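(* Let $E$ be an elliptic curve over $\mathbb{Q}$ given by a Weierstrass equation with integer coefficients, without complex multiplication, and let $P=(x,y)\in E(\mathbb{Q})$ be a point of infinite order with $x,y\in\mathbb{Z}$ and with everywhere good reduction. Let $(\beta_n)$ be the elliptic divisibility sequence of $P$. For $D\ge1$ let $\Sigma(D)$ be the set of Dirichlet characters $\chi$ with $\chi(-1)=1$ whose modulus $q(\chi)$ is a prime $\le D$. Say $\chi$ satisfies $(\ast)$ if there exists $\alpha\in\mathbb{Z}$ with $\gcd(\alpha,\pi(\chi))=1$ and $\chi(|\beta_\alpha|)\notin\{0,1\}$, where $\pi(\chi)$ is the period of $\beta_n\bmod q(\chi)$. Then $$\lim_{D\to\infty}\frac{\#\{\chi\in\Sigma(D):\chi\text{ satisfies }(\ast)\}}{\#\Sigma(D)}=1.$$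
   Context: $P$ has everywhere good reduction means that for every prime $p$ the reduction of $P$ modulo $p$ is a non-singular point of the reduced Weierstrass curve. Let $\psi_n$ be the standard division polynomials of the Weierstrass equation, extended by $\psi_{-n}=-\psi_n$. For $n\neq0$ write $nP=(a_n/e_n^2,b_n/e_n^3)$ with $\gcd(a_nb_n,e_n)=1$, $e_n>0$; the elliptic divisibility sequence is $\beta_0=0$, $\beta_n=\operatorname{sign}(\psi_n(P))e_n/e_1$ for $n\neq0$. The period of $\beta_n\bmod q$ is the least $\pi\ge1$ with $\beta_{n+\pi}\equiv\beta_n\bmod q$ for all $n$. *)

theory Defs
  imports Complex_Main "HOL-Number_Theory.Cong"
begin

section \<open>Weierstrass curves and the group law\<close>

text \<open>The equation is $y^2 + a_1 x y + a_3 y = x^3 + a_2 x^2 + a_4 x + a_6$.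
  Base change along a ring homomorphism is the generated \<open>map_weierstrass\<close>.\<close>

datatype 'a weierstrass =
  Weierstrass (wa1: 'a) (wa2: 'a) (wa3: 'a) (wa4: 'a) (wa6: 'a)

definition wb2 :: "'a::comm_ring_1 weierstrass \<Rightarrow> 'a" where
  "wb2 W = wa1 W ^ 2 + 4 * wa2 W"

definition wb4 :: "'a::comm_ring_1 weierstrass \<Rightarrow> 'a" where
  "wb4 W = 2 * wa4 W + wa1 W * wa3 W"

definition wb6 :: "'a::comm_ring_1 weierstrass \<Rightarrow> 'a" where
  "wb6 W = wa3 W ^ 2 + 4 * wa6 W"

definition wb8 :: "'a::comm_ring_1 weierstrass \<Rightarrow> 'a" where
  "wb8 W = wa1 W ^ 2 * wa6 W + 4 * wa2 W * wa6 W - wa1 W * wa3 W * wa4 W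
           + wa2 W * wa3 W ^ 2 - wa4 W ^ 2"

definition discriminant :: "'a::comm_ring_1 weierstrass \<Rightarrow> 'a" where
  "discriminant W = - (wb2 W ^ 2) * wb8 W - 8 * wb4 W ^ 3 - 27 * wb6 W ^ 2
                    + 9 * wb2 W * wb4 W * wb6 W"

definition on_curve :: "'a::comm_ring_1 weierstrass \<Rightarrow> 'a \<Rightarrow> 'a \<Rightarrow> bool" where
  "on_curve W x y \<longleftrightarrow>
     y ^ 2 + wa1 W * x * y + wa3 W * y = x ^ 3 + wa2 W * x ^ 2 + wa4 W * x + wa6 W"

datatype 'a ec_point = Infinity | Affine 'a 'a

definition ec_points :: "'a::comm_ring_1 weierstrass \<Rightarrow> 'a ec_point set" where
  "ec_points W = insert Infinity {Affine x y | x y. on_curve W x y}"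

fun ec_neg :: "'a::field weierstrass \<Rightarrow> 'a ec_point \<Rightarrow> 'a ec_point" where
  "ec_neg W Infinity = Infinity"
| "ec_neg W (Affine x y) = Affine x (- y - wa1 W * x - wa3 W)"

fun ec_add :: "'a::field weierstrass \<Rightarrow> 'a ec_point \<Rightarrow> 'a ec_point \<Rightarrow> 'a ec_point" where
  "ec_add W Infinity Q = Q"
| "ec_add W (Affine x1 y1) Infinity = Affine x1 y1"
| "ec_add W (Affine x1 y1) (Affine x2 y2) =
     (if x1 = x2 \<and> y2 = - y1 - wa1 W * x1 - wa3 W then Infinity
      else let l = (if x1 = x2
                    then (3 * x1 ^ 2 + 2 * wa2 W * x1 + wa4 W - wa1 W * y1)
                           / (2 * y1 + wa1 W * x1 + wa3 W)
                    else (y2 - y1) / (x2 - x1));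
               x3 = l ^ 2 + wa1 W * l - wa2 W - x1 - x2
           in Affine x3 (- (y1 + l * (x3 - x1)) - wa1 W * x3 - wa3 W))"

definition ec_mult :: "'a::field weierstrass \<Rightarrow> int \<Rightarrow> 'a ec_point \<Rightarrow> 'a ec_point" where
  "ec_mult W n P =
     (if n \<ge> 0 then (ec_add W P ^^ nat n) Infinity
      else ec_neg W ((ec_add W P ^^ nat (- n)) Infinity))"

definition infinite_order :: "'a::field weierstrass \<Rightarrow> 'a ec_point \<Rightarrow> bool" where
  "infinite_order W P \<longleftrightarrow> (\<forall>n. n \<noteq> 0 \<longrightarrow> ec_mult W n P \<noteq> Infinity)"


section \<open>Endomorphisms and complex multiplication\<close>

definition homogeneous_form ::
  "nat \<Rightarrow> ('a::comm_ring_1 \<Rightarrow> 'a \<Rightarrow> 'a \<Rightarrow> 'a) \<Rightarrow> bool" where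
  "homogeneous_form d F \<longleftrightarrow>
     (\<exists>c :: nat \<Rightarrow> nat \<Rightarrow> 'a. \<forall>X Y Z.
        F X Y Z = (\<Sum>i\<le>d. \<Sum>j\<le>d - i. c i j * X ^ i * Y ^ j * Z ^ (d - i - j)))"

fun proj_coords :: "'a::field ec_point \<Rightarrow> 'a \<times> 'a \<times> 'a" where
  "proj_coords Infinity = (0, 1, 0)"
| "proj_coords (Affine x y) = (x, y, 1)"

text \<open>A map from the curve to itself is a morphism of projective varieties if near every point it
  is given by three forms of the same degree without common zero at that point. The forms are
  required to describe the map at every point of the curve where they do not all vanish; as the
  curve is irreducible, this is no restriction.\<close>

definition ec_morphism :: "'a::field weierstrass \<Rightarrow> ('a ec_point \<Rightarrow> 'a ec_point) \<Rightarrow> bool" where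
  "ec_morphism W \<phi> \<longleftrightarrow>
     \<phi> ` ec_points W \<subseteq> ec_points W \<and>
     (\<forall>P \<in> ec_points W. \<exists>d F G H.
        homogeneous_form d F \<and> homogeneous_form d G \<and> homogeneous_form d H \<and>
        (case proj_coords P of (X, Y, Z) \<Rightarrow> (F X Y Z, G X Y Z, H X Y Z) \<noteq> (0, 0, 0)) \<and>
        (\<forall>Q \<in> ec_points W.
           case proj_coords Q of (X, Y, Z) \<Rightarrow>
             (F X Y Z, G X Y Z, H X Y Z) \<noteq> (0, 0, 0) \<longrightarrow>
             (\<exists>t. t \<noteq> 0 \<and>
               (case proj_coords (\<phi> Q) of (X', Y', Z') \<Rightarrow>
                  (F X Y Z, G X Y Z, H X Y Z) = (t * X', t * Y', t * Z')))))"

definition ec_endomorphism :: "'a::field weierstrass \<Rightarrow> ('a ec_point \<Rightarrow> 'a ec_point) \<Rightarrow> bool" where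
  "ec_endomorphism W \<phi> \<longleftrightarrow> ec_morphism W \<phi> \<and> \<phi> Infinity = Infinity"

text \<open>Complex multiplication is geometric: the endomorphisms are those defined over the complex
  numbers, not only those over the field of definition.\<close>

definition has_CM :: "complex weierstrass \<Rightarrow> bool" where
  "has_CM W \<longleftrightarrow>
     (\<exists>\<phi>. ec_endomorphism W \<phi> \<and> (\<forall>m. \<exists>P \<in> ec_points W. \<phi> P \<noteq> ec_mult W m P))"


section \<open>Good reduction of an integral point\<close>

text \<open>An integral point reduces to an affine point modulo every prime; it is singular there iff both
  partial derivatives of the Weierstrass polynomial vanish modulo the prime.\<close>

definition nonsingular_mod :: "int weierstrass \<Rightarrow> int \<Rightarrow> int \<Rightarrow> int \<Rightarrow> bool" where
  "nonsingular_mod W x y p \<longleftrightarrow>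
     \<not> ([wa1 W * y - (3 * x ^ 2 + 2 * wa2 W * x + wa4 W) = 0] (mod p) \<and>
        [2 * y + wa1 W * x + wa3 W = 0] (mod p))"

definition everywhere_good_reduction :: "int weierstrass \<Rightarrow> int \<Rightarrow> int \<Rightarrow> bool" where
  "everywhere_good_reduction W x y \<longleftrightarrow> (\<forall>p. prime p \<longrightarrow> nonsingular_mod W x y p)"


section \<open>Division polynomials and the elliptic divisibility sequence\<close>

text \<open>Values of the division polynomials at a point. In the even-index recurrence
  $\psi_2 \psi_{2m} = \psi_m (\psi_{m+2} \psi_{m-1}^2 - \psi_{m-2} \psi_{m+1}^2)$ the division by
  $\psi_2$ takes place after evaluation, so it gives the right value only at points with
  $\psi_2 \neq 0$, i.e. not of order 2.\<close>

function division_poly_nat :: "'a::field weierstrass \<Rightarrow> 'a \<Rightarrow> 'a \<Rightarrow> nat \<Rightarrow> 'a" where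
  "division_poly_nat W x y n =
     (if n = 0 then 0
      else if n = 1 then 1
      else if n = 2 then 2 * y + wa1 W * x + wa3 W
      else if n = 3 then 3 * x ^ 4 + wb2 W * x ^ 3 + 3 * wb4 W * x ^ 2 + 3 * wb6 W * x + wb8 W
      else if n = 4 then
        (2 * y + wa1 W * x + wa3 W) *
        (2 * x ^ 6 + wb2 W * x ^ 5 + 5 * wb4 W * x ^ 4 + 10 * wb6 W * x ^ 3 + 10 * wb8 W * x ^ 2
          + (wb2 W * wb8 W - wb4 W * wb6 W) * x + (wb4 W * wb8 W - wb6 W ^ 2))
      else if even n then
        division_poly_nat W x y (n div 2) *
        (division_poly_nat W x y (n div 2 + 2) * division_poly_nat W x y (n div 2 - 1) ^ 2
          - division_poly_nat W x y (n div 2 - 2) * division_poly_nat W x y (n div 2 + 1) ^ 2)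
        / (2 * y + wa1 W * x + wa3 W)
      else
        division_poly_nat W x y (n div 2 + 2) * division_poly_nat W x y (n div 2) ^ 3
          - division_poly_nat W x y (n div 2 - 1) * division_poly_nat W x y (n div 2 + 1) ^ 3)"
  by pat_completeness auto
termination
  by (relation "measure (\<lambda>(W, x, y, n). n)", simp, unfold in_measure prod.case) presburger+

declare division_poly_nat.simps [simp del]

definition division_poly :: "'a::field weierstrass \<Rightarrow> 'a \<Rightarrow> 'a \<Rightarrow> int \<Rightarrow> 'a" where
  "division_poly W x y n =
     (if n \<ge> 0 then division_poly_nat W x y (nat n) else - division_poly_nat W x y (nat (- n)))"

abbreviation rat_curve :: "int weierstrass \<Rightarrow> rat weierstrass" where
  "rat_curve W \<equiv> map_weierstrass of_int W"

abbreviation rat_point :: "int \<Rightarrow> int \<Rightarrow> rat ec_point" where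
  "rat_point x y \<equiv> Affine (of_int x) (of_int y)"

definition eds_denom :: "int weierstrass \<Rightarrow> int \<Rightarrow> int \<Rightarrow> int \<Rightarrow> int" where
  "eds_denom W x y n =
     (THE e. e > 0 \<and> (\<exists>a b. coprime (a * b) e \<and>
        ec_mult (rat_curve W) n (rat_point x y)
          = Affine (of_int a / of_int (e ^ 2)) (of_int b / of_int (e ^ 3))))"

text \<open>The point is integral, so \<open>eds_denom W x y 1 = 1\<close> and the integer division below is exact.\<close>

definition eds :: "int weierstrass \<Rightarrow> int \<Rightarrow> int \<Rightarrow> int \<Rightarrow> int" where
  "eds W x y n =
     (if n = 0 then 0
      else (let s = division_poly (rat_curve W) (of_int x) (of_int y) n in
              if s > 0 then 1 else if s < 0 then - 1 else 0)
           * (eds_denom W x y n div eds_denom W x y 1))"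

definition eds_period :: "int weierstrass \<Rightarrow> int \<Rightarrow> int \<Rightarrow> nat \<Rightarrow> nat" where
  "eds_period W x y q =
     (LEAST k. k \<ge> 1 \<and> (\<forall>n. [eds W x y (n + int k) = eds W x y n] (mod int q)))"


section \<open>Dirichlet characters\<close>

definition dirichlet_character :: "nat \<Rightarrow> (int \<Rightarrow> complex) \<Rightarrow> bool" where
  "dirichlet_character q \<chi> \<longleftrightarrow>
     (\<forall>m n. \<chi> (m * n) = \<chi> m * \<chi> n) \<and>
     (\<forall>n. \<chi> (n + int q) = \<chi> n) \<and>
     (\<forall>n. \<chi> n = 0 \<longleftrightarrow> \<not> coprime n (int q))"

text \<open>A character is recorded together with its modulus; principal characters are included.\<close>

definition even_prime_characters :: "real \<Rightarrow> (nat \<times> (int \<Rightarrow> complex)) set" where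
  "even_prime_characters D =
     {(q, \<chi>). prime q \<and> real q \<le> D \<and> dirichlet_character q \<chi> \<and> \<chi> (- 1) = 1}"

definition char_condition ::
  "int weierstrass \<Rightarrow> int \<Rightarrow> int \<Rightarrow> nat \<times> (int \<Rightarrow> complex) \<Rightarrow> bool" where
  "char_condition W x y = (\<lambda>(q, \<chi>).
     \<exists>\<alpha>::int. coprime \<alpha> (int (eds_period W x y q)) \<and> \<chi> \<bar>eds W x y \<alpha>\<bar> \<notin> {0, 1})"

end

theory Submission
  imports
    Defs
    "HOL-Computational_Algebra.Polynomial"
    "HOL-Number_Theory.Residue_Primitive_Roots"
    "HOL-Real_Asymp.Real_Asymp"
begin

text \<open>If \<open>\<chi>\<close> violates the condition, then \<open>\<chi> \<bar>\<beta> a\<bar> \<in> {0, 1}\<close> for all \<open>a\<close> coprime to the period \<open>\<pi>\<close>. For fixed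
  \<open>\<bar>\<beta> a\<bar> > 1\<close>, all but finitely many primes \<open>q\<close> have \<open>\<beta> a\<close> of order at least \<open>T\<close> modulo \<open>q\<close>, and then at
  most the fraction \<open>1 / T\<close> of the even characters modulo \<open>q\<close> is trivial on \<open>\<bar>\<beta> a\<bar>\<close>. As
  \<open>log \<bar>\<beta> a\<bar>\<close> is polynomially bounded in \<open>a\<close>, this holds uniformly for all \<open>a \<le> A\<close> up to polynomially many
  (in \<open>A\<close>) exceptional primes \<open>q\<close>, so \<open>A\<close> may be a small power of \<open>D\<close>.

  It remains to find such an \<open>a \<le> A\<close> coprime to \<open>\<pi>\<close>. The period is at most \<open>q\<^sup>6\<close>, because six consecutive terms
  modulo \<open>q\<close> determine the sequence, so only \<open>O(log D)\<close> primes divide \<open>\<pi>\<close>. For a prime \<open>k\<close> not dividing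
  \<open>\<pi>\<close>, either \<open>\<bar>\<beta> k\<bar> > 1\<close>, or fewer than \<open>k\<^sup>2\<close> indices \<open>l\<close> satisfy \<open>\<bar>\<beta> l\<bar> = \<bar>\<beta> (k * l)\<bar> = 1\<close>, since
  then \<open>\<psi>\<^sub>k\<close> takes the value \<open>1\<close> or \<open>-1\<close> at \<open>l P\<close>. So some prime \<open>l\<close> makes \<open>a = l\<close> or \<open>a = k * l\<close> work.
  The elliptic identities for \<open>\<psi>\<close> follow from the chord construction alone, without the group law.\<close>

section \<open>Multiples of a point and the elliptic identities\<close>

text \<open>The multiples of a point in the model \<open>Y\<^sup>2 = 4 X\<^sup>3 + b2 X\<^sup>2 + 2 b4 X + b6\<close>, each obtained from the
  preceding one by the chord or tangent construction with the first.\<close>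

locale chord_sequence =
  fixes X Y :: "nat \<Rightarrow> 'a::field_char_0" and b2 b4 b6 b8 :: 'a
  assumes b8: "4 * b8 = b2 * b6 - b4 ^ 2"
    and curve: "n \<ge> 1 \<Longrightarrow> Y n ^ 2 = 4 * X n ^ 3 + b2 * X n ^ 2 + 2 * b4 * X n + b6"
    and X_neq_X1: "n \<ge> 2 \<Longrightarrow> X n \<noteq> X 1"
    and Y1_nz: "Y 1 \<noteq> 0"
    and X2_eq: "X 2 = ((6 * X 1 ^ 2 + b2 * X 1 + b4) / Y 1) ^ 2 / 4 - b2 / 4 - 2 * X 1"
    and Y2_eq: "Y 2 = - (Y 1 + (6 * X 1 ^ 2 + b2 * X 1 + b4) / Y 1 * (X 2 - X 1))"
    and X_Suc: "n \<ge> 2 \<Longrightarrow>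
      X (Suc n) = ((Y n - Y 1) / (X n - X 1)) ^ 2 / 4 - b2 / 4 - X n - X 1"
    and Y_Suc: "n \<ge> 2 \<Longrightarrow>
      Y (Suc n) = - (Y 1 + (Y n - Y 1) / (X n - X 1) * (X (Suc n) - X 1))"
begin

text \<open>If \<open>a\<close>, \<open>b\<close> are the first coordinates of points \<open>A\<close>, \<open>B\<close>, then \<open>S a b\<close>, \<open>R a b\<close> and \<open>G a b c\<close>
  are \<open>(a - b)\<^sup>2\<close> times the sum of the first coordinates \<open>u\<close>, \<open>v\<close> of \<open>A + B\<close> and \<open>A - B\<close>, their product, and
  \<open>(u - c) * (v - c)\<close>. The symmetry of \<open>G\<close> in all three arguments replaces the group law below.\<close>

definition S :: "'a \<Rightarrow> 'a \<Rightarrow> 'a" where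
  "S a b = 2 * a * b * (a + b) + b2 * a * b + b4 * (a + b) + b6"

definition R :: "'a \<Rightarrow> 'a \<Rightarrow> 'a" where
  "R a b = a ^ 2 * b ^ 2 - b4 * a * b - b6 * (a + b) - b8"

definition G :: "'a \<Rightarrow> 'a \<Rightarrow> 'a \<Rightarrow> 'a" where
  "G a b c = c ^ 2 * (a - b) ^ 2 - c * S a b + R a b"

lemma G_swap: "G a b c = G c b a" "G a b c = G b a c"
  by (simp_all add: G_def S_def R_def) Groebner_Basis.algebra+

text \<open>The line through the points \<open>n - 1\<close> and \<open>1\<close> also passes
  through the negative of the point \<open>n\<close>, so its slope is
  \<open>- (Y n + Y 1) / (X n - X 1)\<close> as well, and the relation between slope and first
  coordinates is symmetric in the three points.\<close>

lemma X_pred: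
  assumes "n \<ge> 2"
  shows "X (n - 1) = ((Y n + Y 1) / (X n - X 1)) ^ 2 / 4 - b2 / 4 - X n - X 1"
proof -
  obtain m where m: "n = Suc m" "m \<ge> 1" using assms by (cases n) auto
  define M where "M = (if m = 1 then (6 * X 1 ^ 2 + b2 * X 1 + b4) / Y 1
    else (Y m - Y 1) / (X m - X 1))"
  have X: "X n = M ^ 2 / 4 - b2 / 4 - X m - X 1" and Y: "Y n = - (Y 1 + M * (X n - X 1))"
    using X2_eq Y2_eq X_Suc[of m] Y_Suc[of m] m
    by (auto simp: M_def numeral_2_eq_2)
  have "X n - X 1 \<noteq> 0" using X_neq_X1[OF assms] by simp
  hence "(Y n + Y 1) / (X n - X 1) = - M" using Y by (simp add: field_simps)
  thus ?thesis using X m by simp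
qed

text \<open>The two expressions are the first coordinates of sum and difference of two points, with
  \<open>d\<close> for the reciprocal of \<open>x - x1\<close>. Their sum and product are even in
  \<open>y\<close> and in \<open>y1\<close>, so the equations of the curve eliminate both.\<close>

lemma chord_aux:
  fixes x x1 y y1 c u d :: 'a
  assumes y: "y ^ 2 = 4 * x ^ 3 + b2 * x ^ 2 + 2 * b4 * x + b6"
    and y1: "y1 ^ 2 = 4 * x1 ^ 3 + b2 * x1 ^ 2 + 2 * b4 * x1 + b6"
    and d: "d * (x - x1) = 1"
  shows "((((y - y1) * d) ^ 2 / 4 - b2 / 4 - x - x1) + (((y + y1) * d) ^ 2 / 4 - b2 / 4 - x - x1)) 
      * (x - x1) ^ 2 = S x x1"
   and "((((y - y1) * d) ^ 2 / 4 - b2 / 4 - x - x1) * (((y + y1) * d) ^ 2 / 4 - b2 / 4 - x - x1)) 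
      * (x - x1) ^ 2 = R x x1"
proof -
  define p where "p = y ^ 2 + y1 ^ 2"
  let ?e = "x - x1"
  have de: "d ^ 2 * ?e ^ 2 = 1" using d by (metis power_mult_distrib power_one)
  have "((((y - y1) * d) ^ 2 / 4 - b2 / 4 - x - x1) + (((y + y1) * d) ^ 2 / 4 - b2 / 4 - x - x1)) 
      * ?e ^ 2 = (y^2 + y1^2) / 2 * (d^2 * ?e^2) - (b2 / 2 + 2 * x + 2 * x1) * ?e ^ 2"
    by (simp add: field_simps power2_eq_square)
  also have "\<dots> = S x x1"
    unfolding de y y1 S_def by (simp add: field_simps power2_eq_square power3_eq_cube)
  finally show "((((y - y1) * d) ^ 2 / 4 - b2 / 4 - x - x1) + (((y + y1) * d) ^ 2 / 4 - b2 / 4 - x - x1)) 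
      * ?e ^ 2 = S x x1" .
  let ?k = "b2 / 4 + x + x1"
  let ?A = "(((y - y1) * d) ^ 2 / 4 - b2 / 4 - x - x1)" and ?B = "(((y + y1) * d) ^ 2 / 4 - b2 / 4 - x - x1)"
  let ?A' = "(y - y1)^2 - 4 * ?k * ?e ^ 2" and ?B' = "(y + y1)^2 - 4 * ?k * ?e ^ 2"
  have A: "4 * (?A * ?e ^ 2) = ?A'" 
    using de by (simp add: field_simps power2_eq_square) Groebner_Basis.algebra
  have B: "4 * (?B * ?e ^ 2) = ?B'" 
    using de by (simp add: field_simps power2_eq_square) Groebner_Basis.algebra
  have e0: "?e \<noteq> 0" using d by auto
  have *: "16 * (a * b * c) * c = 4 * (a * c) * (4 * (b * c))" for a b c :: 'a
    by simp
  have "16 * (?A * ?B * ?e ^ 2) * ?e ^ 2 = ?A' * ?B'" 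
    unfolding A[symmetric] B[symmetric] by (rule *)
  also have "\<dots> = (y^2 - y1^2)^2 - 8 * ?k * ?e^2 * (y^2 + y1^2) + 16 * ?k^2 * ?e ^ 4"
    by (simp add: algebra_simps power2_eq_square power4_eq_xxxx)
  \<comment> \<open>On the curve this difference is divisible by \<open>x - x1\<close>, which lets a
    factor \<open>(x - x1) ^ 2\<close> cancel.\<close>
  also have "(y^2 - y1^2) = ?e * (4 * (x^2 + x * x1 + x1^2) + b2 * (x + x1) + 2 * b4)"
    unfolding y y1 by (simp add: algebra_simps power2_eq_square power3_eq_cube)
  also have "(?e * (4 * (x^2 + x * x1 + x1^2) + b2 * (x + x1) + 2 * b4))^2 - 8 * ?k * ?e^2 * (y^2 + y1^2) + 16 * ?k^2 * ?e ^ 4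
     = ((4 * (x^2 + x * x1 + x1^2) + b2 * (x + x1) + 2 * b4)^2 - 8 * ?k * (y^2 + y1^2) + 16 * ?k^2 * ?e ^ 2) * ?e ^ 2"
    by (simp add: algebra_simps power2_eq_square power4_eq_xxxx)
  finally have "16 * (?A * ?B * ?e ^ 2) = ((4 * (x^2 + x * x1 + x1^2) + b2 * (x + x1) + 2 * b4)^2 
    - 8 * ?k * (y^2 + y1^2) + 16 * ?k^2 * ?e ^ 2)"
    using e0 by simp
  also have "\<dots> = 16 * (x ^ 2 * x1 ^ 2 - b4 * x * x1 - b6 * (x + x1)) - 4 * (b2 * b6 - b4 ^ 2)"
    unfolding y y1 by (simp add: algebra_simps power2_eq_square power3_eq_cube)
  also have "\<dots> = 16 * R x x1"
    unfolding R_def b8[symmetric] by (simp add: algebra_simps)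
  finally show "?A * ?B * ?e ^ 2 = R x x1" by simp
qed

lemma X_sum_prod:
  assumes "n \<ge> 2"
  shows "(X (Suc n) + X (n - 1)) * (X n - X 1) ^ 2 = S (X n) (X 1)"
    and "(X (Suc n) * X (n - 1)) * (X n - X 1) ^ 2 = R (X n) (X 1)"
proof -
  have d: "1 / (X n - X 1) * (X n - X 1) = 1" using X_neq_X1[OF assms] by simp
  show "(X (Suc n) + X (n - 1)) * (X n - X 1) ^ 2 = S (X n) (X 1)"
    and "(X (Suc n) * X (n - 1)) * (X n - X 1) ^ 2 = R (X n) (X 1)"
    using chord_aux[OF curve[of n] curve[of 1] d] assms X_pred[OF assms] X_Suc[OF assms] by simp_all
qed

lemma G_chord:
  assumes "n \<ge> 2"
  shows "(X (Suc n) - c) * (X (n - 1) - c) * (X n - X 1) ^ 2 = G (X n) (X 1) c"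
proof -
  have "(X (Suc n) - c) * (X (n - 1) - c) * (X n - X 1) ^ 2 = (X (Suc n) * X (n - 1)) * (X n - X 1) ^ 2
    - c * ((X (Suc n) + X (n - 1)) * (X n - X 1) ^ 2) + c ^ 2 * (X n - X 1) ^ 2"
    by (simp add: algebra_simps power2_eq_square)
  thus ?thesis unfolding X_sum_prod[OF assms] G_def by simp
qed

lemma X_diff:
  assumes "n \<ge> 2"
  shows "(X (n - 1) - X (Suc n)) * (X n - X 1) ^ 2 = Y n * Y 1"
proof -
  have "X n - X 1 \<noteq> 0" using X_neq_X1[OF assms] by simp
  have *: "((a + b) / u) ^ 2 / 4 - ((a - b) / u) ^ 2 / 4 = a * b / u ^ 2" for a b u :: 'a
  proof -
    have "(a + b) ^ 2 = (a - b) ^ 2 + 4 * (a * b)"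
      by (simp add: power2_eq_square algebra_simps)
    thus ?thesis unfolding power_divide by (simp only: add_divide_distrib) simp
  qed
  have "X (n - 1) - X (Suc n) = Y n * Y 1 / (X n - X 1) ^ 2"
    unfolding X_pred[OF assms] X_Suc[OF assms] *[symmetric] by simp
  thus ?thesis using \<open>X n - X 1 \<noteq> 0\<close> by simp
qed

lemma X2_dup: "Y 1 ^ 2 * X 2 = R (X 1) (X 1)"
proof -
  have "4 * (Y 1 ^ 2 * X 2) = (6 * X 1 ^ 2 + b2 * X 1 + b4)^2 - (b2 + 8 * X 1) * Y 1 ^ 2"
    using Y1_nz unfolding X2_eq by (simp add: field_simps)
  also have "\<dots> = 4 * (X 1 ^ 2 * X 1 ^ 2 - b4 * X 1 * X 1 - b6 * (X 1 + X 1)) - (b2 * b6 - b4 ^ 2)"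
    unfolding curve[OF order_refl] by (simp add: algebra_simps power2_eq_square power3_eq_cube)
  also have "\<dots> = 4 * R (X 1) (X 1)"
    unfolding R_def b8[symmetric] by (simp add: algebra_simps)
  finally show ?thesis by simp
qed

lemma S_diag:
  assumes "n \<ge> 1"
  shows "S (X n) (X n) = Y n ^ 2"
  unfolding S_def curve[OF assms] by (simp add: algebra_simps power2_eq_square power3_eq_cube)

text \<open>These turn out to be the values of the division polynomials. The recursion is the
  classical \<open>x(n P) = x(P) - \<psi>(n + 1) * \<psi>(n - 1) / \<psi>(n) ^ 2\<close> solved for
  the next term; for \<open>H 2\<close> it would divide by \<open>H 0 = 0\<close>, so this value is
  set directly.\<close>

fun H :: "nat \<Rightarrow> 'a" where
  "H 0 = 0"
| "H (Suc 0) = 1"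
| "H (Suc (Suc n)) = (if n = 0 then Y 1 else H (Suc n) ^ 2 * (X 1 - X (Suc n)) / H n)"

lemma H_nz: "n \<ge> 1 \<Longrightarrow> H n \<noteq> 0"
proof (induction n rule: H.induct)
  case (3 n)
  show ?case
  proof (cases "n = 0")
    case False
    thus ?thesis using 3 X_neq_X1[of "Suc n"] by auto
  qed (use Y1_nz in auto)
qed auto

lemma H_2 [simp]: "H 2 = Y 1" by (simp add: numeral_2_eq_2)

lemma H_step: "n \<ge> 1 \<Longrightarrow> H (Suc n) * H (n - 1) = H n ^ 2 * (X 1 - X n)"
  by (cases "n = 1") (use H_nz[of "n - 1"] in \<open>cases n; force simp: not_less_eq_eq\<close>)+

declare H.simps(3) [simp del]

text \<open>Multiplied by \<open>H m ^ 2\<close>, the left side splits into two instances of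
  \<open>H_step\<close>. The symmetry of \<open>G\<close> then trades the chord through the points
  \<open>m\<close> and \<open>1\<close> for the tangent at the point \<open>1\<close>, which brings
  in \<open>X 2\<close>.\<close>

lemma H_diff_2:
  assumes "m \<ge> 3"
  shows "H (m + 2) * H (m - 2) = H m ^ 2 * H 2 ^ 2 * (X 2 - X m)"
proof -
  have "H (m + 2) * H m = H (m + 1) ^ 2 * (X 1 - X (m + 1))"
    "H m * H (m - 2) = H (m - 1) ^ 2 * (X 1 - X (m - 1))"
    "H (m + 1) * H (m - 1) = H m ^ 2 * (X 1 - X m)"
    using H_step[of "m + 1"] H_step[of "m - 1"] H_step[of m] assms
    by (simp_all add: numeral_2_eq_2 Suc_diff_Suc)
  note 1 = this
  have "(H (m + 2) * H (m - 2)) * H m ^ 2 = (H (m + 2) * H m) * (H m * H (m - 2))"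
    by (simp add: power2_eq_square)
  also have "\<dots> = (H (m + 1) * H (m - 1)) ^ 2 * ((X (m + 1) - X 1) * (X (m - 1) - X 1))"
    unfolding 1(1,2) by (simp add: algebra_simps power2_eq_square)
  also have "\<dots> = H m ^ 4 * ((X (Suc m) - X 1) * (X (m - 1) - X 1) * (X m - X 1) ^ 2)"
    unfolding 1(3) by (simp add: algebra_simps power2_eq_square power4_eq_xxxx)
  also have "\<dots> = H m ^ 4 * G (X m) (X 1) (X 1)"
    using G_chord[of m "X 1"] assms by simp
  also have "G (X m) (X 1) (X 1) = G (X 1) (X 1) (X m)" by (rule G_swap)
  also have "\<dots> = Y 1 ^ 2 * X 2 - X m * Y 1 ^ 2"
    unfolding G_def X2_dup using S_diag[of 1] by simp
  finally have "(H (m + 2) * H (m - 2)) * H m ^ 2 = (H m ^ 2 * H 2 ^ 2 * (X 2 - X m)) * H m ^ 2"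
    by (simp add: algebra_simps power2_eq_square power4_eq_xxxx)
  thus ?thesis using H_nz[of m] assms by simp
qed

text \<open>For \<open>k = n + 1\<close>, the instances of \<open>n\<close> at \<open>m + 1\<close>
  and at \<open>m - 1\<close> are multiplied and divided by the instance of \<open>n - 1\<close> at
  \<open>m\<close>. What remains is that the chord from \<open>1\<close> to \<open>m\<close>
  evaluated at \<open>X n\<close> agrees with the chord from \<open>1\<close> to \<open>n\<close>
  evaluated at \<open>X m\<close>: the symmetry of \<open>G\<close>.\<close>

theorem H_diff:
  assumes "1 \<le> n" "n < m"
  shows "H (m + n) * H (m - n) = H m ^ 2 * H n ^ 2 * (X n - X m)"
  using assms
proof (induction n arbitrary: m rule: less_induct)
  case (less k)
  consider "k = 1" | "k = 2" | n where "k = Suc n" "n \<ge> 2"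
    using less.prems by (metis Suc_1 Suc_le_D le_SucE le_antisym not_less_eq_eq One_nat_def)
  thus ?case
  proof cases
    case 1
    thus ?thesis using H_step[of m] less.prems by simp
  next
    case 2
    thus ?thesis using H_diff_2[of m] less.prems by simp
  next
    case 3
    note k = 3
    have m: "m > n + 1" "m \<ge> 2" using less.prems k by auto
    define u where "u = m - Suc n"
    have mu: "m = u + Suc n" using m by (simp add: u_def)
    have u: "u \<ge> 1" using m mu by auto
    have IH1: "H (m + 1 + n) * H (m + 1 - n) = H (m + 1) ^ 2 * H n ^ 2 * (X n - X (m + 1))"
      by (rule less.IH) (use k m in auto)
    have IH2: "H (m - 1 + n) * H (m - 1 - n) = H (m - 1) ^ 2 * H n ^ 2 * (X n - X (m - 1))"
      by (rule less.IH) (use k m in auto)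
    have IH3: "H (m + (n - 1)) * H (m - (n - 1)) = H m ^ 2 * H (n - 1) ^ 2 * (X (n - 1) - X m)"
      by (rule less.IH) (use k m in auto)
    have idx: "m + 1 + n = m + k" "m - 1 - n = m - k" "m - 1 + n = m + (n - 1)" "m + 1 - n = m - (n - 1)"
      using k m by auto
    have nz: "H (m + (n - 1)) * H (m - (n - 1)) \<noteq> 0" 
      using H_nz k m by simp
    have sm: "H (m + 1) * H (m - 1) = H m ^ 2 * (X 1 - X m)" using H_step[of m] m by simp
    have sn: "H k * H (n - 1) = H n ^ 2 * (X 1 - X n)" using H_step[of n] k by simp
    have Gm: "(X (m + 1) - X n) * (X (m - 1) - X n) * (X m - X 1) ^ 2 = G (X m) (X 1) (X n)"
      using G_chord[of m] m by simp
    have Gn: "(X k - X m) * (X (n - 1) - X m) * (X n - X 1) ^ 2 = G (X m) (X 1) (X n)"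
      using G_chord[of n] k G_swap by simp
    have "(H (m + k) * H (m - k)) * (H (m + (n - 1)) * H (m - (n - 1))) =
      (H (m + 1 + n) * H (m + 1 - n)) * (H (m - 1 + n) * H (m - 1 - n))"
      unfolding idx by simp
    also have "\<dots> = (H (m + 1) * H (m - 1))^2 * H n ^ 4 * ((X (m + 1) - X n) * (X (m - 1) - X n))"
      unfolding IH1 IH2 by (simp add: algebra_simps power2_eq_square power4_eq_xxxx)
    also have "\<dots> = H m ^ 4 * H n ^ 4 * G (X m) (X 1) (X n)"
      unfolding sm Gm[symmetric] by (simp add: algebra_simps power2_eq_square power4_eq_xxxx)
    also have "\<dots> = H m ^ 4 * (H n ^ 2 * (X 1 - X n)) ^ 2 * ((X k - X m) * (X (n - 1) - X m))"
      unfolding Gn[symmetric] by (simp add: algebra_simps power2_eq_square power4_eq_xxxx)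
    also have "\<dots> = (H m ^ 2 * H k ^ 2 * (X k - X m)) * (H (m + (n - 1)) * H (m - (n - 1)))"
      unfolding sn[symmetric] IH3 by (simp add: algebra_simps power2_eq_square power4_eq_xxxx)
    finally show ?thesis using nz by simp
  qed
qed

text \<open>The indices \<open>n + 1\<close> and \<open>n - 1\<close> have sum \<open>2 * n\<close>
  and difference \<open>2\<close>, and \<open>X_diff\<close> knows the difference of their first
  coordinates.\<close>

lemma H_double:
  assumes "n \<ge> 1"
  shows "H (2 * n) = H n ^ 4 * Y n"
proof (cases "n \<ge> 3")
  case True
  have "H (2 * n) * H 2 = H (n + 1) ^ 2 * H (n - 1) ^ 2 * (X (n - 1) - X (n + 1))"
    using H_diff[of "n - 1" "n + 1"] True by (simp add: mult_2 numeral_2_eq_2 Suc_diff_le)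
  also have "\<dots> = (H (Suc n) * H (n - 1)) ^ 2 * (X (n - 1) - X (Suc n))"
    by (simp add: power2_eq_square)
  also have "\<dots> = H n ^ 4 * ((X (n - 1) - X (Suc n)) * (X n - X 1) ^ 2)"
    unfolding H_step[OF assms] by (simp add: power2_eq_square power4_eq_xxxx algebra_simps)
  also have "\<dots> = H n ^ 4 * (Y n * Y 1)" using X_diff True by simp
  finally show ?thesis using Y1_nz by simp
next
  case False
  hence "n = 1 \<or> n = 2" using assms by auto
  thus ?thesis
  proof
    assume n: "n = 2"
    have 4: "H 4 * H 2 = H 3 ^ 2 * (X 1 - X 3)" and 3: "H 3 = H 2 ^ 2 * (X 1 - X 2)"
      using H_step[of 3] H_step[of 2] by (simp_all add: numeral_eq_Suc)
    have "H 4 * H 2 = H 2 ^ 4 * ((X 1 - X 3) * (X 2 - X 1) ^ 2)"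
      unfolding 3 4 by (simp add: power2_eq_square power4_eq_xxxx algebra_simps)
    also have "(X 1 - X 3) * (X 2 - X 1) ^ 2 = Y 2 * Y 1"
      using X_diff[of 2] by (simp add: numeral_3_eq_3)
    finally show ?thesis using Y1_nz n by simp
  qed auto
qed

text \<open>The chord construction only ever adds the first point, so the duplication formula at the
  point \<open>n\<close> is read off from \<open>H (2 * n + 1) * H (2 * n - 1)\<close>, computed
  once by \<open>H_step\<close> and once by \<open>H_diff\<close>.\<close>

lemma X_dup:
  assumes "n \<ge> 1"
  shows "Y n ^ 2 * X (2 * n) = R (X n) (X n)"
proof (cases "n \<ge> 2")
  case False
  thus ?thesis using X2_dup assms by (cases "n = 1") (auto simp: numeral_2_eq_2)
next
  case True
  have a: "H (Suc (2 * n)) = H (n + 1) ^ 2 * H n ^ 2 * (X n - X (n + 1))"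
    using H_diff[of n "n + 1"] assms by (simp add: mult_2)
  have b: "H (2 * n - 1) = H n ^ 2 * H (n - 1) ^ 2 * (X (n - 1) - X n)"
    using H_diff[of "n - 1" "n"] True by (simp add: mult_2)
  have "H (2 * n) ^ 2 * (X 1 - X (2 * n)) = (H (Suc n) * H (n - 1)) ^ 2 * H n ^ 4 * ((X n - X (n + 1)) * (X (n - 1) - X n))"
    using H_step[of "2 * n"] assms unfolding a b by (simp add: algebra_simps power2_eq_square power4_eq_xxxx)
  also have "\<dots> = - (H n ^ 8 * ((X (Suc n) - X n) * (X (n - 1) - X n) * (X n - X 1) ^ 2))"
    unfolding H_step[OF assms] by (simp add: algebra_simps eval_nat_numeral)
  also have "\<dots> = - (H n ^ 8 * G (X n) (X 1) (X n))"
    using G_chord True by simp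
  also have "G (X n) (X 1) (X n) = G (X n) (X n) (X 1)" by (metis G_swap)
  also have "\<dots> = R (X n) (X n) - X 1 * Y n ^ 2"
    unfolding G_def S_diag[OF assms] by simp
  finally have "H n ^ 8 * (Y n ^ 2 * (X 1 - X (2 * n))) = - (H n ^ 8 * (R (X n) (X n) - X 1 * Y n ^ 2))"
    unfolding H_double[OF assms] by (simp add: algebra_simps eval_nat_numeral)
  hence "H n ^ 8 * (Y n ^ 2 * (X 1 - X (2 * n)) + (R (X n) (X n) - X 1 * Y n ^ 2)) = 0"
    unfolding distrib_left by simp
  hence "Y n ^ 2 * (X 1 - X (2 * n)) + (R (X n) (X n) - X 1 * Y n ^ 2) = 0"
    using H_nz[OF assms] by (simp del: One_nat_def)
  thus ?thesis by (simp add: algebra_simps)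
qed

lemma X_inj:
  assumes "1 \<le> n" "n < m"
  shows "X n \<noteq> X m"
  using H_diff[OF assms] H_nz[of "m + n"] H_nz[of "m - n"] assms by auto

end

section \<open>Multiplication polynomials\<close>

text \<open>The value \<open>c = 0\<close> is allowed, so summands of lower degree take part in sums
  with coefficient \<open>0\<close> and no cancellation has to be excluded.\<close>

definition leading_term :: "'a::comm_ring_1 poly \<Rightarrow> nat \<Rightarrow> 'a \<Rightarrow> bool" where
  "leading_term p d c \<longleftrightarrow> degree p \<le> d \<and> Polynomial.coeff p d = c"

lemma leading_term_mult:
  assumes "leading_term p d c" "leading_term q e c'"
  shows "leading_term (p * q) (d + e) (c * c')"
proof -
  have "degree (p * q) \<le> d + e"
    using assms degree_mult_le[of p q] by (auto simp: leading_term_def)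
  moreover have "Polynomial.coeff (p * q) (d + e) = (\<Sum>i\<le>d + e. if i = d then c * c' else 0)"
    unfolding coeff_mult
  proof (rule sum.cong)
    fix i assume "i \<in> {..d + e}"
    consider "i = d" | "i < d" "d + e - i > e" | "i > d" using \<open>i \<in> _\<close> by fastforce
    thus "Polynomial.coeff p i * Polynomial.coeff q (d + e - i) = (if i = d then c * c' else 0)"
      by cases (use assms in \<open>auto simp: leading_term_def coeff_eq_0\<close>)
  qed auto
  ultimately show ?thesis by (simp add: leading_term_def)
qed

lemma leading_term_add:
  "leading_term p d c \<Longrightarrow> leading_term q d c' \<Longrightarrow> leading_term (p + q) d (c + c')"
  by (auto simp: leading_term_def degree_add_le)

lemma leading_term_diff:
  "leading_term p d c \<Longrightarrow> leading_term q d c' \<Longrightarrow> leading_term (p - q) d (c - c')"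
  by (auto simp: leading_term_def degree_diff_le)

lemma leading_term_smult:
  "leading_term p d c \<Longrightarrow> leading_term (Polynomial.smult b p) d (b * c)"
  by (auto simp: leading_term_def intro: order_trans[OF degree_smult_le])

lemma leading_term_less:
  "leading_term p d c \<Longrightarrow> d < e \<Longrightarrow> leading_term p e 0"
  by (auto simp: leading_term_def coeff_eq_0)

lemma leading_term_power:
  "leading_term p d c \<Longrightarrow> leading_term (p ^ k) (k * d) (c ^ k)"
  by (induction k) (auto intro: leading_term_mult simp: leading_term_def[of 1])

context chord_sequence begin

section \<open>The addition formula for first coordinates\<close>

lemma H_nz' [simp]: "n > 0 \<Longrightarrow> H n \<noteq> 0"
  using H_nz by simp

text \<open>This and \<open>G_Xm\<close> check the addition formula for the points \<open>m\<close>
  and \<open>n\<close> at one value of \<open>c\<close> each. Here the instances of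
  \<open>H_step\<close> at \<open>m + n\<close> and \<open>m - n\<close> are regrouped into
  instances of \<open>H_diff\<close> at \<open>m + 1\<close> and \<open>m - 1\<close>.\<close>

lemma G_X1:
  assumes "1 \<le> n" "n < m"
  shows "(X (m + n) - X 1) * (X (m - n) - X 1) * (X m - X n) ^ 2 = G (X m) (X n) (X 1)"
proof -
  have s1: "H (m + n + 1) * H (m + n - 1) = H (m + n) ^ 2 * (X 1 - X (m + n))"
    and s2: "H (m - n + 1) * H (m - n - 1) = H (m - n) ^ 2 * (X 1 - X (m - n))"
    and s3: "H (m + 1) * H (m - 1) = H m ^ 2 * (X 1 - X m)"
    using H_step[of "m + n"] H_step[of "m - n"] H_step[of m] assms by simp_all
  have d1: "H (m + n + 1) * H (m - n + 1) = H (m + 1) ^ 2 * H n ^ 2 * (X n - X (m + 1))"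
    using H_diff[of n "m + 1"] assms by (simp add: Suc_diff_le)
  have d2: "H (m + n - 1) * H (m - n - 1) = H (m - 1) ^ 2 * H n ^ 2 * (X n - X (m - 1))"
  \<comment> \<open>For \<open>n = m - 1\<close> both sides vanish, the left one because
    \<open>H 0 = 0\<close>.\<close>
  proof (cases "n = m - 1")
    case False
    hence "m - 1 + n = m + n - 1" "m - 1 - n = m - n - 1" "n < m - 1" using assms by auto
    thus ?thesis using H_diff[of n "m - 1"] assms by metis
  qed auto
  have d3: "H (m + n) * H (m - n) = H m ^ 2 * H n ^ 2 * (X n - X m)"
    using H_diff assms by simp
  have "(H (m + n) * H (m - n)) ^ 2 * ((X (m + n) - X 1) * (X (m - n) - X 1))
    = (H (m + n) ^ 2 * (X 1 - X (m + n))) * (H (m - n) ^ 2 * (X 1 - X (m - n)))"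
    by (simp add: algebra_simps power2_eq_square)
  also have "\<dots> = (H (m + n + 1) * H (m - n + 1)) * (H (m + n - 1) * H (m - n - 1))"
    unfolding s1[symmetric] s2[symmetric] by simp
  also have "\<dots> = (H (m + 1) * H (m - 1)) ^ 2 * H n ^ 4 * ((X (m + 1) - X n) * (X (m - 1) - X n))"
    unfolding d1 d2 by (simp add: algebra_simps eval_nat_numeral)
  also have "\<dots> = H m ^ 4 * H n ^ 4 * ((X (Suc m) - X n) * (X (m - 1) - X n) * (X m - X 1) ^ 2)"
    unfolding s3 by (simp add: algebra_simps eval_nat_numeral)
  also have "\<dots> = H m ^ 4 * H n ^ 4 * G (X m) (X 1) (X n)"
    using G_chord[of m] assms by simp
  also have "G (X m) (X 1) (X n) = G (X m) (X n) (X 1)" by (metis G_swap)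
  finally have "H m ^ 4 * H n ^ 4 * ((X (m + n) - X 1) * (X (m - n) - X 1) * (X m - X n) ^ 2)
    = H m ^ 4 * H n ^ 4 * G (X m) (X n) (X 1)"
    unfolding d3 by (simp add: algebra_simps eval_nat_numeral)
  thus ?thesis using assms by simp
qed

text \<open>The product \<open>H (2 * m + n) * H (2 * m - n)\<close> is evaluated in two ways: each
  factor paired with \<open>H n\<close>, and the two factors paired with each other. The second way
  produces \<open>X (2 * m)\<close>, which \<open>X_dup\<close> eliminates.\<close>

lemma G_Xm:
  assumes "1 \<le> n" "n < m"
  shows "(X (m + n) - X m) * (X (m - n) - X m) * (X m - X n) ^ 2 = G (X m) (X n) (X m)"
proof -
  have d1: "H (2 * m + n) * H n = H (m + n) ^ 2 * H m ^ 2 * (X m - X (m + n))"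
    using H_diff[of m "m + n"] assms by (simp add: mult_2 add_ac)
  have d2: "H (2 * m - n) * H n = H m ^ 2 * H (m - n) ^ 2 * (X (m - n) - X m)"
    using H_diff[of "m - n" "m"] assms by (simp add: mult_2)
  have d3: "H (m + n) * H (m - n) = H m ^ 2 * H n ^ 2 * (X n - X m)"
    using H_diff assms by simp
  have d4: "H (2 * m + n) * H (2 * m - n) = H (2 * m) ^ 2 * H n ^ 2 * (X n - X (2 * m))"
    using H_diff[of n "2 * m"] assms by simp
  have "- (H m ^ 8 * H n ^ 4 * ((X (m + n) - X m) * (X (m - n) - X m) * (X m - X n) ^ 2))
    = (H m ^ 2 * H n ^ 2 * (X n - X m)) ^ 2 * H m ^ 4 * ((X m - X (m + n)) * (X (m - n) - X m))"
    by (simp add: algebra_simps eval_nat_numeral)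
  also have "\<dots> = (H (2 * m + n) * H n) * (H (2 * m - n) * H n)"
    unfolding d3[symmetric] d1 d2 by (simp add: algebra_simps eval_nat_numeral)
  also have "\<dots> = (H (2 * m + n) * H (2 * m - n)) * H n ^ 2"
    by (simp add: power2_eq_square)
  also have "\<dots> = H m ^ 8 * H n ^ 4 * (X n * Y m ^ 2 - Y m ^ 2 * X (2 * m))"
    unfolding d4 using H_double[of m] assms by (simp add: algebra_simps eval_nat_numeral)
  also have "\<dots> = - (H m ^ 8 * H n ^ 4 * G (X m) (X m) (X n))"
    using X_dup[of m] assms S_diag[of m] by (simp add: G_def algebra_simps)
  also have "G (X m) (X m) (X n) = G (X m) (X n) (X m)" by (metis G_swap)
  finally show ?thesis using assms by simp
qed

text \<open>As quadratics in \<open>c\<close> both sides of the formula have the same leading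
  coefficient, so their difference is linear in \<open>c\<close>; it vanishes at the distinct values
  \<open>X 1\<close> and \<open>X m\<close>.\<close>

lemma X_addition:
  assumes "1 \<le> n" "n < m"
  shows "(X (m + n) + X (m - n)) * (X m - X n) ^ 2 = S (X m) (X n)"
proof -
  define s where "s = (X (m + n) + X (m - n)) * (X m - X n) ^ 2"
  define p where "p = (X (m + n) * X (m - n)) * (X m - X n) ^ 2"
  have *: "(X (m + n) - c) * (X (m - n) - c) * (X m - X n) ^ 2 - G (X m) (X n) c
    = p - R (X m) (X n) - c * (s - S (X m) (X n))" for c
    by (simp add: s_def p_def G_def algebra_simps power2_eq_square)
  have "p - R (X m) (X n) - X 1 * (s - S (X m) (X n)) = 0"
    using G_X1[OF assms] *[of "X 1"] by simp
  moreover have "p - R (X m) (X n) - X m * (s - S (X m) (X n)) = 0"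
    using G_Xm[OF assms] *[of "X m"] by simp
  ultimately have "(X m - X 1) * (s - S (X m) (X n)) = 0" by Groebner_Basis.algebra
  thus ?thesis using X_neq_X1[of m] assms by (auto simp: s_def)
qed

text \<open>Classical numerator and denominator of multiplication by \<open>k\<close> on first
  coordinates. The induction halves \<open>k\<close>: for \<open>2 * j\<close> by duplication, for
  \<open>2 * j + 1\<close> by adding the multiples \<open>j + 1\<close> and \<open>j\<close>, whose
  difference is the point itself.\<close>

lemma multiplication_polys:
  assumes "k \<ge> 1"
  shows "\<exists>\<phi> \<psi>. leading_term \<phi> (k ^ 2) 1 \<and> leading_term \<psi> (k ^ 2 - 1) (of_nat k ^ 2) \<and>
    (\<forall>n\<ge>1. H (k * n) ^ 2 = H n ^ (2 * k ^ 2) * poly \<psi> (X n) \<and> X (k * n) * poly \<psi> (X n) = poly \<phi> (X n))"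
  using assms
proof (induction k rule: less_induct)
  case (less k)
  consider "k = 1" | j where "k = 2 * j" "j \<ge> 1" | j where "k = 2 * j + 1" "j \<ge> 1"
  proof (cases "even k")
    case True
    thus ?thesis using that less.prems by (auto elim!: evenE)
  next
    case False
    then obtain j where "k = 2 * j + 1" by (auto elim!: oddE)
    thus ?thesis using that by (cases "j = 0") auto
  qed
  thus ?case
  proof cases
    case 1
    thus ?thesis
      by (intro exI[of _ "[:0, 1:]"] exI[of _ 1]) (auto simp: leading_term_def)
  next
    case 2
    note k = 2
    obtain p s where p: "leading_term p (j ^ 2) 1" and s: "leading_term s (j ^ 2 - 1) (of_nat j ^ 2)"
      and H: "\<And>n. n \<ge> 1 \<Longrightarrow> H (j * n) ^ 2 = H n ^ (2 * j ^ 2) * poly s (X n)"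
      and X: "\<And>n. n \<ge> 1 \<Longrightarrow> X (j * n) * poly s (X n) = poly p (X n)"
      using less.IH[of j] k by auto
    obtain i where i: "j ^ 2 = Suc i" using k by (cases "j ^ 2") auto
    have i': "i = j ^ 2 - 1" and k2: "k ^ 2 = 4 * i + 4" using i k by (simp_all add: power_mult_distrib)
    note p = p[unfolded i] and s = s[folded i']
    \<comment> \<open>With \<open>\<xi> = p / s\<close> these are \<open>R \<xi> \<xi>\<close> and
      \<open>S \<xi> \<xi>\<close>, cleared of denominators by \<open>s ^ 4\<close>.\<close>
    let ?\<phi> = "p ^ 4 - Polynomial.smult b4 (p ^ 2 * s ^ 2) - Polynomial.smult (2 * b6) (p * s ^ 3) - Polynomial.smult b8 (s ^ 4)"
    let ?\<psi> = "Polynomial.smult 4 (p ^ 3 * s) + Polynomial.smult b2 (p ^ 2 * s ^ 2) + Polynomial.smult (2 * b4) (p * s ^ 3) + Polynomial.smult b6 (s ^ 4)"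
    note pw = leading_term_power[OF p] leading_term_power[OF s]
    have t1: "leading_term (p ^ 3 * s) (4 * i + 3) (of_nat j ^ 2)"
      using leading_term_mult[OF pw(1)[of 3] s] by (simp add: algebra_simps)
    have t2: "leading_term (p ^ 2 * s ^ 2) (4 * i + 2) (of_nat j ^ 4)"
      using leading_term_mult[OF pw(1)[of 2] pw(2)[of 2]] by (simp add: algebra_simps)
    have t3: "leading_term (p * s ^ 3) (4 * i + 1) (of_nat j ^ 6)"
      using leading_term_mult[OF p pw(2)[of 3]] by (simp add: algebra_simps)
    have t4: "leading_term (s ^ 4) (4 * i) (of_nat j ^ 8)"
      using pw(2)[of 4] by (simp add: algebra_simps)
    have t5: "leading_term (p ^ 4) (4 * i + 4) 1"
      using pw(1)[of 4] by (simp add: algebra_simps)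
    have "leading_term ?\<psi> (4 * i + 3) (4 * of_nat j ^ 2 + b2 * 0 + 2 * b4 * 0 + b6 * 0)"
      by (intro leading_term_add leading_term_smult t1 leading_term_less[OF t2] leading_term_less[OF t3] 
          leading_term_less[OF t4]) auto
    hence 1: "leading_term ?\<psi> (k ^ 2 - 1) (of_nat k ^ 2)" unfolding k2 by (simp add: k power_mult_distrib add.commute)
    have "leading_term ?\<phi> (4 * i + 4) (1 - b4 * 0 - (2 * b6) * 0 - b8 * 0)"
      by (intro leading_term_diff leading_term_smult t5 leading_term_less[OF t2] leading_term_less[OF t3] 
          leading_term_less[OF t4]) auto
    hence 2: "leading_term ?\<phi> (k ^ 2) 1" unfolding k2 by simp
    have "H (k * n) ^ 2 = H n ^ (2 * k ^ 2) * poly ?\<psi> (X n) \<and> X (k * n) * poly ?\<psi> (X n) = poly ?\<phi> (X n)"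
      if n: "n \<ge> 1" for n
    proof -
      define \<xi> where "\<xi> = X (j * n)"
      define \<sigma> where "\<sigma> = poly s (X n)"
      have jn: "j * n \<ge> 1" using n k by simp
      have kn: "k * n = 2 * (j * n)" using k by simp
      have pp: "poly p (X n) = \<xi> * \<sigma>" using X[OF n] by (simp add: \<xi>_def \<sigma>_def)
      have psi: "poly ?\<psi> (X n) = \<sigma> ^ 4 * S \<xi> \<xi>"
        by (simp add: pp flip: \<sigma>_def) (simp add: S_def algebra_simps eval_nat_numeral)
      have phi: "poly ?\<phi> (X n) = \<sigma> ^ 4 * R \<xi> \<xi>"
        by (simp add: pp flip: \<sigma>_def) (simp add: R_def algebra_simps eval_nat_numeral)
      have "H (k * n) ^ 2 = (H (j * n) ^ 2) ^ 4 * Y (j * n) ^ 2"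
        unfolding kn H_double[OF jn] by (simp add: algebra_simps flip: power_mult)
      also have "\<dots> = H n ^ (2 * k ^ 2) * (\<sigma> ^ 4 * S \<xi> \<xi>)"
        unfolding H[OF n] \<xi>_def S_diag[OF jn] \<sigma>_def k 
        by (simp add: power_mult_distrib algebra_simps flip: power_mult)
      finally have "H (k * n) ^ 2 = H n ^ (2 * k ^ 2) * (\<sigma> ^ 4 * S \<xi> \<xi>)" .
      moreover have "X (k * n) * (\<sigma> ^ 4 * S \<xi> \<xi>) = \<sigma> ^ 4 * R \<xi> \<xi>"
        using X_dup[OF jn] S_diag[OF jn] by (simp add: \<xi>_def kn mult.commute)
      ultimately show ?thesis unfolding psi phi by simp
    qed
    thus ?thesis using 1 2 by blast
  next
    case 3
    note k = 3
    obtain p s where p: "leading_term p (j ^ 2) 1" and s: "leading_term s (j ^ 2 - 1) (of_nat j ^ 2)"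
      and H: "\<And>n. n \<ge> 1 \<Longrightarrow> H (j * n) ^ 2 = H n ^ (2 * j ^ 2) * poly s (X n)"
      and X: "\<And>n. n \<ge> 1 \<Longrightarrow> X (j * n) * poly s (X n) = poly p (X n)"
      using less.IH[of j] k by auto
    obtain q t where q: "leading_term q ((j+1) ^ 2) 1" and t: "leading_term t ((j+1) ^ 2 - 1) (of_nat (j+1) ^ 2)"
      and H': "\<And>n. n \<ge> 1 \<Longrightarrow> H ((j+1) * n) ^ 2 = H n ^ (2 * (j+1) ^ 2) * poly t (X n)"
      and X': "\<And>n. n \<ge> 1 \<Longrightarrow> X ((j+1) * n) * poly t (X n) = poly q (X n)"
      using less.IH[of "j+1"] k by auto
    obtain i where i: "j ^ 2 = Suc i" using k by (cases "j ^ 2") auto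
    obtain l where l: "(j+1) ^ 2 = Suc l" by (cases "(j+1) ^ 2") auto
    have i': "i = j ^ 2 - 1" and l': "l = (j+1) ^ 2 - 1" and k2: "k ^ 2 = 2 * i + 2 * l + 3" using i l k 
      by (simp_all add: power2_eq_square algebra_simps)
    note p = p[unfolded i] and s = s[folded i'] and q = q[unfolded l] and t = t[folded l']
    \<comment> \<open>With \<open>\<xi> = p / s\<close> and \<open>\<xi>' = q / t\<close> this is
      \<open>(\<xi>' - \<xi>) ^ 2\<close> times \<open>(s * t) ^ 2\<close>; accordingly
      \<open>?\<phi>\<close> comes from \<open>X_addition\<close>, where the difference of the two
      points contributes the subtracted \<open>X n\<close>.\<close>
    let ?\<psi> = "(q * s - p * t) ^ 2"
    let ?\<phi> = "Polynomial.smult 2 (p * q * (p * t + q * s)) + Polynomial.smult b2 (p * q * (s * t)) + Polynomial.smult b4 ((p * t + q * s) * (s * t)) 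
        + Polynomial.smult b6 (s ^ 2 * t ^ 2) - [:0, 1:] * ?\<psi>"
    have "of_nat j ^ 2 - of_nat (j + 1) ^ 2 = - (of_nat k :: 'a)"
      by (simp add: k algebra_simps power2_eq_square)
    hence u0: "leading_term (q * s - p * t) (i + l + 1) (- (of_nat k))"
      using leading_term_diff[OF leading_term_mult[OF q s, unfolded add_Suc] leading_term_mult[OF p t, unfolded add_Suc, unfolded add.commute[of i]]]
      by (simp add: add_ac)
    have u: "leading_term ?\<psi> (2 * (i + l + 1)) (of_nat k ^ 2)"
      using leading_term_power[OF u0, of 2] by simp
    hence 1: "leading_term ?\<psi> (k ^ 2 - 1) (of_nat k ^ 2)" unfolding k2 by (simp add: algebra_simps)
    have v: "leading_term (p * t + q * s) (i + l + 1) (of_nat (j + 1) ^ 2 + of_nat j ^ 2)"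
      using leading_term_add[OF leading_term_mult[OF p t, unfolded add_Suc] leading_term_mult[OF q s, unfolded add_Suc, unfolded add.commute[of l]]]
      by simp
    have st: "leading_term (s * t) (i + l) (of_nat j ^ 2 * of_nat (j + 1) ^ 2)"
      by (rule leading_term_mult[OF s t])
    have pq: "leading_term (p * q) (i + l + 2) 1"
      using leading_term_mult[OF p q] by simp
    have st2: "leading_term (s ^ 2 * t ^ 2) (2 * (i + l)) ((of_nat j ^ 2 * of_nat (j + 1) ^ 2) ^ 2)"
      using leading_term_power[OF st, of 2] by (simp add: power_mult_distrib)
    have e1: "i + l + 2 + (i + l + 1) = 2 * i + 2 * l + 3" and e2: "1 + 2 * (i + l + 1) = 2 * i + 2 * l + 3"
      by simp_all
    have X1: "leading_term [:0, 1 :: 'a:] 1 1" by (simp add: leading_term_def)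
    have "leading_term ?\<phi> (2 * i + 2 * l + 3) (2 * (of_nat (j + 1) ^ 2 + of_nat j ^ 2) + b2 * 0 + b4 * 0 + b6 * 0 - of_nat k ^ 2)"
      apply (intro leading_term_diff leading_term_add leading_term_smult)
      subgoal using leading_term_mult[OF pq v] unfolding e1 by simp
      subgoal by (rule leading_term_less[OF leading_term_mult[OF pq st]]) simp
      subgoal by (rule leading_term_less[OF leading_term_mult[OF v st]]) simp
      subgoal by (rule leading_term_less[OF st2]) simp
      subgoal using leading_term_mult[OF X1 u] unfolding e2 by simp
      done
    moreover have "2 * (of_nat (j + 1) ^ 2 + of_nat j ^ 2) - of_nat k ^ 2 = (1 :: 'a)"
      by (simp add: k algebra_simps power2_eq_square)
    ultimately have 2: "leading_term ?\<phi> (k ^ 2) 1" unfolding k2 by simp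
    have "H (k * n) ^ 2 = H n ^ (2 * k ^ 2) * poly ?\<psi> (X n) \<and> X (k * n) * poly ?\<psi> (X n) = poly ?\<phi> (X n)"
      if n: "n \<ge> 1" for n
    proof -
      define \<xi> where "\<xi> = X (j * n)"
      define \<sigma> where "\<sigma> = poly s (X n)"
      define \<xi>' where "\<xi>' = X ((j+1) * n)"
      define \<tau> where "\<tau> = poly t (X n)"
      have jn: "1 \<le> j * n" "j * n < (j + 1) * n" using n k by simp_all
      have kn: "(j + 1) * n + j * n = k * n" "(j + 1) * n - j * n = n" using k by (simp_all add: algebra_simps)
      have pp: "poly p (X n) = \<xi> * \<sigma>" using X[OF n] by (simp add: \<xi>_def \<sigma>_def)
      have qq: "poly q (X n) = \<xi>' * \<tau>" using X'[OF n] by (simp add: \<xi>'_def \<tau>_def)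
      have psi: "poly ?\<psi> (X n) = (\<sigma> * \<tau>) ^ 2 * (\<xi>' - \<xi>) ^ 2"
        by (simp add: pp qq flip: \<sigma>_def \<tau>_def) (simp add: algebra_simps power2_eq_square)
      have phi: "poly ?\<phi> (X n) = (\<sigma> * \<tau>) ^ 2 * S \<xi>' \<xi> - X n * poly ?\<psi> (X n)"
        by (simp add: pp qq flip: \<sigma>_def \<tau>_def) (simp add: S_def algebra_simps power2_eq_square)
      have e: "2 * (2 * (j + 1) ^ 2) + 2 * (2 * j ^ 2) = 2 + 2 * k ^ 2"
        by (simp add: k algebra_simps power2_eq_square)
      have "H (k * n) * H n = H ((j + 1) * n) ^ 2 * H (j * n) ^ 2 * (\<xi> - \<xi>')"
        using H_diff[OF jn] unfolding kn \<xi>_def \<xi>'_def .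
      hence "H (k * n) ^ 2 * H n ^ 2 = (H ((j + 1) * n) ^ 2 * H (j * n) ^ 2 * (\<xi> - \<xi>')) ^ 2"
        by (metis power_mult_distrib)
      also have "\<dots> = (H n ^ (2 * (2 * (j + 1) ^ 2)) * H n ^ (2 * (2 * j ^ 2))) * ((\<sigma> * \<tau>) ^ 2 * (\<xi>' - \<xi>) ^ 2)"
        unfolding H[OF n] H'[OF n] \<sigma>_def[symmetric] \<tau>_def[symmetric]
        by (simp add: power_mult_distrib flip: power_mult) (simp add: algebra_simps power2_eq_square)
      also have "(H n ^ (2 * (2 * (j + 1) ^ 2)) * H n ^ (2 * (2 * j ^ 2))) = H n ^ (2 * k ^ 2) * H n ^ 2"
        unfolding power_add[symmetric] e by (simp add: add_ac)
      finally have "H (k * n) ^ 2 = H n ^ (2 * k ^ 2) * ((\<sigma> * \<tau>) ^ 2 * (\<xi>' - \<xi>) ^ 2)"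
        using n by simp
      moreover have "X (k * n) * poly ?\<psi> (X n) = poly ?\<phi> (X n)"
      proof -
        have "(X (k * n) + X n) * (\<xi>' - \<xi>) ^ 2 = S \<xi>' \<xi>"
          using X_addition[OF jn] unfolding kn \<xi>_def \<xi>'_def .
        hence "(\<sigma> * \<tau>) ^ 2 * ((X (k * n) + X n) * (\<xi>' - \<xi>) ^ 2) = (\<sigma> * \<tau>) ^ 2 * S \<xi>' \<xi>" by simp
        thus ?thesis unfolding phi psi by (simp add: algebra_simps)
      qed
      ultimately show ?thesis unfolding psi by simp
    qed
    thus ?thesis using 1 2 by blast
  qed
qed

text \<open>By \<open>multiplication_polys\<close>, such an \<open>n\<close> makes \<open>X n\<close> a root of a fixed polynomial of degree \<open>k\<^sup>2 - 1\<close>.\<close>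

theorem card_unit_multiples:
  assumes "k \<ge> 2"
  shows "finite {n. n \<ge> 1 \<and> H n ^ 2 = 1 \<and> H (k * n) ^ 2 = 1}" (is "finite ?A")
    and "card {n. n \<ge> 1 \<and> H n ^ 2 = 1 \<and> H (k * n) ^ 2 = 1} < k ^ 2"
proof -
  obtain \<psi> where \<psi>: "leading_term \<psi> (k ^ 2 - 1) (of_nat k ^ 2)"
    and H: "\<And>n. n \<ge> 1 \<Longrightarrow> H (k * n) ^ 2 = H n ^ (2 * k ^ 2) * poly \<psi> (X n)"
    using multiplication_polys[of k] assms by auto
  have k: "k ^ 2 \<ge> 4" using assms power_mono[of 2 k 2] by simp
  \<comment> \<open>The degree \<open>k ^ 2 - 1\<close> is at least \<open>3\<close>, so subtracting
    \<open>1\<close> leaves the top coefficient alone, which is nonzero in characteristic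
    \<open>0\<close>.\<close>
  have "leading_term (\<psi> - 1) (k ^ 2 - 1) (of_nat k ^ 2 - 0)"
    by (intro leading_term_diff \<psi>) (use k in \<open>auto simp: leading_term_def\<close>)
  hence nz: "\<psi> - 1 \<noteq> 0" and deg: "degree (\<psi> - 1) \<le> k ^ 2 - 1"
    using assms unfolding leading_term_def by (metis coeff_0 diff_zero of_nat_eq_0_iff not_numeral_le_zero power_not_zero)+
  have sub: "X ` ?A \<subseteq> {x. poly (\<psi> - 1) x = 0}"
    using H by (auto simp: power_mult)
  have inj: "inj_on X ?A"
    by (rule inj_onI) (metis (mono_tags, lifting) X_inj linorder_neqE_nat mem_Collect_eq)
  show "finite ?A"
    using finite_imageD[OF finite_subset[OF sub poly_roots_finite[OF nz]] inj] .
  have "card ?A = card (X ` ?A)" by (rule card_image[OF inj, symmetric])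
  also have "\<dots> \<le> card {x. poly (\<psi> - 1) x = 0}"
    by (rule card_mono[OF poly_roots_finite[OF nz] sub])
  also have "\<dots> \<le> degree (\<psi> - 1)" by (rule card_poly_roots_bound[OF nz])
  finally show "card ?A < k ^ 2" using deg k by linarith
qed

end

section \<open>Division polynomials\<close>

context chord_sequence begin

lemma H_even:
  assumes "n \<ge> 3"
  shows "H (2 * n) * Y 1 = H n * (H (n + 2) * H (n - 1) ^ 2 - H (n - 2) * H (n + 1) ^ 2)"
proof -
  have "H (n + 2) * H n = H (n + 1) ^ 2 * (X 1 - X (n + 1))"
    "H n * H (n - 2) = H (n - 1) ^ 2 * (X 1 - X (n - 1))"
    using H_step[of "n + 1"] H_step[of "n - 1"] assms
    by (simp_all add: numeral_2_eq_2 Suc_diff_Suc)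
  moreover have "H (2 * n) * Y 1 = H (n + 1) ^ 2 * H (n - 1) ^ 2 * (X (n - 1) - X (n + 1))"
    using H_diff[of "n - 1" "n + 1"] assms H_2 by (simp add: mult_2 numeral_2_eq_2 Suc_diff_le)
  ultimately show ?thesis by Groebner_Basis.algebra
qed

lemma H_odd:
  assumes "n \<ge> 2"
  shows "H (2 * n + 1) = H (n + 2) * H n ^ 3 - H (n - 1) * H (n + 1) ^ 3"
proof -
  have "H (n + 2) * H n = H (n + 1) ^ 2 * (X 1 - X (n + 1))"
    "H (n + 1) * H (n - 1) = H n ^ 2 * (X 1 - X n)"
    using H_step[of "n + 1"] H_step[of n] assms
    by (simp_all add: numeral_2_eq_2)
  moreover have "H (2 * n + 1) = H (n + 1) ^ 2 * H n ^ 2 * (X n - X (n + 1))"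
    using H_diff[of n "n + 1"] assms by (simp add: mult_2)
  ultimately show ?thesis by Groebner_Basis.algebra
qed

lemma H_3: "H 3 = 3 * X 1 ^ 4 + b2 * X 1 ^ 3 + 3 * b4 * X 1 ^ 2 + 3 * b6 * X 1 + b8"
proof -
  have "H 3 = Y 1 ^ 2 * X 1 - Y 1 ^ 2 * X 2"
    using H_step[of 2] H_2 by (simp add: numeral_3_eq_3 numeral_2_eq_2 algebra_simps)
  also have "\<dots> = 3 * X 1 ^ 4 + b2 * X 1 ^ 3 + 3 * b4 * X 1 ^ 2 + 3 * b6 * X 1 + b8"
    unfolding X2_dup unfolding curve[OF order_refl] R_def by (simp add: algebra_simps eval_nat_numeral)
  finally show ?thesis .
qed

lemma H_4: "H 4 = Y 1 * (2 * X 1 ^ 6 + b2 * X 1 ^ 5 + 5 * b4 * X 1 ^ 4 + 10 * b6 * X 1 ^ 3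
  + 10 * b8 * X 1 ^ 2 + (b2 * b8 - b4 * b6) * X 1 + (b4 * b8 - b6 ^ 2))"
proof -
  define f where "f = 6 * X 1 ^ 2 + b2 * X 1 + b4"
  have "Y 1 * Y 2 = - (Y 1 ^ 2 + f * (X 2 - X 1))"
    unfolding Y2_eq f_def[symmetric] using Y1_nz by (simp add: field_simps power2_eq_square)
  hence "Y 1 ^ 3 * Y 2 = - (Y 1 ^ 2 * Y 1 ^ 2 + f * (Y 1 ^ 2 * X 2 - X 1 * Y 1 ^ 2))"
    by Groebner_Basis.algebra
  also have "\<dots> = - (Y 1 ^ 2 * Y 1 ^ 2 + f * (R (X 1) (X 1) - X 1 * Y 1 ^ 2))"
    unfolding X2_dup ..
  also have "\<dots> = (2 * X 1 ^ 6 + b2 * X 1 ^ 5 + 5 * b4 * X 1 ^ 4 + 10 * b6 * X 1 ^ 3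
      + 10 * b8 * X 1 ^ 2 + (b2 * b8 - b4 * b6) * X 1 + (b4 * b8 - b6 ^ 2))
      + (b4 ^ 2 - b2 * b6 + 4 * b8) * X 1 ^ 2 * 0"
    unfolding curve[OF order_refl] R_def f_def using b8 by Groebner_Basis.algebra
  finally have "Y 1 * (Y 1 ^ 3 * Y 2) = Y 1 * (2 * X 1 ^ 6 + b2 * X 1 ^ 5 + 5 * b4 * X 1 ^ 4 + 10 * b6 * X 1 ^ 3
      + 10 * b8 * X 1 ^ 2 + (b2 * b8 - b4 * b6) * X 1 + (b4 * b8 - b6 ^ 2))" by simp
  moreover have "H 4 = Y 1 * (Y 1 ^ 3 * Y 2)"
    using H_double[of 2] H_2 by (simp add: eval_nat_numeral)
  ultimately show ?thesis by simp
qed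

text \<open>Both sequences obey the same recurrences, \<open>H\<close> by \<open>H_even\<close> and
  \<open>H_odd\<close>; the values up to index \<open>4\<close> are compared directly.\<close>

lemma division_poly_nat_eq_H:
  assumes "wb2 W = b2" "wb4 W = b4" "wb6 W = b6" "wb8 W = b8" "x = X 1"
    and "2 * y + wa1 W * x + wa3 W = Y 1"
  shows "division_poly_nat W x y n = H n"
proof (induction n rule: less_induct)
  case (less n)
  consider "n = 0" | "n = 1" | "n = 2" | "n = 3" | "n = 4" | m where "n = 2 * m" "m \<ge> 3"
    | m where "n = 2 * m + 1" "m \<ge> 2"
  proof (cases "n \<le> 4")
    case True
    hence "n \<in> {0,1,2,3,4}" by auto
    thus ?thesis using that by blast
  next
    case False
    thus ?thesis using that(6,7)[of "n div 2"] by (cases "even n") (auto elim!: evenE oddE)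
  qed
  thus ?case
  proof cases
    case 4
    thus ?thesis using H_3 assms by (subst division_poly_nat.simps) simp
  next
    case 5
    thus ?thesis using H_4 assms by (subst division_poly_nat.simps) simp
  next
    case (6 m)
    hence "division_poly_nat W x y n = division_poly_nat W x y m *
      (division_poly_nat W x y (m + 2) * division_poly_nat W x y (m - 1) ^ 2
          - division_poly_nat W x y (m - 2) * division_poly_nat W x y (m + 1) ^ 2) / Y 1"
      using assms(6) by (subst division_poly_nat.simps) simp
    also have "\<dots> = H m * (H (m + 2) * H (m - 1) ^ 2 - H (m - 2) * H (m + 1) ^ 2) / Y 1"
      using 6 by (subst (1 2 3 4 5) less.IH) auto
    also have "\<dots> = H n" unfolding H_even[OF 6(2), symmetric] 6(1) using Y1_nz by simp
    finally show ?thesis .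
  next
    case (7 m)
    hence "division_poly_nat W x y n = division_poly_nat W x y (m + 2) * division_poly_nat W x y m ^ 3
          - division_poly_nat W x y (m - 1) * division_poly_nat W x y (m + 1) ^ 3"
      by (subst division_poly_nat.simps) simp
    also have "\<dots> = H (m + 2) * H m ^ 3 - H (m - 1) * H (m + 1) ^ 3"
      using 7 by (subst (1 2 3 4) less.IH) auto
    finally show ?thesis using H_odd[OF 7(2)] 7(1) by simp
  qed (use assms Y1_nz H_2 in \<open>subst division_poly_nat.simps, simp\<close>)+
qed

text \<open>Integrality is proved together with the divisibility of the even terms by \<open>Y 1\<close>, which
  makes the division by \<open>\<psi>\<^sub>2\<close> in the recurrence for even indices harmless.\<close>

lemma H_Ints:
  assumes "b2 \<in> \<int>" "b4 \<in> \<int>" "b6 \<in> \<int>" "b8 \<in> \<int>" "X 1 \<in> \<int>" "Y 1 \<in> \<int>"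
  shows "\<exists>g \<in> \<int>. H n = (if even n then Y 1 * g else g)"
proof (induction n rule: less_induct)
  case (less n)
  consider "n = 0" | "n = 1" | "n = 2" | "n = 3" | "n = 4" | m where "n = 2 * m" "m \<ge> 3"
    | m where "n = 2 * m + 1" "m \<ge> 2"
  proof (cases "n \<le> 4")
    case True
    hence "n \<in> {0,1,2,3,4}" by auto
    thus ?thesis using that by blast
  next
    case False
    thus ?thesis using that(6,7)[of "n div 2"] by (cases "even n") (auto elim!: evenE oddE)
  qed
  thus ?case
  proof cases
    case 3
    thus ?thesis using H_2 by (intro bexI[of _ 1]) auto
  next
    case 4
    thus ?thesis using assms by (simp add: H_3)
  next
    case 5
    thus ?thesis using assms unfolding H_4 5
      by (intro bexI[of _ "2 * X 1 ^ 6 + b2 * X 1 ^ 5 + 5 * b4 * X 1 ^ 4 + 10 * b6 * X 1 ^ 3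
        + 10 * b8 * X 1 ^ 2 + (b2 * b8 - b4 * b6) * X 1 + (b4 * b8 - b6 ^ 2)"]) auto
  next
    case (6 m)
    have ev: "\<exists>g\<in>\<int>. H k = (if even m then Y 1 * g else g)" if "even k = even m" "k < n" for k
      using less.IH[OF that(2)] that(1) by simp
    have od: "\<exists>g\<in>\<int>. H k = (if even m then g else Y 1 * g)" if "even k \<noteq> even m" "k < n" for k
      using less.IH[OF that(2)] that(1) by (cases "even m") auto
    obtain g where g: "g \<in> \<int>" "H m = (if even m then Y 1 * g else g)"
      using ev[of m] 6 by auto
    obtain g1 where g1: "g1 \<in> \<int>" "H (m + 1) = (if even m then g1 else Y 1 * g1)"
      using od[of "m + 1"] 6 by auto
    obtain g2 where g2: "g2 \<in> \<int>" "H (m + 2) = (if even m then Y 1 * g2 else g2)"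
      using ev[of "m + 2"] 6 by auto
    have "even (m - 1) \<noteq> even m" "even (m - 2) = even m" using 6 by auto
    then obtain g3 g4 where g3: "g3 \<in> \<int>" "H (m - 1) = (if even m then g3 else Y 1 * g3)"
      and g4: "g4 \<in> \<int>" "H (m - 2) = (if even m then Y 1 * g4 else g4)"
      using od[of "m - 1"] ev[of "m - 2"] 6 by fastforce
    \<comment> \<open>Whatever the parity of \<open>m\<close>, the right side carries
      \<open>Y 1\<close> twice: from \<open>H m\<close> and from \<open>H (m + 2)\<close>,
      \<open>H (m - 2)\<close> if \<open>m\<close> is even, from the squares if \<open>m\<close> is
      odd. One factor cancels, the other is the one claimed.\<close>
    have "H n * Y 1 = (Y 1 * (g * (g2 * g3 ^ 2 - g4 * g1 ^ 2))) * Y 1"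
      unfolding 6(1) H_even[OF 6(2)] g(2) g1(2) g2(2) g3(2) g4(2)
      by (auto simp: algebra_simps power2_eq_square)
    hence "H n = Y 1 * (g * (g2 * g3 ^ 2 - g4 * g1 ^ 2))" using Y1_nz by simp
    thus ?thesis using 6 g g1 g2 g3 g4 by (intro bexI[of _ "g * (g2 * g3 ^ 2 - g4 * g1 ^ 2)"]) auto
  next
    case (7 m)
    have *: "H k \<in> \<int>" if "k < n" for k using less.IH[OF that] assms by auto
    have "H n \<in> \<int>" unfolding 7(1) H_odd[OF 7(2)]
      by (intro Ints_diff Ints_mult Ints_power *) (use 7 in auto)
    thus ?thesis using 7 by simp
  qed auto
qed

text \<open>The odd extension to negative indices makes the elliptic identity hold without any
  restriction on the indices.\<close>

definition Hi :: "int \<Rightarrow> 'a" where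
  "Hi n = (if n \<ge> 0 then H (nat n) else - H (nat (- n)))"

lemma Hi_minus: "Hi (- n) = - Hi n"
  by (auto simp: Hi_def)

lemma Hi_of_nat: "Hi (int n) = H n"
  by (simp add: Hi_def)

lemma Hi_elliptic_aux:
  assumes "0 \<le> n" "n \<le> m"
  shows "Hi (m + n) * Hi (m - n) = Hi (m + 1) * Hi (m - 1) * Hi n ^ 2 - Hi (n + 1) * Hi (n - 1) * Hi m ^ 2"
proof -
  consider "n = 0" | "n = m" | "0 < n" "n < m" using assms by linarith
  thus ?thesis
  proof cases
    case 1
    have "Hi (- 1) = - 1" "Hi 1 = 1" "Hi 0 = 0" by (simp_all add: Hi_def)
    thus ?thesis using 1 by (simp add: power2_eq_square)
  next
    case 2
    have "Hi 0 = 0" by (simp add: Hi_def)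
    thus ?thesis using 2 by simp
  next
    case 3
    define k l where "k = nat m" and "l = nat n"
    have mn: "m = int k" "n = int l" and kl: "1 \<le> l" "l < k" using 3 by (auto simp: k_def l_def)
    have idx: "Hi (m + n) = H (k + l)" "Hi (m - n) = H (k - l)" "Hi (m + 1) = H (Suc k)" "Hi (m - 1) = H (k - 1)"
      "Hi (n + 1) = H (Suc l)" "Hi (n - 1) = H (l - 1)" "Hi m = H k" "Hi n = H l"
      unfolding Hi_of_nat[symmetric] using mn kl by (simp_all add: of_nat_diff add.commute)
    have "H (Suc k) * H (k - 1) = H k ^ 2 * (X 1 - X k)" "H (Suc l) * H (l - 1) = H l ^ 2 * (X 1 - X l)"
      using H_step kl by simp_all
    with H_diff[OF kl] show ?thesis unfolding idx by Groebner_Basis.algebra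
  qed
qed

text \<open>Both sides are invariant under a sign change of \<open>m\<close> or of \<open>n\<close>
  and change sign when \<open>m\<close> and \<open>n\<close> are swapped, which reduces everything
  to \<open>0 \<le> n \<le> m\<close>.\<close>

theorem Hi_elliptic:
  "Hi (m + n) * Hi (m - n) = Hi (m + 1) * Hi (m - 1) * Hi n ^ 2 - Hi (n + 1) * Hi (n - 1) * Hi m ^ 2"
proof -
  have minus: "Hi (- k + 1) = - Hi (k - 1)" "Hi (- k - 1) = - Hi (k + 1)" for k
  proof -
    have a: "- (k - 1) = - k + 1" and b: "- (k + 1) = - k - 1" by simp_all
    show "Hi (- k + 1) = - Hi (k - 1)" using Hi_minus[of "k - 1"] unfolding a .
    show "Hi (- k - 1) = - Hi (k + 1)" using Hi_minus[of "k + 1"] unfolding b .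
  qed
  have 1: "Hi (m + n) * Hi (m - n) = Hi (m + 1) * Hi (m - 1) * Hi n ^ 2 - Hi (n + 1) * Hi (n - 1) * Hi m ^ 2"
    if "m \<ge> 0" "n \<ge> 0" for m n
  proof (cases "n \<le> m")
    case False
    have "Hi (m + n) * Hi (m - n) = - (Hi (n + m) * Hi (n - m))"
      using Hi_minus[of "n - m"] by (simp add: add.commute)
    thus ?thesis using Hi_elliptic_aux[of m n] that False by simp
  qed (rule Hi_elliptic_aux[OF that(2)])
  have 2: "Hi (m + n) * Hi (m - n) = Hi (m + 1) * Hi (m - 1) * Hi n ^ 2 - Hi (n + 1) * Hi (n - 1) * Hi m ^ 2"
    if "m \<ge> 0" for m n
  proof (cases "n \<ge> 0")
    case False
    hence "Hi (m - n) * Hi (m + n) = Hi (m + 1) * Hi (m - 1) * Hi n ^ 2 - Hi (n - 1) * Hi (n + 1) * Hi m ^ 2"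
      using 1[OF that, of "- n"] unfolding minus(1)[of n] minus(2)[of n] Hi_minus[of n] by simp
    thus ?thesis by (simp only: mult.commute)
  qed (rule 1[OF that])
  show ?thesis
  proof (cases "m \<ge> 0")
    case False
    have swap: "Hi (- m + n) = - Hi (m - n)" "Hi (- m - n) = - Hi (m + n)"
      by (simp_all flip: Hi_minus)
    hence "Hi (m - n) * Hi (m + n) = Hi (m - 1) * Hi (m + 1) * Hi n ^ 2 - Hi (n + 1) * Hi (n - 1) * Hi m ^ 2"
      using False 2[of "- m" n] unfolding minus(1)[of m] minus(2)[of m] Hi_minus[of m] swap by simp
    thus ?thesis by (simp only: mult.commute)
  qed (rule 2)
qed

end

section \<open>Rational points of infinite order\<close>

text \<open>Substituting a line through the first point into the cubic and dividing by
  \<open>t - x1\<close> leaves a quadratic \<open>g\<close>. The second hypothesis says that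
  \<open>x2\<close> is a root of \<open>g\<close>, and \<open>x3\<close> is the other root by the
  sum of the roots. Chord and tangent are covered alike.\<close>

lemma third_point_on_cubic:
  fixes x1 :: "'a::field_char_0"
  assumes y1: "y1 ^ 2 = 4 * x1 ^ 3 + b2 * x1 ^ 2 + 2 * b4 * x1 + b6"
    and g: "4 * (x2 ^ 2 + x2 * x1 + x1 ^ 2) + b2 * (x2 + x1) + 2 * b4 - 2 * y1 * M - M ^ 2 * (x2 - x1) = 0"
    and x3: "x3 = M ^ 2 / 4 - b2 / 4 - x1 - x2"
  shows "(- (y1 + M * (x3 - x1))) ^ 2 = 4 * x3 ^ 3 + b2 * x3 ^ 2 + 2 * b4 * x3 + b6"
proof -
  define g where "g t = 4 * (t ^ 2 + t * x1 + x1 ^ 2) + b2 * (t + x1) + 2 * b4 - 2 * y1 * M - M ^ 2 * (t - x1)" for t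
  have M: "M ^ 2 = 4 * (x1 + x2 + x3) + b2" using x3 by (simp add: field_simps)
  have "g x3 - g x2 = (x3 - x2) * (4 * (x1 + x2 + x3) + b2 - M ^ 2)"
    by (simp add: g_def algebra_simps power2_eq_square)
  moreover have "g x2 = 0" using g by (simp add: g_def)
  ultimately have "g x3 = 0" using M by simp
  moreover have "4 * x3 ^ 3 + b2 * x3 ^ 2 + 2 * b4 * x3 + b6 - (- (y1 + M * (x3 - x1))) ^ 2 
     = (4 * x1 ^ 3 + b2 * x1 ^ 2 + 2 * b4 * x1 + b6 - y1 ^ 2) + (x3 - x1) * g x3"
    by (simp add: g_def algebra_simps power2_eq_square power3_eq_cube)
  ultimately show ?thesis using y1 by simp
qed

text \<open>As second coordinate this completes the square and leads to the model used for
  \<open>chord_sequence\<close>.\<close>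

definition psi2 :: "'a::comm_ring_1 weierstrass \<Rightarrow> 'a \<Rightarrow> 'a \<Rightarrow> 'a" where
  "psi2 W x y = 2 * y + wa1 W * x + wa3 W"

lemma on_curve_iff_psi2:
  fixes W :: "'a::field_char_0 weierstrass"
  shows "on_curve W x y \<longleftrightarrow> psi2 W x y ^ 2 = 4 * x ^ 3 + wb2 W * x ^ 2 + 2 * wb4 W * x + wb6 W"
proof -
  have "psi2 W x y ^ 2 - (4 * x ^ 3 + wb2 W * x ^ 2 + 2 * wb4 W * x + wb6 W)
    = 4 * ((y ^ 2 + wa1 W * x * y + wa3 W * y) - (x ^ 3 + wa2 W * x ^ 2 + wa4 W * x + wa6 W))"
    by (simp add: psi2_def wb2_def wb4_def wb6_def algebra_simps power2_eq_square)
  thus ?thesis unfolding on_curve_def by (metis cancel_comm_monoid_add_class.diff_cancel 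
      eq_iff_diff_eq_0 mult_eq_0_iff zero_neq_numeral)
qed

text \<open>In the coordinate \<open>psi2\<close>, the slope \<open>l\<close> of the chord or tangent becomes \<open>2 * l + wa1 W\<close>.\<close>

lemma ec_add_psi2:
  fixes W :: "'a::field_char_0 weierstrass"
  assumes "ec_add W (Affine x1 y1) (Affine x2 y2) = Affine x3 y3"
    and "x1 = x2 \<Longrightarrow> psi2 W x1 y1 \<noteq> 0"
  defines "M \<equiv> (if x1 = x2 then (6 * x1 ^ 2 + wb2 W * x1 + wb4 W) / psi2 W x1 y1
                else (psi2 W x2 y2 - psi2 W x1 y1) / (x2 - x1))"
  shows "x3 = M ^ 2 / 4 - wb2 W / 4 - x2 - x1"
    and "psi2 W x3 y3 = - (psi2 W x1 y1 + M * (x3 - x1))"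
proof -
  define l where "l = (if x1 = x2
                    then (3 * x1 ^ 2 + 2 * wa2 W * x1 + wa4 W - wa1 W * y1)
                           / (2 * y1 + wa1 W * x1 + wa3 W)
                    else (y2 - y1) / (x2 - x1))"
  have x3: "x3 = l ^ 2 + wa1 W * l - wa2 W - x1 - x2" 
    and y3: "y3 = - (y1 + l * (x3 - x1)) - wa1 W * x3 - wa3 W"
    using assms(1) by (auto simp: Let_def l_def split: if_splits)
  have M: "M = 2 * l + wa1 W"
  proof (cases "x1 = x2")
    case True
    have nz: "2 * y1 + wa1 W * x1 + wa3 W \<noteq> 0" using assms(2) True by (simp add: psi2_def)
    have "M = (6 * x1 ^ 2 + wb2 W * x1 + wb4 W) / (2 * y1 + wa1 W * x1 + wa3 W)"
      using True by (simp add: M_def psi2_def)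
    also have "6 * x1 ^ 2 + wb2 W * x1 + wb4 W = 2 * (3 * x1 ^ 2 + 2 * wa2 W * x1 + wa4 W - wa1 W * y1)
        + wa1 W * (2 * y1 + wa1 W * x1 + wa3 W)"
      by (simp add: wb2_def wb4_def algebra_simps power2_eq_square)
    finally show ?thesis using nz True by (simp add: l_def add_divide_distrib)
  next
    case False
    have "psi2 W x2 y2 - psi2 W x1 y1 = 2 * (y2 - y1) + wa1 W * (x2 - x1)"
      by (simp add: psi2_def algebra_simps)
    thus ?thesis using False by (simp add: M_def l_def add_divide_distrib)
  qed
  show "x3 = M ^ 2 / 4 - wb2 W / 4 - x2 - x1"
    unfolding M x3 by (simp add: wb2_def field_simps power2_eq_square)
  show "psi2 W x3 y3 = - (psi2 W x1 y1 + M * (x3 - x1))"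
    unfolding M psi2_def y3 by (simp add: algebra_simps)
qed

locale infinite_order_point =
  fixes W :: "'a::field_char_0 weierstrass" and x y :: 'a
  assumes on_curve: "on_curve W x y"
    and infinite_order: "infinite_order W (Affine x y)"
begin

definition Q :: "nat \<Rightarrow> 'a ec_point" where
  "Q n = (ec_add W (Affine x y) ^^ n) Infinity"

text \<open>The default \<open>0\<close> is taken only at \<open>n = 0\<close>, since all later
  multiples are affine.\<close>

definition Qx :: "nat \<Rightarrow> 'a" where
  "Qx n = (case Q n of Affine u v \<Rightarrow> u | Infinity \<Rightarrow> 0)"

definition Qy :: "nat \<Rightarrow> 'a" where
  "Qy n = (case Q n of Affine u v \<Rightarrow> v | Infinity \<Rightarrow> 0)"

lemma Q_Suc: "Q (Suc n) = ec_add W (Affine x y) (Q n)"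
  by (simp add: Q_def)

lemma Q_affine: "n \<ge> 1 \<Longrightarrow> Q n = Affine (Qx n) (Qy n)"
  using infinite_order[unfolded infinite_order_def, rule_format, of "int n"]
  by (auto simp: ec_mult_def Q_def Qx_def Qy_def split: ec_point.splits)

lemma Q_1: "Qx 1 = x" "Qy 1 = y"
  using Q_affine[of 1] by (simp_all add: Q_def)

lemma psi2_nz: "psi2 W x y \<noteq> 0"
proof
  assume "psi2 W x y = 0"
  hence "y = - y - wa1 W * x - wa3 W" by (simp add: psi2_def algebra_simps)
  hence "Q 2 = Infinity" unfolding Q_def numeral_2_eq_2 by simp
  thus False using Q_affine[of 2] by simp
qed

text \<open>When the first coordinate of a sum equals that of the first summand, the addition
  formula returns the second coordinate of the negative of that summand. So \<open>Q n\<close> would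
  be the negative of the point and \<open>Q (Suc n)\<close> would be
  \<open>Infinity\<close>.\<close>

lemma Qx_neq:
  assumes "n \<ge> 2"
  shows "Qx n \<noteq> x"
proof
  assume eq: "Qx n = x"
  obtain m where m: "n = Suc m" "m \<ge> 1" using assms by (cases n) auto
  have "ec_add W (Affine x y) (Affine (Qx m) (Qy m)) = Affine (Qx n) (Qy n)"
    using Q_Suc[of m] Q_affine[of m] Q_affine[of n] m by simp
  moreover have "\<exists>l. y3 = - (y1 + l * (x3 - x1)) - wa1 W * x3 - wa3 W"
    if "ec_add W (Affine x1 y1) (Affine x2 y2) = Affine x3 y3" for x1 y1 x2 y2 x3 y3
  proof -
    define l where "l = (if x1 = x2
                    then (3 * x1 ^ 2 + 2 * wa2 W * x1 + wa4 W - wa1 W * y1)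
                           / (2 * y1 + wa1 W * x1 + wa3 W)
                    else (y2 - y1) / (x2 - x1))"
    show ?thesis using that by (intro exI[of _ l]) (auto simp: Let_def l_def split: if_splits)
  qed
  ultimately have "Qy n = - y - wa1 W * x - wa3 W"
    using eq by fastforce
  hence "Q (Suc n) = Infinity" unfolding Q_Suc using eq Q_affine[of n] assms by simp
  thus False using Q_affine[of "Suc n"] by simp
qed

definition QY :: "nat \<Rightarrow> 'a" where "QY n = psi2 W (Qx n) (Qy n)"

lemma Q_step:
  assumes "n \<ge> 1"
  defines "M \<equiv> (if n = 1 then (6 * x ^ 2 + wb2 W * x + wb4 W) / psi2 W x y
                else (QY n - psi2 W x y) / (Qx n - x))"
  shows "Qx (Suc n) = M ^ 2 / 4 - wb2 W / 4 - Qx n - x"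
    and "QY (Suc n) = - (psi2 W x y + M * (Qx (Suc n) - x))"
proof -
  have a: "ec_add W (Affine x y) (Affine (Qx n) (Qy n)) = Affine (Qx (Suc n)) (Qy (Suc n))"
    using Q_Suc[of n] Q_affine[of n] Q_affine[of "Suc n"] assms by simp
  have iff: "x = Qx n \<longleftrightarrow> n = 1" using Qx_neq[of n] Q_1 assms by (cases "n = 1") auto
  note b = ec_add_psi2[OF a psi2_nz]
  show "Qx (Suc n) = M ^ 2 / 4 - wb2 W / 4 - Qx n - x"
    and "QY (Suc n) = - (psi2 W x y + M * (Qx (Suc n) - x))"
    using b unfolding iff M_def QY_def by simp_all
qed

lemma QY_curve:
  assumes "n \<ge> 1"
  shows "QY n ^ 2 = 4 * Qx n ^ 3 + wb2 W * Qx n ^ 2 + 2 * wb4 W * Qx n + wb6 W"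
  using assms
proof (induction n rule: dec_induct)
  case base
  thus ?case using on_curve unfolding on_curve_iff_psi2 QY_def Q_1 .
next
  case (step n)
  have y1: "psi2 W x y ^ 2 = 4 * x ^ 3 + wb2 W * x ^ 2 + 2 * wb4 W * x + wb6 W"
    using on_curve unfolding on_curve_iff_psi2 .
  define M where "M = (if n = 1 then (6 * x ^ 2 + wb2 W * x + wb4 W) / psi2 W x y
                else (QY n - psi2 W x y) / (Qx n - x))"
  have "4 * (Qx n ^ 2 + Qx n * x + x ^ 2) + wb2 W * (Qx n + x) + 2 * wb4 W - 2 * psi2 W x y * M - M ^ 2 * (Qx n - x) = 0"
  proof (cases "n = 1")
    case True
    have "psi2 W x y * M = 6 * x ^ 2 + wb2 W * x + wb4 W" using True psi2_nz by (simp add: M_def)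
    moreover have "Qx n = x" using True Q_1 by simp
    ultimately show ?thesis by Groebner_Basis.algebra
  next
    case False
    hence nz: "Qx n - x \<noteq> 0" using Qx_neq[of n] step.hyps by simp
    have M: "M * (Qx n - x) = QY n - psi2 W x y" using False nz by (simp add: M_def)
    have "(Qx n - x) * (4 * (Qx n ^ 2 + Qx n * x + x ^ 2) + wb2 W * (Qx n + x) + 2 * wb4 W - 2 * psi2 W x y * M - M ^ 2 * (Qx n - x))
      = (4 * Qx n ^ 3 + wb2 W * Qx n ^ 2 + 2 * wb4 W * Qx n + wb6 W) - (4 * x ^ 3 + wb2 W * x ^ 2 + 2 * wb4 W * x + wb6 W)
        - (2 * psi2 W x y * (M * (Qx n - x)) + (M * (Qx n - x)) ^ 2)"
      by (simp add: algebra_simps power2_eq_square power3_eq_cube)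
    also have "\<dots> = 0" unfolding M step.IH[symmetric] y1[symmetric] 
      by (simp add: algebra_simps power2_eq_square)
    finally show ?thesis using nz by simp
  qed
  moreover have "Qx (Suc n) = M ^ 2 / 4 - wb2 W / 4 - x - Qx n"
    using Q_step(1)[OF step.hyps(1)] unfolding M_def[symmetric] by simp
  ultimately show ?case
    using third_point_on_cubic[OF y1] Q_step(2)[OF step.hyps(1)] unfolding M_def[symmetric] by simp
qed

lemma on_curve_Q: "n \<ge> 1 \<Longrightarrow> Defs.on_curve W (Qx n) (Qy n)"
  unfolding on_curve_iff_psi2 using QY_curve by (simp add: QY_def)

sublocale chord_sequence Qx QY "wb2 W" "wb4 W" "wb6 W" "wb8 W"
proof
  have Y: "QY 1 = psi2 W x y" by (simp add: QY_def Q_1[unfolded One_nat_def])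
  show "4 * wb8 W = wb2 W * wb6 W - wb4 W ^ 2"
    by (simp add: wb2_def wb4_def wb6_def wb8_def algebra_simps power2_eq_square)
  show "QY n ^ 2 = 4 * Qx n ^ 3 + wb2 W * Qx n ^ 2 + 2 * wb4 W * Qx n + wb6 W" if "1 \<le> n" for n
    by (rule QY_curve[OF that])
  show "Qx n \<noteq> Qx 1" if "2 \<le> n" for n using Qx_neq[OF that] Q_1 by simp
  show "QY 1 \<noteq> 0" using psi2_nz Y by simp
  show "Qx 2 = ((6 * Qx 1 ^ 2 + wb2 W * Qx 1 + wb4 W) / QY 1) ^ 2 / 4 - wb2 W / 4 - 2 * Qx 1"
    using Q_step(1)[of 1] unfolding Y Q_1 by (simp add: numeral_2_eq_2 Q_1[unfolded One_nat_def])
  show "QY 2 = - (QY 1 + (6 * Qx 1 ^ 2 + wb2 W * Qx 1 + wb4 W) / QY 1 * (Qx 2 - Qx 1))"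
    using Q_step(2)[of 1] unfolding Y Q_1 by (simp add: numeral_2_eq_2)
  show "Qx (Suc n) = ((QY n - QY 1) / (Qx n - Qx 1)) ^ 2 / 4 - wb2 W / 4 - Qx n - Qx 1" if "2 \<le> n" for n
    using Q_step(1)[of n] that unfolding Y Q_1 by simp
  show "QY (Suc n) = - (QY 1 + (QY n - QY 1) / (Qx n - Qx 1) * (Qx (Suc n) - Qx 1))" if "2 \<le> n" for n
    using Q_step(2)[of n] that unfolding Y Q_1 by simp
qed

lemma QY_1: "QY 1 = psi2 W x y"
  unfolding QY_def Q_1 ..

lemma division_poly_eq: "division_poly W x y n = Hi n"
  unfolding division_poly_def Hi_def
  by (simp add: division_poly_nat_eq_H Q_1[unfolded One_nat_def] QY_1[unfolded One_nat_def] psi2_def)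

end

section \<open>Integrality and denominators\<close>

lemma rat_root_monic_quadratic:
  fixes z :: rat
  assumes "z ^ 2 + of_int B * z = of_int C"
  shows "\<exists>n::int. z = of_int n"
proof -
  obtain a b :: int where ab: "b > 0" "coprime a b" "z = of_int a / of_int b"
    by (cases z) (auto simp: Fract_of_int_quotient)
  have "(of_int (a ^ 2 + B * a * b) :: rat) = of_int (C * b ^ 2)"
    using assms ab by (simp add: field_simps power2_eq_square)
  hence "a ^ 2 + B * a * b = C * b ^ 2" by (simp only: of_int_eq_iff)
  hence "a ^ 2 = b * (C * b - B * a)" by (simp add: algebra_simps power2_eq_square)
  hence "b dvd a ^ 2" by simp
  moreover have "coprime (a ^ 2) b" using ab by simp
  ultimately have "is_unit b" by (metis coprime_common_divisor dvd_refl)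
  hence "b = 1" using ab by simp
  thus ?thesis using ab by auto
qed

locale eds_point =
  fixes W :: "int weierstrass" and x y :: int
  assumes on_curve_int: "on_curve W x y"
    and inf_order: "infinite_order (rat_curve W) (rat_point x y)"
    and good_reduction: "everywhere_good_reduction W x y"
begin

lemma wa_rat [simp]:
  "wa1 (rat_curve W) = of_int (wa1 W)" "wa2 (rat_curve W) = of_int (wa2 W)"
  "wa3 (rat_curve W) = of_int (wa3 W)" "wa4 (rat_curve W) = of_int (wa4 W)"
  "wa6 (rat_curve W) = of_int (wa6 W)"
  by (simp_all add: weierstrass.map_sel)

lemma wb_rat:
  "wb2 (rat_curve W) = of_int (wb2 W)" "wb4 (rat_curve W) = of_int (wb4 W)"
  "wb6 (rat_curve W) = of_int (wb6 W)" "wb8 (rat_curve W) = of_int (wb8 W)"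
  by (simp_all add: wb2_def wb4_def wb6_def wb8_def)

lemma psi2_rat: "psi2 (rat_curve W) (of_int x) (of_int y) = of_int (psi2 W x y)"
  by (simp add: psi2_def)

sublocale infinite_order_point "rat_curve W" "of_int x" "of_int y"
proof
  have "(of_int (y ^ 2 + wa1 W * x * y + wa3 W * y) :: rat) = of_int (x ^ 3 + wa2 W * x ^ 2 + wa4 W * x + wa6 W)"
    using on_curve_int unfolding on_curve_def by simp
  thus "Defs.on_curve (rat_curve W) (of_int x) (of_int y)"
    unfolding on_curve_def by simp
qed (rule inf_order)

lemma H_Ints': "H n \<in> \<int>"
proof -
  obtain g where "g \<in> \<int>" "H n = (if even n then QY 1 * g else g)"
    using H_Ints[of n] unfolding wb_rat Q_1 QY_1 psi2_rat by auto
  moreover have "QY 1 \<in> \<int>" unfolding QY_1 psi2_rat by simp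
  ultimately show ?thesis by auto
qed

text \<open>The floor only changes the type, as \<open>Hi n\<close> is already an integer.\<close>

definition h :: "int \<Rightarrow> int" where "h n = \<lfloor>Hi n\<rfloor>"

lemma of_int_h [simp]: "of_int (h n) = Hi n"
proof -
  have "Hi n \<in> \<int>" using H_Ints' by (simp add: Hi_def)
  thus ?thesis by (auto simp: h_def elim: Ints_cases)
qed

lemma h_eqI: "Hi n = of_int k \<Longrightarrow> h n = k"
  by (simp add: h_def)

lemma h_0 [simp]: "h 0 = 0" and h_1 [simp]: "h 1 = 1"
  by (rule h_eqI, simp add: Hi_def)+

lemma h_minus: "h (- n) = - h n"
  by (rule h_eqI) (simp add: Hi_minus)

lemma h_elliptic:
  "h (m + n) * h (m - n) = h (m + 1) * h (m - 1) * h n ^ 2 - h (n + 1) * h (n - 1) * h m ^ 2"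
proof -
  have "(of_int (h (m + n) * h (m - n)) :: rat)
    = of_int (h (m + 1) * h (m - 1) * h n ^ 2 - h (n + 1) * h (n - 1) * h m ^ 2)"
    using Hi_elliptic[of m n] by simp
  thus ?thesis by (simp only: of_int_eq_iff)
qed

lemma h_nz: "n \<noteq> 0 \<Longrightarrow> h n \<noteq> 0"
proof -
  assume "n \<noteq> 0"
  hence "Hi n \<noteq> 0" by (auto simp: Hi_def)
  thus ?thesis by (metis of_int_0 of_int_h)
qed

section \<open>Coprimality of consecutive terms\<close>

lemma h_2: "h 2 = psi2 W x y"
  by (rule h_eqI) (use QY_1 H_2 psi2_rat in \<open>simp add: Hi_def\<close>)

lemma h_3: "h 3 = 3 * x ^ 4 + wb2 W * x ^ 3 + 3 * wb4 W * x ^ 2 + 3 * wb6 W * x + wb8 W"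
  by (rule h_eqI) (simp add: Hi_def H_3[unfolded Q_1 wb_rat])

lemma h_4: "h 4 = h 2 * (2 * x ^ 6 + wb2 W * x ^ 5 + 5 * wb4 W * x ^ 4 + 10 * wb6 W * x ^ 3
  + 10 * wb8 W * x ^ 2 + (wb2 W * wb8 W - wb4 W * wb6 W) * x + (wb4 W * wb8 W - wb6 W ^ 2))"
  unfolding h_2 by (rule h_eqI) (simp add: Hi_def H_4[unfolded Q_1 wb_rat QY_1 psi2_rat])

text \<open>The two partial derivatives are \<open>h 2\<close> and, up to sign, \<open>t\<close>. As
  \<open>t ^ 2\<close> lies in the ideal generated by \<open>h 2\<close> and \<open>h 3\<close>, a
  common prime factor would make the reduction singular.\<close>

lemma h_2_3_nonsingular:
  assumes "prime q" "q dvd h 2" "q dvd h 3"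
  shows False
proof -
  define t where "t = wa1 W * y - (3 * x ^ 2 + 2 * wa2 W * x + wa4 W)"
  have F: "y ^ 2 + wa1 W * x * y + wa3 W * y - (x ^ 3 + wa2 W * x ^ 2 + wa4 W * x + wa6 W) = 0"
    using on_curve_int by (simp add: on_curve_def)
  \<comment> \<open>On the curve this is \<open>h 3 = h 2 ^ 2 * (x(P) - x(2 P))\<close>, where
    \<open>x(2 P)\<close> is expressed by the tangent slope \<open>- t / h 2\<close>.\<close>
  have "h 3 + (12 * x + wb2 W) * (y ^ 2 + wa1 W * x * y + wa3 W * y - (x ^ 3 + wa2 W * x ^ 2 + wa4 W * x + wa6 W))
    = (3 * x + wa2 W) * h 2 ^ 2 - t ^ 2 + wa1 W * t * h 2"
    unfolding h_2 h_3 t_def psi2_def wb2_def wb4_def wb6_def wb8_def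
    by (simp add: algebra_simps eval_nat_numeral)
  hence "t ^ 2 = h 2 * ((3 * x + wa2 W) * h 2 + wa1 W * t) - h 3"
    unfolding F by (simp add: algebra_simps power2_eq_square)
  hence "q dvd t ^ 2" using assms by simp
  hence "q dvd t" using assms(1) prime_dvd_power by blast
  moreover have "q dvd 2 * y + wa1 W * x + wa3 W" using assms(2) by (simp add: h_2 psi2_def)
  moreover have "nonsingular_mod W x y q"
    using good_reduction assms(1) by (simp add: everywhere_good_reduction_def)
  ultimately show False by (simp add: nonsingular_mod_def t_def cong_0_iff)
qed

text \<open>Modulo \<open>h 3\<close> the term \<open>h 4\<close> is \<open>- h 2 ^ 5\<close>, so a
  common prime factor would divide \<open>h 2\<close> too.\<close>

lemma h_3_4_nonsingular:
  assumes q: "prime q" and "q dvd h 3" "q dvd h 4"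
  shows False
proof -
  have F: "x ^ 3 + wa2 W * x ^ 2 + wa4 W * x + wa6 W = y ^ 2 + wa1 W * x * y + wa3 W * y"
    using on_curve_int by (simp add: on_curve_def)
  define f where "f = 4 * x ^ 3 + wb2 W * x ^ 2 + 2 * wb4 W * x + wb6 W"
  have f: "h 2 ^ 2 = f"
  proof -
    have "f = 4 * (x ^ 3 + wa2 W * x ^ 2 + wa4 W * x + wa6 W) + wa1 W ^ 2 * x ^ 2 + 2 * wa1 W * wa3 W * x + wa3 W ^ 2"
      by (simp add: f_def wb2_def wb4_def wb6_def algebra_simps)
    also have "\<dots> = h 2 ^ 2" unfolding F h_2 psi2_def by (simp add: algebra_simps power2_eq_square)
    finally show ?thesis ..
  qed
  have b8: "4 * wb8 W = wb2 W * wb6 W - wb4 W ^ 2"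
    by (simp add: wb2_def wb4_def wb6_def wb8_def algebra_simps power2_eq_square)
  have "2 * x ^ 6 + wb2 W * x ^ 5 + 5 * wb4 W * x ^ 4 + 10 * wb6 W * x ^ 3
    + 10 * wb8 W * x ^ 2 + (wb2 W * wb8 W - wb4 W * wb6 W) * x + (wb4 W * wb8 W - wb6 W ^ 2)
    = h 3 * (6 * x ^ 2 + wb2 W * x + wb4 W) - f ^ 2"
    unfolding h_3 f_def using b8 by Groebner_Basis.algebra
  hence h4: "h 4 = h 2 * (h 3 * (6 * x ^ 2 + wb2 W * x + wb4 W) - h 2 ^ 4)"
    unfolding h_4 f[symmetric] by (simp flip: power_mult)
  have "q dvd h 2 ^ 5"
  proof -
    have "h 2 ^ 5 = h 3 * (h 2 * (6 * x ^ 2 + wb2 W * x + wb4 W)) - h 4"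
      unfolding h4 by (simp add: algebra_simps eval_nat_numeral)
    thus ?thesis using assms by simp
  qed
  hence "q dvd h 2" using q prime_dvd_power by blast
  thus False using h_2_3_nonsingular[OF q _ assms(2)] by blast
qed

text \<open>Descent: zeros at \<open>n\<close> and \<open>n + 1\<close> modulo \<open>q\<close> give
  \<open>q dvd h 3\<close> by the elliptic identity for \<open>n - 1\<close> and \<open>2\<close>,
  then a zero at \<open>n - 3\<close> by the one for \<open>n - 2\<close> and \<open>2\<close>, then
  a zero at \<open>n - 2\<close> by the one for \<open>n - 2\<close> and \<open>3\<close>. This is
  an earlier adjacent pair.\<close>

lemma h_adjacent_nat:
  assumes q: "prime q" and k: "q dvd h (int k)" "q dvd h (int k + 1)"
  shows False
  using k
proof (induction k rule: less_induct)
  case (less k)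
  have q1: "\<not> q dvd 1" using q by auto
  consider "k = 0" | "k = 1" | "k = 2" | "k \<ge> 3" by linarith
  thus ?case
  proof cases
    case 4
    define n where "n = int k"
    have dn: "q dvd h n" "q dvd h (n + 1)" using less.prems by (simp_all add: n_def)
    have adj: False if "q dvd h m" "q dvd h (m + 1)" "0 \<le> m" "m < n" for m
      using less.IH[of "nat m"] that by (simp add: n_def nat_less_iff)
    have nd: "\<not> q dvd h (n - 1)" using adj[of "n - 1"] dn 4 by (auto simp: n_def)
    have pm: "q dvd a * b \<longleftrightarrow> q dvd a \<or> q dvd b" for a b using q prime_dvd_mult_iff by blast
    have pp: "q dvd a ^ 2 \<longleftrightarrow> q dvd a" for a using q by (simp add: prime_dvd_power_iff)
    have "h 3 * h (n - 1) ^ 2 = h n * (h (n - 2) * h 2 ^ 2) - h (n + 1) * h (n - 3)"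
      using h_elliptic[of "n - 1" 2] by (simp add: algebra_simps)
    hence "q dvd h 3 * h (n - 1) ^ 2" using dn by simp
    hence h3: "q dvd h 3" using nd pm pp by blast
    have n2: "\<not> q dvd h 2" using h_2_3_nonsingular[OF q _ h3] by blast
    have "h (n - 1) * h (n - 3) * h 2 ^ 2 = h n * h (n - 4) + h 3 * h (n - 2) ^ 2"
      using h_elliptic[of "n - 2" 2] by (simp add: algebra_simps)
    hence "q dvd h (n - 1) * h (n - 3) * h 2 ^ 2" using dn h3 by simp
    hence n3: "q dvd h (n - 3)" using nd n2 pm pp by blast
    have "h 4 * h 2 * h (n - 2) ^ 2 = h 3 * (h 3 * h (n - 1) * h (n - 3)) - h (n + 1) * h (n - 5)"
      using h_elliptic[of "n - 2" 3] by (simp add: algebra_simps power2_eq_square)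
    hence "q dvd h 4 * h 2 * h (n - 2) ^ 2" using dn h3 by simp
    moreover have "\<not> q dvd h 4" using h_3_4_nonsingular[OF q h3] by blast
    ultimately have n2': "q dvd h (n - 2)" using n2 pm pp by blast
    show False using adj[of "n - 3"] n3 n2' 4 by (simp add: n_def)
  next
    case 3
    thus ?thesis using h_2_3_nonsingular[OF q] less.prems by simp
  qed (use less.prems q1 h_1 in auto)
qed

lemma h_adjacent:
  assumes q: "prime q" and n: "q dvd h n" "q dvd h (n + 1)"
  shows False
proof (cases "n \<ge> 0")
  case True
  thus ?thesis using h_adjacent_nat[OF q, of "nat n"] n by simp
next
  case False
  have "h (- n) = - h n" "h (- n - 1) = - h (n + 1)"
    using h_minus[of n] h_minus[of "n + 1"] by simp_all
  thus ?thesis using h_adjacent_nat[OF q, of "nat (- n - 1)"] n False by simp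
qed

section \<open>Numerators and denominators of the multiples\<close>

definition \<phi> :: "int \<Rightarrow> int" where
  "\<phi> n = x * h n ^ 2 - h (n + 1) * h (n - 1)"

text \<open>Modulo \<open>h n\<close> the numerator is \<open>- h (n + 1) * h (n - 1)\<close>, and a
  prime factor of \<open>h n\<close> divides neither neighbour. Good reduction enters through
  \<open>h_adjacent\<close>.\<close>

lemma coprime_\<phi>_h: "coprime (\<phi> n) (h n)"
proof (rule ccontr)
  assume "\<not> coprime (\<phi> n) (h n)"
  hence "\<not> is_unit (gcd (\<phi> n) (h n))" by (simp add: coprime_iff_gcd_eq_1)
  moreover have "gcd (\<phi> n) (h n) \<noteq> 0"
    using h_nz[of n] h_minus[of 1] by (cases "n = 0") (simp_all add: \<phi>_def)
  ultimately obtain p where p: "prime p" "p dvd gcd (\<phi> n) (h n)"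
    by (metis prime_divisorE)
  hence p: "prime p" "p dvd \<phi> n" "p dvd h n" by simp_all
  have "h (n + 1) * h (n - 1) = x * h n * h n - \<phi> n" by (simp add: \<phi>_def power2_eq_square)
  hence "p dvd h (n + 1) * h (n - 1)" using p by simp
  thus False using h_adjacent[OF p(1), of n] h_adjacent[OF p(1), of "n - 1"] p prime_dvd_mult_iff by auto
qed

lemma Qx_\<phi>:
  assumes "n \<ge> 1"
  shows "Qx n = of_int (\<phi> (int n)) / of_int (h (int n)) ^ 2"
proof -
  have "Hi (int n + 1) = H (Suc n)" "Hi (int n - 1) = H (n - 1)"
    unfolding Hi_of_nat[symmetric] using assms by (simp_all add: of_nat_diff add.commute)
  hence "of_int (\<phi> (int n)) = of_int x * H n ^ 2 - H (Suc n) * H (n - 1)"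
    by (simp add: \<phi>_def Hi_of_nat)
  also have "\<dots> = H n ^ 2 * Qx n"
    unfolding H_step[OF assms] Q_1 by (simp add: algebra_simps)
  finally show ?thesis using assms by (simp add: Hi_of_nat)
qed

lemma denominator_unique:
  fixes a f e g :: int
  assumes "(of_int a :: rat) / of_int (e ^ 2) = of_int f / of_int g ^ 2"
    and "coprime a e" "coprime f g" "e > 0" "g \<noteq> 0"
  shows "e = \<bar>g\<bar>"
proof -
  have "(of_int (a * g ^ 2) :: rat) = of_int (f * e ^ 2)"
    using assms by (simp add: field_simps)
  hence eq: "a * g ^ 2 = f * e ^ 2" by (simp only: of_int_eq_iff)
  have "e ^ 2 dvd a * g ^ 2" "g ^ 2 dvd f * e ^ 2" using eq by (simp_all) (metis dvd_triv_right)
  hence "e ^ 2 dvd g ^ 2" "g ^ 2 dvd e ^ 2"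
    using assms(2,3) by (auto simp: coprime_dvd_mult_right_iff coprime_commute)
  hence "e dvd g" "g dvd e" by simp_all
  hence "\<bar>e\<bar> = \<bar>g\<bar>" using zdvd_antisym_abs by blast
  thus ?thesis using assms(4) by simp
qed

text \<open>Multiplied by \<open>G ^ 6\<close>, the equation of the curve becomes a monic quadratic
  with integer coefficients for \<open>v * G ^ 3\<close>, so this number is an integer
  \<open>b\<close>. The same equation shows that a common divisor of \<open>b\<close> and
  \<open>g\<close> divides \<open>f ^ 3\<close>.\<close>

lemma denominator_affine:
  assumes c: "Defs.on_curve (rat_curve W) u v" and u: "u = of_int f / of_int g ^ 2"
    and fg: "coprime f g" "g \<noteq> 0"
  shows "(THE e. e > 0 \<and> (\<exists>a b. coprime (a * b) e \<and>
    Affine u v = Affine (of_int a / of_int (e ^ 2)) (of_int b / of_int (e ^ 3)))) = \<bar>g\<bar>"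
proof (rule the_equality)
  fix e :: int
  assume "e > 0 \<and> (\<exists>a b. coprime (a * b) e \<and>
    Affine u v = Affine (of_int a / of_int (e ^ 2)) (of_int b / of_int (e ^ 3)))"
  thus "e = \<bar>g\<bar>" using denominator_unique[of _ e f g] u fg by auto
next
  define G :: rat where "G = of_int \<bar>g\<bar>"
  have G: "G \<noteq> 0" "G ^ 2 = of_int g ^ 2" using fg by (simp_all add: G_def flip: of_int_power)
  have u: "u * G ^ 2 = of_int f" using u G fg by simp
  define z where "z = v * G ^ 3"
  have "z ^ 2 + of_int (wa1 W) * (u * G ^ 2) * G * z + of_int (wa3 W) * G ^ 3 * z
    = G ^ 6 * (v ^ 2 + of_int (wa1 W) * u * v + of_int (wa3 W) * v)"
    by (simp add: z_def algebra_simps eval_nat_numeral)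
  also have "\<dots> = G ^ 6 * (u ^ 3 + of_int (wa2 W) * u ^ 2 + of_int (wa4 W) * u + of_int (wa6 W))"
    using c by (simp add: on_curve_def)
  also have "\<dots> = (u * G ^ 2) ^ 3 + of_int (wa2 W) * (u * G ^ 2) ^ 2 * G ^ 2 + of_int (wa4 W) * (u * G ^ 2) * G ^ 4
      + of_int (wa6 W) * G ^ 6"
    by (simp add: algebra_simps eval_nat_numeral)
  finally have eq: "z ^ 2 + of_int (wa1 W * f * \<bar>g\<bar> + wa3 W * \<bar>g\<bar> ^ 3) * z
    = of_int (f ^ 3 + wa2 W * f ^ 2 * \<bar>g\<bar> ^ 2 + wa4 W * f * \<bar>g\<bar> ^ 4 + wa6 W * \<bar>g\<bar> ^ 6)"
    unfolding u by (simp add: G_def algebra_simps)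
  then obtain b where b: "z = of_int b" using rat_root_monic_quadratic by blast
  have "(of_int (b ^ 2 + (wa1 W * f * \<bar>g\<bar> + wa3 W * \<bar>g\<bar> ^ 3) * b) :: rat)
    = of_int (f ^ 3 + wa2 W * f ^ 2 * \<bar>g\<bar> ^ 2 + wa4 W * f * \<bar>g\<bar> ^ 4 + wa6 W * \<bar>g\<bar> ^ 6)"
    using eq unfolding b by simp
  hence eqi: "b ^ 2 + (wa1 W * f * \<bar>g\<bar> + wa3 W * \<bar>g\<bar> ^ 3) * b
    = f ^ 3 + wa2 W * f ^ 2 * \<bar>g\<bar> ^ 2 + wa4 W * f * \<bar>g\<bar> ^ 4 + wa6 W * \<bar>g\<bar> ^ 6"
    by (simp only: of_int_eq_iff)
  have "f ^ 3 = b * (b + wa1 W * f * \<bar>g\<bar> + wa3 W * \<bar>g\<bar> ^ 3) - \<bar>g\<bar> * 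
    (wa2 W * f ^ 2 * \<bar>g\<bar> + wa4 W * f * \<bar>g\<bar> ^ 3 + wa6 W * \<bar>g\<bar> ^ 5)"
    using eqi by (simp add: algebra_simps eval_nat_numeral)
  hence dvd: "d dvd f ^ 3" if "d dvd b" "d dvd \<bar>g\<bar>" for d
    using that by (metis dvd_diff dvd_mult2)
  have "coprime (f ^ 3) \<bar>g\<bar>" using fg by simp
  hence "coprime b \<bar>g\<bar>" using dvd by (meson coprime_def)
  hence "coprime (f * b) \<bar>g\<bar>" using fg by simp
  moreover have "u = of_int f / of_int (\<bar>g\<bar> ^ 2)" using u G by (simp add: G_def field_simps)
  moreover have "v = of_int b / of_int (\<bar>g\<bar> ^ 3)" using b[symmetric] G by (simp add: G_def z_def field_simps)
  ultimately show "\<bar>g\<bar> > 0 \<and> (\<exists>a b. coprime (a * b) \<bar>g\<bar> \<and>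
    Affine u v = Affine (of_int a / of_int (\<bar>g\<bar> ^ 2)) (of_int b / of_int (\<bar>g\<bar> ^ 3)))"
    using fg by auto
qed

lemma on_curve_neg:
  "Defs.on_curve (rat_curve W) u v \<Longrightarrow> Defs.on_curve (rat_curve W) u (- v - of_int (wa1 W) * u - of_int (wa3 W))"
  by (simp add: on_curve_def algebra_simps power2_eq_square)

lemma eds_denom_eq:
  assumes "n \<noteq> 0"
  shows "eds_denom W x y n = \<bar>h n\<bar>"
proof (cases "n > 0")
  case True
  hence n: "nat n \<ge> 1" "int (nat n) = n" by simp_all
  have "ec_mult (rat_curve W) n (rat_point x y) = Affine (Qx (nat n)) (Qy (nat n))"
    using True Q_affine[OF n(1)] by (simp add: ec_mult_def Q_def)
  thus ?thesis unfolding eds_denom_def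
    using denominator_affine[OF on_curve_Q[OF n(1)] Qx_\<phi>[OF n(1)]] coprime_\<phi>_h[of n] h_nz[OF assms] n(2) by simp
next
  case False
  hence n: "nat (- n) \<ge> 1" "int (nat (- n)) = - n" using assms by simp_all
  have "ec_mult (rat_curve W) n (rat_point x y) = Affine (Qx (nat (- n))) 
      (- Qy (nat (- n)) - of_int (wa1 W) * Qx (nat (- n)) - of_int (wa3 W))"
    using False assms Q_affine[OF n(1)] by (simp add: ec_mult_def Q_def)
  thus ?thesis unfolding eds_denom_def
    using denominator_affine[OF on_curve_neg[OF on_curve_Q[OF n(1)]] Qx_\<phi>[OF n(1)]]
      coprime_\<phi>_h[of "- n"] h_nz[of "- n"] h_minus[of n] assms n(2) by simp
qed

text \<open>Since nothing cancels between numerator and denominator, the latter contributes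
  \<open>\<bar>h n\<bar>\<close>, and the division polynomial contributes the sign of
  \<open>h n\<close>.\<close>

theorem eds_eq_h: "eds W x y n = h n"
proof (cases "n = 0")
  case False
  have s: "division_poly (rat_curve W) (of_int x) (of_int y) n = of_int (h n)"
    by (simp add: division_poly_eq)
  show ?thesis unfolding eds_def s
    using False eds_denom_eq[of 1] eds_denom_eq[OF False] h_nz[OF False]
    by (auto simp: Let_def simp del: of_int_h)
qed (simp add: eds_def)

end

section \<open>Growth and period\<close>

context eds_point begin

text \<open>The duplication recurrences bound \<open>h n\<close> by a product of four terms of index
  at most \<open>n div 2 + 2\<close>. A cubic exponent passes through this induction with room to
  spare, which a quadratic one would not: \<open>1 + 4 * (m + 2) ^ 3 \<le> (2 * m) ^ 3\<close> holds
  from \<open>m = 8\<close> on, whence the \<open>16\<close> initial values.\<close>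

theorem h_growth: "\<exists>K\<ge>2. \<forall>n::nat. \<bar>h (int n)\<bar> \<le> K ^ (n ^ 3)"
proof -
  \<comment> \<open>The sum takes care of the initial values, the summand \<open>2\<close> of the
    two products in each recurrence.\<close>
  define K where "K = 2 + (\<Sum>i<16. \<bar>h (int i)\<bar>)"
  have "(\<Sum>i<16. \<bar>h (int i)\<bar>) \<ge> 0" by (rule sum_nonneg) simp
  hence K2: "K \<ge> 2" by (simp add: K_def)
  have prod_bound: "\<bar>a * b * c * d - a' * b' * c' * d'\<bar> \<le> K * B ^ 4"
    if "\<bar>a\<bar> \<le> B" "\<bar>b\<bar> \<le> B" "\<bar>c\<bar> \<le> B" "\<bar>d\<bar> \<le> B" "\<bar>a'\<bar> \<le> B" "\<bar>b'\<bar> \<le> B" "\<bar>c'\<bar> \<le> B" "\<bar>d'\<bar> \<le> B"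
    for a b c d a' b' c' d' B :: int
  proof -
    have *: "\<bar>a * b * c * d\<bar> \<le> B ^ 4" if "\<bar>a\<bar> \<le> B" "\<bar>b\<bar> \<le> B" "\<bar>c\<bar> \<le> B" "\<bar>d\<bar> \<le> B" for a b c d :: int
    proof -
      have "\<bar>a\<bar> * \<bar>b\<bar> * \<bar>c\<bar> * \<bar>d\<bar> \<le> B * B * B * B"
        using that by (intro mult_mono) auto
      thus ?thesis by (simp add: abs_mult eval_nat_numeral algebra_simps)
    qed
    have "\<bar>a * b * c * d - a' * b' * c' * d'\<bar> \<le> 2 * B ^ 4"
      using *[OF that(1-4)] *[OF that(5-8)] by linarith
    also have "\<dots> \<le> K * B ^ 4" using K2 by (intro mult_right_mono) auto
    finally show ?thesis .
  qed
  have "\<bar>h (int n)\<bar> \<le> K ^ (n ^ 3)" for n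
  proof (induction n rule: less_induct)
    case (less n)
    show ?case
    proof (cases "n < 16")
      case True
      show ?thesis
      proof (cases "n = 0")
        case False
        have "\<bar>h (int n)\<bar> \<le> (\<Sum>i<16. \<bar>h (int i)\<bar>)" 
          using True by (intro member_le_sum) auto
        also have "\<dots> \<le> K ^ 1" by (simp add: K_def)
        also have "\<dots> \<le> K ^ (n ^ 3)" using K2 False by (intro power_increasing) auto
        finally show ?thesis .
      qed auto
    next
      case False
      define m where "m = n div 2"
      have m: "m \<ge> 8" using False by (simp add: m_def)
      define B where "B = K ^ ((m + 2) ^ 3)"
      have b: "\<bar>h (int j)\<bar> \<le> B" if "j \<le> m + 2" for j
      proof -
        have "j < n" using that False by (simp add: m_def)
        hence "\<bar>h (int j)\<bar> \<le> K ^ (j ^ 3)" by (rule less.IH)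
        also have "\<dots> \<le> B" unfolding B_def using K2 that by (intro power_increasing power_mono) auto
        finally show ?thesis .
      qed
      have nn: "int m + 1 = int (m + 1)" "int m - 1 = int (m - 1)" "int m + 2 = int (m + 2)" "int m - 2 = int (m - 2)"
        using m by auto
      have bs: "\<bar>h (int m)\<bar> \<le> B" "\<bar>h (int m + 1)\<bar> \<le> B" "\<bar>h (int m - 1)\<bar> \<le> B" "\<bar>h (int m + 2)\<bar> \<le> B" "\<bar>h (int m - 2)\<bar> \<le> B"
        unfolding nn by (rule b; simp)+
      have "\<bar>h (int n)\<bar> \<le> K * B ^ 4"
      proof (cases "even n")
        case True
        hence n: "int n = 2 * int m" unfolding m_def by presburger
        have "h (int n) * h 2 = h (int m + 2) * h (int m) * h (int m - 1) * h (int m - 1)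
            - h (int m) * h (int m - 2) * h (int m + 1) * h (int m + 1)"
          using h_elliptic[of "int m + 1" "int m - 1"] unfolding n by (simp add: algebra_simps power2_eq_square)
        hence "\<bar>h (int n)\<bar> * \<bar>h 2\<bar> \<le> K * B ^ 4"
          unfolding abs_mult[symmetric] by (simp only: prod_bound bs)
        moreover have "\<bar>h (int n)\<bar> * 1 \<le> \<bar>h (int n)\<bar> * \<bar>h 2\<bar>"
          using h_nz[of 2] by (intro mult_left_mono) auto
        ultimately show ?thesis by linarith
      next
        case odd: False
        have n: "int n = 2 * int m + 1" unfolding m_def using odd by presburger
        have "h (int n) = h (int m + 2) * h (int m) * h (int m) * h (int m)
            - h (int m + 1) * h (int m - 1) * h (int m + 1) * h (int m + 1)"
          using h_elliptic[of "int m + 1" "int m"] unfolding n by (simp add: algebra_simps power2_eq_square)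
        thus ?thesis by (simp only: prod_bound bs)
      qed
      also have "\<dots> = K ^ (1 + (m + 2) ^ 3 * 4)" by (simp add: B_def power_mult)
      also have "\<dots> \<le> K ^ (n ^ 3)"
      proof (rule power_increasing)
        obtain k where k: "m = 8 + k" using m le_Suc_ex by blast
        have "1 + (m + 2) ^ 3 * 4 \<le> (2 * m) ^ 3"
          unfolding k by (simp add: power3_eq_cube algebra_simps)
        also have "\<dots> \<le> n ^ 3" by (intro power_mono) (simp_all add: m_def)
        finally show "1 + (m + 2) ^ 3 * 4 \<le> n ^ 3" .
      qed (use K2 in auto)
      finally show ?thesis .
    qed
  qed
  thus ?thesis using K2 by blast
qed

text \<open>The elliptic identity for \<open>k\<close> and \<open>2\<close> would produce a further
  zero at \<open>k + 1\<close> or at \<open>k - 1\<close>, adjacent to the one at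
  \<open>k\<close>.\<close>

lemma h_zeros_distance_2:
  assumes q: "prime q" "\<not> q dvd h 2" and "q dvd h k" "q dvd h (k + 2)"
  shows False
proof -
  have "h (k + 1) * h (k - 1) * h 2 ^ 2 = h (k + 2) * h (k - 2) + h k * (h 3 * h k)"
    using h_elliptic[of k 2] by (simp add: algebra_simps power2_eq_square)
  hence "q dvd h (k + 1) * h (k - 1) * h 2 ^ 2" using assms by simp
  hence "q dvd h (k + 1) \<or> q dvd h (k - 1)"
    using q by (simp add: prime_dvd_mult_iff prime_dvd_power_iff)
  thus False using h_adjacent[OF q(1), of k] h_adjacent[OF q(1), of "k - 1"] assms by auto
qed

text \<open>The elliptic identities at distance 2 and 3 express \<open>h (m + 6)\<close> modulo \<open>q\<close> by the six preceding terms,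
  after division by \<open>h (m + 2)\<close> and by \<open>h m\<close> respectively; these are not both zero modulo \<open>q\<close>.\<close>

definition same_window :: "int \<Rightarrow> int \<Rightarrow> int \<Rightarrow> bool" where
  "same_window q m n \<longleftrightarrow> (\<forall>i\<in>{0..5}. [h (m + i) = h (n + i)] (mod q))"

lemma same_window_next:
  assumes q: "prime q" "\<not> q dvd h 2" and w: "same_window q m n"
  shows "[h (m + 6) = h (n + 6)] (mod q)"
proof -
  have c: "[h (m + i) = h (n + i)] (mod q)" if "i \<in> {0..5}" for i
    using w that by (auto simp: same_window_def)
  have cancel: "[h (m + 6) = h (n + 6)] (mod q)"
    if "[h (m + 6) * h (m + i) = h (n + 6) * h (n + i)] (mod q)" "i \<in> {0..5}" "\<not> q dvd h (m + i)" for i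
  proof -
    have "[h (m + 6) * h (m + i) = h (n + 6) * h (m + i)] (mod q)"
      using that(1) cong_mult[OF cong_refl[of "h (n + 6)"] c[OF that(2)]] cong_trans cong_sym by blast
    moreover have "coprime (h (m + i)) q"
      using prime_imp_coprime[OF q(1) that(3)] by (simp add: coprime_commute)
    ultimately show ?thesis using cong_mult_rcancel by blast
  qed
  show ?thesis
  proof (cases "q dvd h (m + 2)")
    case False
    have E: "h (k + 6) * h (k + 2) = h (k + 5) * h (k + 3) * h 2 ^ 2 - h 3 * h (k + 4) ^ 2" for k
      using h_elliptic[of "k + 4" 2] by (simp add: algebra_simps)
    have "[h (m + 6) * h (m + 2) = h (n + 6) * h (n + 2)] (mod q)"
      unfolding E by (intro cong_diff cong_mult cong_pow cong_refl c) auto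
    thus ?thesis by (rule cancel) (use False in auto)
  next
    case True
    have E: "h (k + 6) * h (k + 0) = h (k + 4) * h (k + 2) * h 3 ^ 2 - h 4 * h 2 * h (k + 3) ^ 2" for k
      using h_elliptic[of "k + 3" 3] by (simp add: algebra_simps)
    have "[h (m + 6) * h (m + 0) = h (n + 6) * h (n + 0)] (mod q)"
      unfolding E by (intro cong_diff cong_mult cong_pow cong_refl c) auto
    thus ?thesis by (rule cancel) (use h_zeros_distance_2[OF q, of m] True in auto)
  qed
qed

text \<open>Steps backward are steps forward conjugated by the reflection \<open>n -> - n\<close>,
  which carries the window at \<open>m\<close> to the one at \<open>- m - 5\<close>.\<close>

lemma same_window_shift:
  assumes q: "prime q" "\<not> q dvd h 2" and w: "same_window q m n"
  shows "same_window q (m + k) (n + k)"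
proof -
  have up: "same_window q (m + 1) (n + 1)" if "same_window q m n" for m n
    unfolding same_window_def
  proof
    fix i :: int assume i: "i \<in> {0..5}"
    show "[h (m + 1 + i) = h (n + 1 + i)] (mod q)"
    proof (cases "i = 5")
      case False
      hence "1 + i \<in> {0..5}" using i by auto
      thus ?thesis using that by (metis same_window_def add.assoc)
    qed (use same_window_next[OF q that] in \<open>simp add: add.assoc\<close>)
  qed
  have flip: "same_window q (- m - 5) (- n - 5)" if "same_window q m n" for m n
    unfolding same_window_def
  proof
    fix i :: int assume i: "i \<in> {0..5}"
    hence "[h (m + (5 - i)) = h (n + (5 - i))] (mod q)"
      using that by (auto simp: same_window_def)
    hence "[- h (m + (5 - i)) = - h (n + (5 - i))] (mod q)"
      by (simp add: cong_minus_minus_iff)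
    moreover have "- m - 5 + i = - (m + (5 - i))" "- n - 5 + i = - (n + (5 - i))" by simp_all
    ultimately show "[h (- m - 5 + i) = h (- n - 5 + i)] (mod q)" by (simp only: h_minus)
  qed
  have down: "same_window q (m - 1) (n - 1)" if "same_window q m n" for m n
    using flip[OF up[OF flip[OF that]]] by simp
  show ?thesis
  proof (induction k rule: int_induct[of _ 0])
    case base
    thus ?case using w by simp
  next
    case (step1 i)
    thus ?case using up[of "m + i" "n + i"] by (simp add: add.assoc)
  next
    case (step2 i)
    thus ?case using down[of "m + i" "n + i"] by (simp add: algebra_simps)
  qed
qed

text \<open>Two of the \<open>q ^ 6 + 1\<close> windows starting at \<open>0\<close>, ...,
  \<open>q ^ 6\<close> coincide modulo \<open>q\<close>. Their agreement extends in both directions,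
  so the sequence is periodic from the outset and not just eventually.\<close>

theorem eds_period_bounds:
  assumes q: "prime q" "\<not> int q dvd h 2"
  shows "1 \<le> eds_period W x y q" "eds_period W x y q \<le> q ^ 6"
proof -
  have q0: "q > 0" using q(1) by (rule prime_gt_0_nat)
  have qi: "prime (int q)" using q by simp
  define w where "w j = map (\<lambda>i. h (int j + int i) mod int q) [0..<6]" for j :: nat
  define A where "A = {xs. set xs \<subseteq> {0..<int q} \<and> length xs = 6}"
  have cardA: "card A = q ^ 6" and finA: "finite A"
    using card_lists_length_eq[of "{0..<int q}" 6] finite_lists_length_eq[of "{0..<int q}" 6]
    by (simp_all add: A_def)
  have "w ` {0..q ^ 6} \<subseteq> A"
    using q0 by (auto simp: w_def A_def)
  hence "card (w ` {0..q ^ 6}) \<le> q ^ 6" using card_mono[OF finA] cardA by metis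
  hence "card (w ` {0..q ^ 6}) < card {0..q ^ 6}" by simp
  hence "\<not> inj_on w {0..q ^ 6}" by (rule pigeonhole)
  then obtain i j where ij: "i < j" "j \<le> q ^ 6" "w i = w j"
    unfolding inj_on_def by (metis atLeastAtMost_iff linorder_neqE_nat)
  have "same_window (int q) (int i) (int j)"
    unfolding same_window_def
  proof
    fix l :: int assume l: "l \<in> {0..5}"
    have "w i ! nat l = w j ! nat l" using ij by simp
    moreover have "nat l < 6" using l by auto
    ultimately show "[h (int i + l) = h (int j + l)] (mod int q)"
      using l by (simp add: w_def Cong.cong_def del: upt_Suc)
  qed
  hence "same_window (int q) (int i + k) (int j + k)" for k
    by (rule same_window_shift[OF qi q(2)])
  hence per0: "[h (int i + k) = h (int j + k)] (mod int q)" for k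
    unfolding same_window_def by (metis add.right_neutral atLeastAtMost_iff zero_le_numeral order_refl)
  have "[h (n + int (j - i)) = h n] (mod int q)" for n
    using per0[of "n - int i"] ij by (simp add: cong_sym_eq of_nat_diff algebra_simps)
  hence per: "j - i \<ge> 1 \<and> (\<forall>n. [eds W x y (n + int (j - i)) = eds W x y n] (mod int q))" (is "?P (j - i)")
    using ij by (simp add: eds_eq_h)
  show "1 \<le> eds_period W x y q" unfolding eds_period_def using LeastI[of ?P, OF per] by blast
  have "eds_period W x y q \<le> j - i" unfolding eds_period_def by (rule Least_le[of ?P, OF per])
  thus "eds_period W x y q \<le> q ^ 6" using ij by simp
qed

end

section \<open>Even characters modulo a prime\<close>

lemma dirichlet_character_cong:
  assumes \<chi>: "dirichlet_character q \<chi>" and "[a = b] (mod int q)"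
  shows "\<chi> a = \<chi> b"
proof -
  have per: "\<chi> (n + int q) = \<chi> n" for n using \<chi> by (simp add: dirichlet_character_def)
  have "\<chi> (n + int q * k) = \<chi> n" for n k
  proof (induction k rule: int_induct[of _ 0])
    case (step1 i)
    thus ?case using per[of "n + int q * i"] by (simp add: algebra_simps)
  next
    case (step2 i)
    thus ?case using per[of "n + int q * (i - 1)"] by (simp add: algebra_simps)
  qed simp
  moreover obtain k where "b = a + int q * k" using assms(2) by (auto simp: cong_iff_lin)
  ultimately show ?thesis by simp
qed

lemma dirichlet_character_1:
  assumes "dirichlet_character q \<chi>"
  shows "\<chi> 1 = 1"
proof -
  have "\<chi> (1 * 1) = \<chi> 1 * \<chi> 1" "\<chi> 1 \<noteq> 0"
    using assms unfolding dirichlet_character_def by (blast, simp)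
  thus ?thesis by simp
qed

lemma dirichlet_character_power:
  assumes "dirichlet_character q \<chi>"
  shows "\<chi> (a ^ k) = \<chi> a ^ k"
proof (induction k)
  case (Suc k)
  have "\<chi> (a * a ^ k) = \<chi> a * \<chi> (a ^ k)"
    using assms unfolding dirichlet_character_def by blast
  thus ?case using Suc by simp
qed (use dirichlet_character_1[OF assms] in simp)

definition even_characters :: "nat \<Rightarrow> (int \<Rightarrow> complex) set" where
  "even_characters q = {\<chi>. dirichlet_character q \<chi> \<and> \<chi> (- 1) = 1}"

locale primitive_root =
  fixes q g :: nat
  assumes q: "prime q" and g: "residue_primroot q g"
begin

lemma q_gt_1: "q > 1" using q by (rule prime_gt_1_nat)

lemma coprime_iff: "coprime n (int q) \<longleftrightarrow> \<not> int q dvd n"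
proof (cases "int q dvd n")
  case True
  have "\<not> coprime n (int q)"
    using coprime_common_divisor[of n "int q" "int q"] True q_gt_1 by auto
  thus ?thesis using True by simp
next
  case False
  thus ?thesis using q prime_imp_coprime[of "int q" n] by (simp add: coprime_commute)
qed

lemma ord_g: "ord q g = q - 1"
  using g q by (simp add: residue_primroot_def totient_prime)

lemma cong_power_iff: "[int g ^ i = int g ^ j] (mod int q) \<longleftrightarrow> [i = j] (mod (q - 1))"
proof -
  have "[int g ^ i = int g ^ j] (mod int q) \<longleftrightarrow> [g ^ i = g ^ j] (mod q)"
    by (simp flip: cong_int_iff)
  also have "\<dots> \<longleftrightarrow> [i = j] (mod (q - 1))"
    using order_divides_expdiff[of q g i j] g ord_g by (simp add: residue_primroot_def)
  finally show ?thesis .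
qed

lemma discrete_log_exists:
  assumes "coprime n (int q)"
  shows "\<exists>k. [n = int g ^ k] (mod int q)"
proof -
  define r where "r = nat (n mod int q)"
  have r: "int r = n mod int q" using q_gt_1 by (simp add: r_def)
  have "coprime (n mod int q) (int q)" using assms by (simp add: coprime_iff dvd_mod_iff)
  hence "coprime r q" using r by (metis coprime_int_iff)
  moreover have "r < q" using r q_gt_1 by (simp add: r_def nat_less_iff)
  moreover have "r > 0" using \<open>coprime r q\<close> q_gt_1 by (cases "r = 0") auto
  ultimately have "r \<in> totatives q" by (simp add: totatives_def)
  then obtain k where "r = g ^ k mod q"
    using residue_primroot_is_generator[OF q_gt_1 g] by (auto simp: bij_betw_def image_iff)
  hence "n mod int q = int g ^ k mod int q" using r by (simp add: zmod_int)
  thus ?thesis by (auto simp: Cong.cong_def)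
qed

lemma character_inj: "inj_on (\<lambda>\<chi>. \<chi> (int g)) {\<chi>. dirichlet_character q \<chi>}"
proof (rule inj_onI, rule ext)
  fix \<chi> \<chi>' n
  assume \<chi>: "\<chi> \<in> {\<chi>. dirichlet_character q \<chi>}" "\<chi>' \<in> {\<chi>. dirichlet_character q \<chi>}"
    and eq: "\<chi> (int g) = \<chi>' (int g)"
  show "\<chi> n = \<chi>' n"
  proof (cases "coprime n (int q)")
    case True
    then obtain k where k: "[n = int g ^ k] (mod int q)" using discrete_log_exists by blast
    have "\<chi> n = \<chi> (int g) ^ k" if "dirichlet_character q \<chi>" for \<chi>
      using dirichlet_character_cong[OF that k] dirichlet_character_power[OF that] by simp
    from this[of \<chi>] this[of \<chi>'] show ?thesis using \<chi> eq by simp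
  next
    case False
    hence "\<chi> n = 0" "\<chi>' n = 0" using \<chi> by (simp_all add: dirichlet_character_def)
    thus ?thesis by simp
  qed
qed

lemma character_root:
  assumes "dirichlet_character q \<chi>"
  shows "\<chi> (int g) ^ (q - 1) = 1"
proof -
  have "[int g ^ (q - 1) = int g ^ 0] (mod int q)"
    unfolding cong_power_iff by (simp add: Cong.cong_def)
  thus ?thesis
    using dirichlet_character_cong[OF assms] dirichlet_character_power[OF assms]
      dirichlet_character_1[OF assms] by (metis power_0)
qed

lemma finite_even_characters: "finite (even_characters q)" "card (even_characters q) \<le> q"
proof -
  have sub: "(\<lambda>\<chi>. \<chi> (int g)) ` even_characters q \<subseteq> {z. z ^ (q - 1) = 1}"
    using character_root by (auto simp: even_characters_def)
  have inj: "inj_on (\<lambda>\<chi>. \<chi> (int g)) (even_characters q)"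
    by (rule inj_on_subset[OF character_inj]) (auto simp: even_characters_def)
  have fin: "finite {z :: complex. z ^ (q - 1) = 1}" using q_gt_1 by (intro finite_roots_unity) simp
  show "finite (even_characters q)" using finite_imageD[OF finite_subset[OF sub fin] inj] .
  have "card (even_characters q) \<le> card {z :: complex. z ^ (q - 1) = 1}"
    by (rule card_inj_on_le[OF inj sub fin])
  also have "\<dots> \<le> q - 1" using q_gt_1 by (intro card_roots_unity) simp
  finally show "card (even_characters q) \<le> q" by simp
qed

lemma power_half:
  assumes "q > 2"
  shows "[int g ^ ((q - 1) div 2) = - 1] (mod int q)"
proof -
  define N where "N = (q - 1) div 2"
  have "odd q" using q assms prime_odd_nat by blast
  hence N: "q - 1 = 2 * N" "N > 0" using assms by (auto simp: N_def elim!: oddE)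
  have "[int g ^ (q - 1) = int g ^ 0] (mod int q)"
    unfolding cong_power_iff by (simp add: Cong.cong_def)
  hence "int q dvd int g ^ (2 * N) - 1" unfolding N by (simp add: cong_iff_dvd_diff)
  also have "int g ^ (2 * N) - 1 = (int g ^ N - 1) * (int g ^ N + 1)"
    unfolding mult_2 power_add by (simp add: algebra_simps)
  finally have "int q dvd int g ^ N - 1 \<or> int q dvd int g ^ N + 1"
    using q by (simp add: prime_dvd_mult_iff)
  moreover have "\<not> int q dvd int g ^ N - 1"
  proof
    assume "int q dvd int g ^ N - 1"
    hence "[int g ^ N = int g ^ 0] (mod int q)" by (simp add: cong_iff_dvd_diff)
    thus False unfolding cong_power_iff N using N by (simp add: Cong.cong_def)
  qed
  ultimately show ?thesis by (simp add: cong_iff_dvd_diff N_def)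
qed

lemma even_character_root:
  assumes "\<chi> \<in> even_characters q" "q > 2"
  shows "\<chi> (int g) ^ ((q - 1) div 2) = 1"
proof -
  have \<chi>: "dirichlet_character q \<chi>" "\<chi> (- 1) = 1" using assms by (simp_all add: even_characters_def)
  show ?thesis
    using dirichlet_character_cong[OF \<chi>(1) power_half[OF assms(2)]] dirichlet_character_power[OF \<chi>(1)] \<chi>(2)
    by simp
qed

text \<open>Determined only modulo \<open>q - 1\<close>, which suffices for powers of a
  \<open>(q - 1)\<close>-th root of unity (\<open>dlog_eqI\<close>).\<close>

definition dlog :: "int \<Rightarrow> nat" where
  "dlog n = (SOME k. [n = int g ^ k] (mod int q))"

lemma dlog: "coprime n (int q) \<Longrightarrow> [n = int g ^ dlog n] (mod int q)"
  unfolding dlog_def using someI_ex[OF discrete_log_exists] .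

lemma dlog_eqI:
  assumes "coprime n (int q)" "[n = int g ^ k] (mod int q)" "(z :: complex) ^ (q - 1) = 1"
  shows "z ^ dlog n = z ^ k"
proof -
  have "[int g ^ dlog n = int g ^ k] (mod int q)"
    using dlog[OF assms(1)] assms(2) cong_sym cong_trans by blast
  hence "[dlog n = k] (mod (q - 1))" unfolding cong_power_iff .
  hence m: "dlog n mod (q - 1) = k mod (q - 1)" by (simp add: Cong.cong_def)
  have "z ^ j = z ^ (j mod (q - 1))" for j
  proof -
    have "z ^ j = z ^ ((q - 1) * (j div (q - 1)) + j mod (q - 1))" by simp
    also have "\<dots> = (z ^ (q - 1)) ^ (j div (q - 1)) * z ^ (j mod (q - 1))"
      by (simp only: power_add power_mult)
    finally show ?thesis using assms(3) by simp
  qed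
  thus ?thesis using m by metis
qed

definition root_character :: "complex \<Rightarrow> int \<Rightarrow> complex" where
  "root_character z n = (if coprime n (int q) then z ^ dlog n else 0)"

lemma root_character:
  assumes z: "z ^ (q - 1) = 1"
  shows "dirichlet_character q (root_character z)"
proof -
  have z0: "z \<noteq> 0" using z q_gt_1 by (auto simp: power_0_left split: if_splits)
  have "root_character z (m * n) = root_character z m * root_character z n" for m n
  proof (cases "coprime m (int q) \<and> coprime n (int q)")
    case True
    have "[m * n = int g ^ (dlog m + dlog n)] (mod int q)"
      unfolding power_add using True by (intro cong_mult dlog) auto
    moreover have "coprime (m * n) (int q)" using True by simp
    ultimately have "z ^ dlog (m * n) = z ^ (dlog m + dlog n)" using dlog_eqI z by blast
    thus ?thesis using True by (simp add: root_character_def power_add)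
  qed (auto simp: root_character_def)
  moreover have "root_character z (n + int q) = root_character z n" for n
  proof (cases "coprime n (int q)")
    case True
    hence "coprime (n + int q) (int q)" by (simp add: coprime_iff)
    moreover have "[n + int q = int g ^ dlog n] (mod int q)"
      using dlog[OF True] by (simp add: Cong.cong_def)
    ultimately show ?thesis using True dlog_eqI[OF _ _ z] by (simp add: root_character_def)
  next
    case False
    hence "\<not> coprime (n + int q) (int q)" by (simp add: coprime_iff)
    thus ?thesis using False by (simp add: root_character_def)
  qed
  moreover have "root_character z n = 0 \<longleftrightarrow> \<not> coprime n (int q)" for n
    using z0 by (simp add: root_character_def)
  ultimately show ?thesis by (simp add: dirichlet_character_def)
qed

text \<open>Evaluation at \<open>g\<close> identifies all characters with the
  \<open>(q - 1)\<close>-th roots of unity. Because \<open>-1\<close> is \<open>g ^ N\<close> modulo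
  \<open>q\<close>, the even ones correspond to the \<open>N\<close>-th roots.\<close>

lemma card_even_characters:
  assumes "q > 2"
  shows "card (even_characters q) = (q - 1) div 2"
proof -
  define N where "N = (q - 1) div 2"
  have "odd q" using q assms prime_odd_nat by blast
  hence N: "q - 1 = 2 * N" "N > 0" using assms by (auto simp: N_def elim!: oddE)
  have inj: "inj_on (\<lambda>\<chi>. \<chi> (int g)) (even_characters q)"
    by (rule inj_on_subset[OF character_inj]) (auto simp: even_characters_def)
  have "(\<lambda>\<chi>. \<chi> (int g)) ` even_characters q = {z. z ^ N = 1}"
  proof (intro equalityI subsetI)
    fix z :: complex assume "z \<in> {z. z ^ N = 1}"
    hence zN: "z ^ N = 1" by simp
    hence z: "z ^ (q - 1) = 1" unfolding N by (metis mult.commute power_mult power_one)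
    have cg: "coprime (int g) (int q)" using g by (simp add: residue_primroot_def coprime_commute)
    have "root_character z (int g) = z ^ 1"
      unfolding root_character_def using cg dlog_eqI[OF cg _ z, of 1] by simp
    moreover have "root_character z (- 1) = z ^ N"
      unfolding root_character_def using dlog_eqI[OF _ _ z, of "- 1" N] power_half[OF assms]
      by (simp add: N_def cong_sym)
    hence "root_character z \<in> even_characters q"
      using root_character[OF z] zN by (simp add: even_characters_def)
    ultimately show "z \<in> (\<lambda>\<chi>. \<chi> (int g)) ` even_characters q" 
      by (intro image_eqI[of _ _ "root_character z"]) simp_all
  qed (use even_character_root[OF _ assms] in \<open>auto simp: N_def\<close>)
  hence "card (even_characters q) = card {z :: complex. z ^ N = 1}"
    by (metis card_image inj)
  also have "\<dots> = N" by (rule card_roots_unity_eq[OF N(2)])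
  finally show ?thesis by (simp add: N_def)
qed

text \<open>Write \<open>b = g ^ t\<close> modulo \<open>q\<close>. The value at \<open>g\<close> of
  a character counted here is both an \<open>N\<close>-th root of unity and killed by
  \<open>t\<close>, hence a \<open>d\<close>-th root with \<open>d = gcd N t\<close>; this is the
  fraction \<open>1 / k\<close> for \<open>k = N / d\<close>. Now \<open>b ^ k\<close> is
  \<open>1\<close> or \<open>-1\<close> modulo \<open>q\<close>, so the hypothesis forces
  \<open>T \<le> k\<close>.\<close>

lemma card_trivial_characters:
  assumes "q > 2" and b: "\<not> int q dvd b"
    and T: "\<And>k. 1 \<le> k \<Longrightarrow> k < T \<Longrightarrow> \<not> int q dvd b ^ (2 * k) - 1"
  shows "T * card {\<chi> \<in> even_characters q. \<chi> b = 1} \<le> card (even_characters q)"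
proof -
  define N where "N = (q - 1) div 2"
  have "odd q" using q assms prime_odd_nat by blast
  hence N: "q - 1 = 2 * N" "N > 0" using assms by (auto simp: N_def elim!: oddE)
  obtain t where t: "[b = int g ^ t] (mod int q)" using discrete_log_exists b coprime_iff by blast
  define d where "d = gcd N t"
  have d0: "d > 0" using N by (simp add: d_def)
  obtain k where k: "N = d * k" by (metis d_def dvd_def gcd_dvd1)
  obtain s where s: "t = d * s" by (metis d_def dvd_def gcd_dvd2)
  have inj: "inj_on (\<lambda>\<chi>. \<chi> (int g)) {\<chi> \<in> even_characters q. \<chi> b = 1}"
    by (rule inj_on_subset[OF character_inj]) (auto simp: even_characters_def)
  have sub: "(\<lambda>\<chi>. \<chi> (int g)) ` {\<chi> \<in> even_characters q. \<chi> b = 1} \<subseteq> {z. z ^ d = 1}"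
  proof safe
    fix \<chi> assume \<chi>: "\<chi> \<in> even_characters q" "\<chi> b = 1"
    define z where "z = \<chi> (int g)"
    have zN: "z ^ N = 1" using even_character_root[OF \<chi>(1) assms(1)] by (simp add: z_def N_def)
    have \<chi>': "dirichlet_character q \<chi>" using \<chi> by (simp add: even_characters_def)
    have zt: "z ^ t = 1"
      using dirichlet_character_cong[OF \<chi>' t] dirichlet_character_power[OF \<chi>'] \<chi>(2) by (simp add: z_def)
    obtain u v where "N * u = t * v + d" using bezout_nat[of N t] N by (auto simp: d_def)
    hence "z ^ (N * u) = z ^ (t * v) * z ^ d" by (simp add: power_add)
    thus "\<chi> (int g) ^ d = 1" using zN zt by (simp add: power_mult z_def)
  qed
  have fin: "finite {z :: complex. z ^ d = 1}" using d0 by (intro finite_roots_unity) simp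
  have "card {\<chi> \<in> even_characters q. \<chi> b = 1} \<le> card {z :: complex. z ^ d = 1}"
    by (rule card_inj_on_le[OF inj sub fin])
  also have "\<dots> \<le> d" using d0 by (intro card_roots_unity) simp
  finally have c: "card {\<chi> \<in> even_characters q. \<chi> b = 1} \<le> d" .
  have "[b ^ (2 * k) = (int g ^ t) ^ (2 * k)] (mod int q)" using t by (rule cong_pow)
  also have "(int g ^ t) ^ (2 * k) = int g ^ ((q - 1) * s)"
    unfolding power_mult[symmetric] N k s by (simp add: mult_ac)
  also have "[int g ^ ((q - 1) * s) = int g ^ 0] (mod int q)"
    unfolding cong_power_iff by (simp add: Cong.cong_def)
  finally have "int q dvd b ^ (2 * k) - 1" by (simp add: cong_iff_dvd_diff)
  moreover have "k \<ge> 1" using k N by (cases k) auto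
  ultimately have "T \<le> k" using T[of k] by force
  hence "T * card {\<chi> \<in> even_characters q. \<chi> b = 1} \<le> k * d" using c by (rule mult_le_mono)
  also have "\<dots> = card (even_characters q)"
    using card_even_characters[OF assms(1)] k by (simp add: N_def mult.commute)
  finally show ?thesis .
qed

end

section \<open>Counting primes\<close>

text \<open>The entry in row \<open>n\<close> and column \<open>m\<close> of the Leibniz harmonic triangle is the reciprocal of
  \<open>m * (n choose m)\<close>; it is the difference of two entries of the preceding column.\<close>

lemma binomial_dvd_Lcm:
  assumes "1 \<le> m" "m \<le> n"
  shows "m * (n choose m) dvd Lcm {1..n}"
proof -
  have "(of_nat (Lcm {1..n}) / of_nat (m * (n choose m)) :: rat) \<in> \<int>"
    using assms
  proof (induction m arbitrary: n rule: dec_induct)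
    case base
    have "n dvd Lcm {1..n}" using base by (intro dvd_Lcm) auto
    then obtain c where "Lcm {1..n} = n * c" by (auto simp: dvd_def)
    thus ?case using base by simp
  next
    case (step m)
    then obtain k where n: "n = Suc k" "m \<le> k" by (cases n) auto
    have "Lcm {1..k} dvd Lcm {1..n}"
      using n by (intro Lcm_least dvd_Lcm) auto
    then obtain c where c: "Lcm {1..n} = Lcm {1..k} * c" by (auto simp: dvd_def)
    define a b d where "a = m * (k choose m)" and "b = m * (n choose m)" and "d = Suc m * (n choose Suc m)"
    have pos: "a > 0" "b > 0" "d > 0" using step.hyps n by (simp_all add: a_def b_def d_def)
    have 1: "d = (Suc k) * (k choose m)" unfolding d_def n using Suc_times_binomial_eq[of k m] by simp
    have "Suc k * (k choose m) = (Suc k - m) * (Suc k choose m)"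
      using binomial_absorb_comp[of "Suc k" m] by simp
    hence 2: "m * d = (Suc k - m) * b" unfolding 1 b_def n by simp
    have 3: "m * d = Suc k * a" unfolding 1 a_def by (simp add: algebra_simps)
    have r2: "(of_nat m * of_nat d :: rat) = (of_nat (Suc k) - of_nat m) * of_nat b"
      using 2 n by (metis of_nat_diff of_nat_mult le_SucI)
    have r3: "(of_nat m * of_nat d :: rat) = of_nat (Suc k) * of_nat a"
      using 3 by (metis of_nat_mult)
    have m: "(of_nat m :: rat) \<noteq> 0" and K: "(of_nat (Suc k) :: rat) \<noteq> 0" using step.hyps by simp_all
    have "(1 :: rat) / of_nat a = of_nat (Suc k) / (of_nat m * of_nat d)"
      unfolding r3 using K by simp
    moreover have "(1 :: rat) / of_nat b = (of_nat (Suc k) - of_nat m) / (of_nat m * of_nat d)"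
      unfolding r2 using n by simp
    ultimately have "(1 :: rat) / of_nat d = 1 / of_nat a - 1 / of_nat b"
      using m by (simp add: diff_divide_distrib)
    hence "of_nat (Lcm {1..n}) * ((1 :: rat) / of_nat d)
      = of_nat (Lcm {1..n}) / of_nat a - of_nat (Lcm {1..n}) / of_nat b"
      by (simp only: right_diff_distrib times_divide_eq_right mult_1_right)
    moreover have "(of_nat (Lcm {1..n}) / of_nat a :: rat) = of_nat c * (of_nat (Lcm {1..k}) / of_nat a)"
      unfolding c by simp
    ultimately have eq: "(of_nat (Lcm {1..n}) / of_nat d :: rat)
      = of_nat c * (of_nat (Lcm {1..k}) / of_nat a) - of_nat (Lcm {1..n}) / of_nat b"
      by simp
    have "(of_nat (Lcm {1..k}) / of_nat a :: rat) \<in> \<int>"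
      unfolding a_def using n by (intro step.IH) auto
    moreover have "(of_nat (Lcm {1..n}) / of_nat b :: rat) \<in> \<int>"
      unfolding b_def using n by (intro step.IH) auto
    ultimately show ?case unfolding d_def[symmetric] eq by (intro Ints_diff Ints_mult Ints_of_nat)
  qed
  then obtain i where i: "(of_nat (Lcm {1..n}) / of_nat (m * (n choose m)) :: rat) = of_int i"
    by (auto elim: Ints_cases)
  have nz: "m * (n choose m) \<noteq> 0" using assms by simp
  have "(of_int (int (Lcm {1..n})) :: rat) = of_int (i * int (m * (n choose m)))"
    using i nz by (simp add: field_simps)
  hence "int (Lcm {1..n}) = i * int (m * (n choose m))" by (simp only: of_int_eq_iff)
  hence "int (m * (n choose m)) dvd int (Lcm {1..n})" by simp
  thus ?thesis by (simp only: int_dvd_int_iff)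
qed

text \<open>The sum of the \<open>n\<close> numbers \<open>m * (n choose m)\<close> is
  \<open>n * 2 ^ (n - 1)\<close>, and each of them divides the least common multiple.\<close>

lemma Lcm_lower_bound:
  assumes "n \<ge> 1"
  shows "2 ^ (n - 1) \<le> Lcm {1..n}"
proof -
  have pos: "Lcm {1..n} > 0" by (auto intro!: Nat.gr0I simp: Lcm_0_iff)
  have "n * 2 ^ (n - 1) = (\<Sum>m\<le>n. m * (n choose m))"
    using choose_linear_sum[of n] by simp
  also have "\<dots> = (\<Sum>m\<in>{1..n}. m * (n choose m))"
    by (rule sum.mono_neutral_right) auto
  also have "\<dots> \<le> (\<Sum>m\<in>{1..n}. Lcm {1..n})"
    using pos by (intro sum_mono dvd_imp_le[OF binomial_dvd_Lcm]) auto
  also have "\<dots> = n * Lcm {1..n}" by simp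
  finally show ?thesis using assms by simp
qed

definition primes_upto :: "nat \<Rightarrow> nat set" where
  "primes_upto n = {p. prime p \<and> p \<le> n}"

lemma finite_primes_upto [simp]: "finite (primes_upto n)"
  by (rule finite_subset[of _ "{..n}"]) (auto simp: primes_upto_def)

text \<open>Every prime up to \<open>n\<close> contributes to the least common multiple a power that
  is itself at most \<open>n\<close>.\<close>

lemma Lcm_upper_bound: "Lcm {1..n} \<le> n ^ card (primes_upto n)"
proof (cases "n = 0")
  case False
  define e where "e p = Max {k. p ^ k \<le> n}" for p
  have fin: "finite {k. p ^ k \<le> n}" if "prime p" for p
  proof (rule finite_subset[of _ "{..n}"], safe)
    fix k assume "p ^ k \<le> n"
    have "k < 2 ^ k" by (rule less_exp)
    also have "\<dots> \<le> p ^ k" using prime_ge_2_nat[OF that] by (rule power_mono) simp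
    finally show "k \<le> n" using \<open>p ^ k \<le> n\<close> by simp
  qed
  have e: "p ^ e p \<le> n" if "prime p" for p
  proof -
    have "0 \<in> {k. p ^ k \<le> n}" using False by simp
    hence "e p \<in> {k. p ^ k \<le> n}" unfolding e_def by (intro Max_in fin[OF that]) blast
    thus ?thesis by simp
  qed
  have e_max: "k \<le> e p" if "prime p" "p ^ k \<le> n" for p k
    unfolding e_def using that fin by (intro Max_ge) auto
  define M where "M = (\<Prod>p\<in>primes_upto n. p ^ e p)"
  have M0: "M > 0" unfolding M_def by (intro prod_pos) (auto simp: primes_upto_def prime_gt_0_nat)
  have "Lcm {1..n} dvd M"
  proof (rule Lcm_least)
    fix j assume j: "j \<in> {1..n}"
    show "j dvd M"
    proof (rule multiplicity_le_imp_dvd)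
      fix p :: nat assume p: "prime p"
      have le: "p ^ multiplicity p j \<le> n"
        using dvd_imp_le[OF multiplicity_dvd[of p j]] j by auto
      show "multiplicity p j \<le> multiplicity p M"
      proof (cases "p \<le> n")
        case True
        hence "multiplicity p M = e p" unfolding M_def
          by (subst multiplicity_prod_prime_powers) (use p in \<open>auto simp: primes_upto_def\<close>)
        thus ?thesis using e_max[OF p le] by simp
      next
        case False
        hence "\<not> p dvd j" using j by (auto dest: dvd_imp_le)
        thus ?thesis by (simp add: not_dvd_imp_multiplicity_0)
      qed
    qed (use j in auto)
  qed
  hence "Lcm {1..n} \<le> M" using M0 by (rule dvd_imp_le)
  also have "\<dots> \<le> (\<Prod>p\<in>primes_upto n. n)"
    unfolding M_def by (intro prod_mono) (auto simp: primes_upto_def e)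
  finally show ?thesis by simp
next
  case True
  hence "primes_upto n = {}" by (auto simp: primes_upto_def)
  thus ?thesis using True by simp
qed

text \<open>Comparing the two bounds for the least common multiple gives the order
  \<open>n / ln n\<close> of Chebyshev; a pure power is weaker but easier to compare with.\<close>

lemma card_primes_upto_ge:
  "eventually (\<lambda>n::nat. real n powr (4/5) \<le> real (card (primes_upto n))) at_top"
proof -
  have "eventually (\<lambda>n::nat. real n powr (4/5) * ln (real n) \<le> (real n - 1) * ln 2) at_top"
    by real_asymp
  moreover have "eventually (\<lambda>n::nat. n \<ge> 2) at_top" by (rule eventually_ge_at_top)
  ultimately show ?thesis
  proof eventually_elim
    case (elim n)
    define c where "c = card (primes_upto n)"
    have "2 ^ (n - 1) \<le> n ^ c" unfolding c_def
      using Lcm_lower_bound[of n] Lcm_upper_bound[of n] elim by linarith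
    hence "real (2 ^ (n - 1)) \<le> real (n ^ c)" by (simp only: of_nat_le_iff)
    hence "ln (2 ^ (n - 1)) \<le> ln (real n ^ c)" using elim by (subst ln_le_cancel_iff) auto
    hence "(real n - 1) * ln 2 \<le> real c * ln (real n)"
      using elim by (simp add: ln_realpow of_nat_diff)
    hence "real n powr (4/5) * ln (real n) \<le> real c * ln (real n)" using elim by linarith
    thus ?case using elim by (simp add: c_def)
  qed
qed

lemma power2_card_prime_divisors_le:
  fixes N :: nat
  assumes "N > 0"
  shows "finite {p. prime p \<and> p dvd N}" "2 ^ card {p. prime p \<and> p dvd N} \<le> N"
proof -
  have eq: "{p. prime p \<and> p dvd N} = prime_factors N" using assms by (auto simp: prime_factors_dvd)
  show "finite {p. prime p \<and> p dvd N}" unfolding eq by simp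
  have "(2::nat) ^ card (prime_factors N) = (\<Prod>p\<in>prime_factors N. 2)" by simp
  also have "\<dots> \<le> (\<Prod>p\<in>prime_factors N. p ^ multiplicity p N)"
  proof (intro prod_mono conjI)
    fix p assume p: "p \<in> prime_factors N"
    hence "p \<ge> 2" "multiplicity p N \<ge> 1" using prime_ge_2_nat by (auto simp: prime_factors_multiplicity)
    thus "2 \<le> p ^ multiplicity p N" using self_le_power[of p "multiplicity p N"] by simp
  qed auto
  also have "\<dots> = N" using prime_factorization_nat[OF assms] by simp
  finally show "2 ^ card {p. prime p \<and> p dvd N} \<le> N" unfolding eq .
qed

section \<open>Bad characters\<close>

lemma even_prime_characters_eq:
  "even_prime_characters D = (SIGMA q:primes_upto (nat \<lfloor>D\<rfloor>). even_characters q)"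
proof -
  have "real q \<le> D \<longleftrightarrow> q \<le> nat \<lfloor>D\<rfloor>" if "prime q" for q
    using prime_gt_0_nat[OF that] by linarith
  thus ?thesis by (auto simp: even_prime_characters_def primes_upto_def even_characters_def)
qed

lemma even_characters_bounds:
  assumes "prime q"
  shows "finite (even_characters q)" "card (even_characters q) \<le> q" "(q - 1) div 2 \<le> card (even_characters q)"
proof -
  obtain g where "residue_primroot q g"
    using prime_primitive_root_exists[of q] assms prime_gt_1_nat by auto
  then interpret primitive_root q g using assms by unfold_locales
  show "finite (even_characters q)" "card (even_characters q) \<le> q" by (fact finite_even_characters)+
  show "(q - 1) div 2 \<le> card (even_characters q)"
  proof (cases "q = 2")
    case False
    thus ?thesis using card_even_characters q_gt_1 by simp
  qed auto
qed

definition total_count :: "nat \<Rightarrow> nat" where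
  "total_count n = (\<Sum>q\<in>primes_upto n. card (even_characters q))"

text \<open>Any \<open>N\<close> distinct natural numbers sum to at least
  \<open>0 + 1 + ... + (N - 1)\<close>, and a prime \<open>q\<close> carries about
  \<open>q / 2\<close> even characters.\<close>

lemma total_count_lower:
  fixes N n :: nat
  defines "N \<equiv> card (primes_upto n)"
  shows "real N * (real N - 5) \<le> 4 * real (total_count n)"
proof -
  have "N * (N - 1) div 2 = \<Sum>{0..<N}"
    using gauss_sum_nat[of "N - 1"] by (cases N) (auto simp: atLeastLessThanSuc_atLeastAtMost mult.commute)
  also have "\<dots> \<le> \<Sum>(primes_upto n)" unfolding N_def by (rule card_sum_le_nat_sum)
  finally have "N * (N - 1) \<le> 2 * \<Sum>(primes_upto n) + 1" by linarith
  moreover have "even (N * (N - 1))" by (cases N) auto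
  ultimately have s: "N * (N - 1) \<le> 2 * \<Sum>(primes_upto n)" by presburger
  \<comment> \<open>The summand \<open>2\<close> pays for the rounding in
    \<open>(q - 1) div 2\<close>, also at \<open>q = 2\<close>.\<close>
  have "\<Sum>(primes_upto n) \<le> (\<Sum>q\<in>primes_upto n. 2 * card (even_characters q) + 2)"
  proof (rule sum_mono)
    fix q assume "q \<in> primes_upto n"
    hence "(q - 1) div 2 \<le> card (even_characters q)"
      using even_characters_bounds(3) by (auto simp: primes_upto_def)
    thus "q \<le> 2 * card (even_characters q) + 2" by linarith
  qed
  also have "\<dots> = 2 * total_count n + 2 * N"
    unfolding total_count_def sum.distrib sum_distrib_left N_def by simp
  finally have "N * (N - 1) \<le> 4 * total_count n + 4 * N" using s by linarith
  hence "real (N * (N - 1)) \<le> real (4 * total_count n + 4 * N)" by (simp only: of_nat_le_iff)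
  moreover have "real (N * (N - 1)) = real N * (real N - 1)" by (cases N) (auto simp: algebra_simps)
  ultimately show ?thesis by (simp add: algebra_simps)
qed

context eds_point begin

lemma h_sq: "h (int n) ^ 2 = 1 \<longleftrightarrow> H n ^ 2 = 1"
proof -
  have "h (int n) ^ 2 = 1 \<longleftrightarrow> (of_int (h (int n) ^ 2) :: rat) = of_int 1" by (simp only: of_int_eq_iff)
  thus ?thesis by (simp add: Hi_of_nat)
qed

text \<open>Pigeonhole twice: a prime \<open>k\<close> up to \<open>u\<close> outside the divisors
  of \<open>L\<close>, then a prime \<open>l\<close> up to \<open>v\<close> that also avoids the
  fewer than \<open>k ^ 2\<close> indices where \<open>H l\<close> and \<open>H (k * l)\<close> are
  both \<open>1\<close> or \<open>-1\<close>. Then \<open>l\<close> or \<open>k * l\<close>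
  serves.\<close>

lemma good_index_exists:
  fixes L u v :: nat
  assumes L: "L > 0" and y: "card {p. prime p \<and> p dvd L} < card (primes_upto u)"
    and z: "card {p. prime p \<and> p dvd L} + u ^ 2 < card (primes_upto v)"
  shows "\<exists>a\<in>{1..u * v}. coprime a L \<and> h (int a) ^ 2 \<noteq> 1"
proof -
  let ?D = "{p. prime p \<and> p dvd L}"
  have fin: "finite ?D" using power2_card_prime_divisors_le(1)[OF L] .
  have cop: "coprime p L" if "prime p" "p \<notin> ?D" for p
    using that prime_imp_coprime by blast
  have "\<not> primes_upto u \<subseteq> ?D" using card_mono[OF fin] y by (metis linorder_not_le)
  then obtain k where k: "prime k" "k \<le> u" "k \<notin> ?D" by (auto simp: primes_upto_def)
  let ?B = "{n. n \<ge> 1 \<and> H n ^ 2 = 1 \<and> H (k * n) ^ 2 = 1}"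
  have B: "finite ?B" "card ?B < k ^ 2" using card_unit_multiples[of k] prime_ge_2_nat[OF k(1)] by auto
  have "k ^ 2 \<le> u ^ 2" using k by (intro power_mono) auto
  hence lt: "card (?D \<union> ?B) < card (primes_upto v)"
    using card_Un_le[of ?D ?B] B z by linarith
  have "\<not> primes_upto v \<subseteq> ?D \<union> ?B"
  proof
    assume "primes_upto v \<subseteq> ?D \<union> ?B"
    from card_mono[OF finite_UnI[OF fin B(1)] this] lt show False by linarith
  qed
  then obtain l where l: "prime l" "l \<le> v" "l \<notin> ?D" "l \<notin> ?B" by (auto simp: primes_upto_def)
  have pos: "l \<ge> 1" "k \<ge> 1" using l(1) k(1) prime_ge_1_nat by auto
  have le: "l \<le> u * v" using pos k l mult_le_mono[of 1 u l v] by simp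
  have le': "k * l \<le> u * v" using k l mult_le_mono by blast
  consider "H l ^ 2 \<noteq> 1" | "H (k * l) ^ 2 \<noteq> 1" using l(4) pos by auto
  thus ?thesis
  proof cases
    case 1
    thus ?thesis using cop[OF l(1,3)] le pos by (intro bexI[of _ l]) (auto simp: h_sq)
  next
    case 2
    have "k * l \<ge> 1" using pos by simp
    thus ?thesis using cop[OF l(1,3)] cop[OF k(1,3)] le' 2 by (intro bexI[of _ "k * l"]) (auto simp: h_sq simp del: of_nat_mult)
  qed
qed

definition bad :: "nat \<Rightarrow> (int \<Rightarrow> complex) set" where
  "bad q = {\<chi> \<in> even_characters q. \<not> char_condition W x y (q, \<chi>)}"

text \<open>The primes where the estimate may fail: \<open>2\<close>, the divisors of
  \<open>h 2\<close>, which the period bound excludes, and those for which a usable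
  \<open>h a\<close> vanishes or has a square of order at most \<open>T\<close> modulo
  \<open>q\<close>.\<close>

definition exceptional :: "nat \<Rightarrow> nat \<Rightarrow> nat set" where
  "exceptional A T = {q. prime q \<and> (q = 2 \<or> int q dvd h 2 \<or>
     (\<exists>a\<in>{1..A}. \<exists>k\<in>{1..T}. h (int a) ^ 2 \<noteq> 1 \<and> int q dvd h (int a) * (h (int a) ^ (2 * k) - 1)))}"

text \<open>A violating character takes the value \<open>0\<close> or \<open>1\<close> at
  \<open>\<bar>h a\<bar>\<close>, and \<open>0\<close> is impossible since \<open>q\<close> does not
  divide \<open>h a\<close>; so the violating characters are among those of
  \<open>card_trivial_characters\<close>.\<close>

lemma bad_count:
  assumes pq: "prime q" "q \<notin> exceptional A T" and a: "a \<in> {1..A}" "h (int a) ^ 2 \<noteq> 1"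
    "coprime a (eds_period W x y q)" and T: "T \<ge> 1"
  shows "T * card (bad q) \<le> card (even_characters q)"
proof -
  obtain g where "residue_primroot q g"
    using prime_primitive_root_exists[of q] pq prime_gt_1_nat by auto
  then interpret primitive_root q g using pq by unfold_locales
  define b where "b = \<bar>h (int a)\<bar>"
  have nd: "\<not> int q dvd h (int a) * (h (int a) ^ (2 * k) - 1)" if "k \<in> {1..T}" for k
    using pq a that unfolding exceptional_def by blast
  have b: "\<not> int q dvd b" using nd[of 1] T by (auto simp: b_def)
  have "q > 2" using pq q_gt_1 by (auto simp: exceptional_def)
  have pw: "\<not> int q dvd b ^ (2 * k) - 1" if "1 \<le> k" "k < T" for k
    using nd[of k] that by (auto simp: b_def power_even_abs)
  have "bad q \<subseteq> {\<chi> \<in> even_characters q. \<chi> b = 1}"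
  proof
    fix \<chi> assume \<chi>: "\<chi> \<in> bad q"
    hence "dirichlet_character q \<chi>" by (auto simp: bad_def even_characters_def)
    hence "\<chi> b \<noteq> 0" using b coprime_iff[of b] by (simp add: dirichlet_character_def)
    moreover have "\<chi> b \<in> {0, 1}"
    proof (rule ccontr)
      assume "\<chi> b \<notin> {0, 1}"
      moreover have "coprime (int a) (int (eds_period W x y q))" using a by simp
      ultimately have "char_condition W x y (q, \<chi>)"
        unfolding char_condition_def b_def by (auto simp: eds_eq_h intro!: exI[of _ "int a"])
      thus False using \<chi> by (simp add: bad_def)
    qed
    ultimately show "\<chi> \<in> {\<chi> \<in> even_characters q. \<chi> b = 1}" using \<chi> by (auto simp: bad_def)
  qed
  hence "card (bad q) \<le> card {\<chi> \<in> even_characters q. \<chi> b = 1}"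
    using finite_even_characters by (intro card_mono) auto
  hence "T * card (bad q) \<le> T * card {\<chi> \<in> even_characters q. \<chi> b = 1}" by simp
  also have "\<dots> \<le> card (even_characters q)"
    using card_trivial_characters[OF \<open>q > 2\<close> b, of T] pw by blast
  finally show ?thesis .
qed

text \<open>A nonzero integer of size at most \<open>2 ^ e\<close> has at most \<open>e\<close>
  prime divisors. By \<open>h_growth\<close> this applies to the at most \<open>A * T\<close>
  integers \<open>N a k\<close> with \<open>e = 3 * \<kappa> * A ^ 3 * T\<close>. The summands of
  \<open>C\<close> account for the prime \<open>2\<close>, for \<open>h 2\<close>, and for these
  integers.\<close>

lemma card_exceptional:
  "\<exists>C. \<forall>A T. finite (exceptional A T) \<and> card (exceptional A T) \<le> C * (1 + T ^ 2 * A ^ 4)"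
proof -
  obtain K where K: "K \<ge> 2" "\<And>n::nat. \<bar>h (int n)\<bar> \<le> K ^ (n ^ 3)" using h_growth by blast
  define \<kappa> where "\<kappa> = nat K"
  have K': "K \<le> 2 ^ \<kappa>"
  proof -
    have "\<kappa> \<le> 2 ^ \<kappa>" by (rule less_imp_le[OF less_exp])
    hence "int \<kappa> \<le> int (2 ^ \<kappa>)" by (simp only: of_nat_le_iff)
    thus ?thesis using K(1) by (simp add: \<kappa>_def)
  qed
  define P where "P N = {q. prime q \<and> int q dvd N}" for N :: int
  have P: "finite (P N) \<and> card (P N) \<le> e" if "N \<noteq> 0" "\<bar>N\<bar> \<le> 2 ^ e" for N e
  proof -
    have eq: "P N = {p. prime p \<and> p dvd nat \<bar>N\<bar>}" unfolding P_def by (simp add: dvd_nat_abs_iff)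
    have "2 ^ card (P N) \<le> nat \<bar>N\<bar>" unfolding eq using that by (intro power2_card_prime_divisors_le) simp
    also have "\<dots> \<le> 2 ^ e" using that(2) by (simp add: nat_le_iff)
    finally have "card (P N) \<le> e" by simp
    moreover have "finite (P N)" unfolding eq using that by (intro power2_card_prime_divisors_le) simp
    ultimately show ?thesis by simp
  qed
  define c2 where "c2 = nat \<bar>h 2\<bar>"
  have c2: "\<bar>h 2\<bar> \<le> 2 ^ c2"
  proof -
    have "c2 \<le> 2 ^ c2" by (rule less_imp_le[OF less_exp])
    hence "int c2 \<le> int (2 ^ c2)" by (simp only: of_nat_le_iff)
    thus ?thesis by (simp add: c2_def)
  qed
  define N where "N a k = h (int a) * (h (int a) ^ (2 * k) - 1)" for a k :: nat
  define C where "C = 1 + c2 + 3 * \<kappa>"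
  have "finite (exceptional A T) \<and> card (exceptional A T) \<le> C * (1 + T ^ 2 * A ^ 4)" for A T
  proof -
    define I where "I = {(a, k). a \<in> {1..A} \<and> k \<in> {1..T} \<and> h (int a) ^ 2 \<noteq> 1}"
    have sub: "I \<subseteq> {1..A} \<times> {1..T}" by (auto simp: I_def)
    have finI: "finite I" by (rule finite_subset[OF sub]) simp
    have cardI: "card I \<le> A * T" using card_mono[OF _ sub] by simp
    have ex: "exceptional A T \<subseteq> {2} \<union> P (h 2) \<union> (\<Union>(a, k)\<in>I. P (N a k))"
    proof
      fix p assume p: "p \<in> exceptional A T"
      hence "p = 2 \<or> p \<in> P (h 2) \<or> (\<exists>a k. (a, k) \<in> I \<and> p \<in> P (N a k))"
        unfolding exceptional_def P_def N_def I_def by blast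
      thus "p \<in> {2} \<union> P (h 2) \<union> (\<Union>(a, k)\<in>I. P (N a k))" by auto
    qed
    have PN: "finite (P (N a k)) \<and> card (P (N a k)) \<le> \<kappa> * A ^ 3 * (3 * T)" if "(a, k) \<in> I" for a k
    proof (rule P)
      have ak: "a \<ge> 1" "a \<le> A" "k \<ge> 1" "k \<le> T" "h (int a) ^ 2 \<noteq> 1" using that by (auto simp: I_def)
      define u where "u = \<bar>h (int a)\<bar>"
      have u0: "u \<ge> 1" using h_nz[of "int a"] ak by (simp add: u_def)
      have "u \<noteq> 1" using ak(5) unfolding u_def by (metis power2_abs one_power2)
      hence u2: "u \<ge> 2" using u0 by simp
      have "u ^ (2 * k) > 1" using u2 ak by (intro one_less_power) auto
      hence pos: "h (int a) ^ (2 * k) > 1" by (simp add: u_def power_even_abs)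
      thus "N a k \<noteq> 0" using u0 by (auto simp: N_def u_def)
      have "\<bar>N a k\<bar> = u * (u ^ (2 * k) - 1)"
        using pos by (simp add: N_def abs_mult u_def power_even_abs)
      also have "\<dots> \<le> u * u ^ (2 * k)" using u0 by (intro mult_left_mono) auto
      also have "\<dots> = u ^ (2 * k + 1)" by simp
      also have "\<dots> \<le> (K ^ (a ^ 3)) ^ (2 * k + 1)" using K(2) u0 by (intro power_mono) (auto simp: u_def)
      also have "\<dots> \<le> ((2 ^ \<kappa>) ^ (a ^ 3)) ^ (2 * k + 1)" using K(1) K' by (intro power_mono) auto
      also have "\<dots> = 2 ^ (\<kappa> * a ^ 3 * (2 * k + 1))" by (simp only: power_mult)
      also have "\<dots> \<le> 2 ^ (\<kappa> * A ^ 3 * (3 * T))"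
        using ak by (intro power_increasing mult_le_mono power_mono) auto
      finally show "\<bar>N a k\<bar> \<le> 2 ^ (\<kappa> * A ^ 3 * (3 * T))" .
    qed
    have P2: "finite (P (h 2)) \<and> card (P (h 2)) \<le> c2" using P[OF h_nz[of 2] c2] by simp
    have fin: "finite (\<Union>(a, k)\<in>I. P (N a k))" using finI PN by auto
    have "card (\<Union>(a, k)\<in>I. P (N a k)) \<le> (\<Sum>(a, k)\<in>I. card (P (N a k)))"
      using card_UN_le[OF finI, of "\<lambda>(a, k). P (N a k)"] by (simp add: case_prod_unfold)
    also have "\<dots> \<le> (\<Sum>i\<in>I. \<kappa> * A ^ 3 * (3 * T))" using PN by (intro sum_mono) auto
    also have "\<dots> \<le> (A * T) * (\<kappa> * A ^ 3 * (3 * T))" using cardI by simp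
    also have "\<dots> = 3 * \<kappa> * (T ^ 2 * A ^ 4)" by (simp add: algebra_simps eval_nat_numeral)
    finally have c: "card (\<Union>(a, k)\<in>I. P (N a k)) \<le> 3 * \<kappa> * (T ^ 2 * A ^ 4)" .
    have finu: "finite ({2} \<union> P (h 2) \<union> (\<Union>(a, k)\<in>I. P (N a k)))" using fin P2 by simp
    have "card (exceptional A T) \<le> card ({2} \<union> P (h 2) \<union> (\<Union>(a, k)\<in>I. P (N a k)))"
      by (rule card_mono[OF finu ex])
    also have "\<dots> \<le> card ({2} \<union> P (h 2)) + card (\<Union>(a, k)\<in>I. P (N a k))" by (rule card_Un_le)
    also have "\<dots> \<le> card {2::nat} + card (P (h 2)) + card (\<Union>(a, k)\<in>I. P (N a k))" 
      using card_Un_le[of "{2}" "P (h 2)"] by simp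
    also have "\<dots> \<le> 1 + c2 + 3 * \<kappa> * (T ^ 2 * A ^ 4)" using P2 c by simp
    also have "\<dots> \<le> C * (1 + T ^ 2 * A ^ 4)" unfolding C_def by (simp add: algebra_simps)
    finally show ?thesis using finite_subset[OF ex finu] by simp
  qed
  thus ?thesis by blast
qed

end

section \<open>Density\<close>

definition root_floor :: "real \<Rightarrow> nat \<Rightarrow> nat" where
  "root_floor e n = nat \<lfloor>real n powr e\<rfloor>"

lemma root_floor_le: "real (root_floor e n) \<le> real n powr e"
  by (simp add: root_floor_def)

lemma root_floor_ge: "real n powr e - 1 \<le> real (root_floor e n)"
  unfolding root_floor_def by linarith

lemma filterlim_root_floor:
  assumes "e > 0"
  shows "filterlim (root_floor e) at_top sequentially"
proof -
  have "filterlim (\<lambda>n. real n powr e - 1) at_top sequentially"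
    using assms by real_asymp
  hence "filterlim (\<lambda>n. real (root_floor e n)) at_top sequentially"
    by (rule filterlim_at_top_mono) (simp add: root_floor_ge)
  thus ?thesis by (simp add: filterlim_sequentially_iff_filterlim_real)
qed

lemma card_primes_root_floor:
  assumes "e > 0"
  shows "eventually (\<lambda>n. (real n powr e - 1) powr (4/5) \<le> real (card (primes_upto (root_floor e n)))) sequentially"
proof -
  have "eventually (\<lambda>n. real (root_floor e n) powr (4/5) \<le> real (card (primes_upto (root_floor e n)))) sequentially"
    using card_primes_upto_ge filterlim_root_floor[OF assms] by (rule eventually_compose_filterlim)
  moreover have "eventually (\<lambda>n. real n powr e - 1 \<ge> 0) sequentially"
    using assms by real_asymp
  ultimately show ?thesis
  proof eventually_elim
    case (elim n)
    have "(real n powr e - 1) powr (4/5) \<le> real (root_floor e n) powr (4/5)"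
      using elim root_floor_ge by (intro powr_mono2) auto
    thus ?case using elim by linarith
  qed
qed

text \<open>The exponents balance three demands. Both ranges must contain more primes than a
  multiple of \<open>ln n\<close>; \<open>large\<close> must contain more primes than
  \<open>small ^ 2\<close>, and \<open>6/100 * 4/5 > 2/100\<close>; and about
  \<open>(small * large) ^ 4\<close>, that is \<open>n powr (28/100)\<close>, exceptional primes
  with at most \<open>n\<close> characters each must stay below the total, which has order at least
  \<open>n powr (8/5)\<close>.\<close>

abbreviation small :: "nat \<Rightarrow> nat" where "small \<equiv> root_floor (1/100)"
abbreviation large :: "nat \<Rightarrow> nat" where "large \<equiv> root_floor (6/100)"

text \<open>The left side bounds the number of prime divisors of a period, which is at most
  \<open>n ^ 6\<close>.\<close>

lemma eventually_card_small:
  "eventually (\<lambda>n. 6 * (ln (real n) / ln 2) < real (card (primes_upto (small n)))) sequentially"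
proof -
  have "eventually (\<lambda>n::nat. 6 * (ln (real n) / ln 2) < (real n powr (1/100) - 1) powr (4/5)) sequentially"
    by real_asymp
  with card_primes_root_floor[of "1/100", simplified] show ?thesis
    by eventually_elim simp
qed

lemma eventually_card_large:
  "eventually (\<lambda>n. 6 * (ln (real n) / ln 2) + real (small n ^ 2) < real (card (primes_upto (large n)))) sequentially"
proof -
  have "eventually (\<lambda>n::nat. 6 * (ln (real n) / ln 2) + (real n powr (1/100)) ^ 2 
      < (real n powr (6/100) - 1) powr (4/5)) sequentially"
    by real_asymp
  moreover have "eventually (\<lambda>n. (real n powr (6/100) - 1) powr (4/5)
      \<le> real (card (primes_upto (large n)))) sequentially"
    by (rule card_primes_root_floor) simp
  ultimately show ?thesis
  proof eventually_elim
    case (elim n)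
    have "real (small n ^ 2) \<le> (real n powr (1/100)) ^ 2"
      unfolding of_nat_power by (intro power_mono root_floor_le) simp
    thus ?case using elim by linarith
  qed
qed

lemma eventually_total_count:
  fixes c :: real
  assumes c: "c > 0"
  shows "eventually (\<lambda>n. c * (1 + real ((small n * large n) ^ 4)) * real n \<le> real (total_count n)) sequentially"
proof -
  have "eventually (\<lambda>n::nat. 4 * (c * (1 + (real n powr (1/100) * real n powr (6/100)) ^ 4) * real n)
      \<le> real n powr (4/5) * (real n powr (4/5) - 5)) sequentially"
    using c by real_asymp
  moreover have "eventually (\<lambda>n::nat. real n powr (4/5) \<ge> 5) sequentially" by real_asymp
  moreover note card_primes_upto_ge
  ultimately show ?thesis
  proof eventually_elim
    case (elim n)
    define N where "N = card (primes_upto n)"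
    have "real ((small n * large n) ^ 4) \<le> (real n powr (1/100) * real n powr (6/100)) ^ 4"
      unfolding of_nat_power of_nat_mult by (intro power_mono mult_mono root_floor_le) auto
    hence "4 * (c * (1 + real ((small n * large n) ^ 4)) * real n)
      \<le> 4 * (c * (1 + (real n powr (1/100) * real n powr (6/100)) ^ 4) * real n)"
      using c by (intro mult_left_mono mult_right_mono add_left_mono) auto
    also have "\<dots> \<le> real n powr (4/5) * (real n powr (4/5) - 5)" by (rule elim(1))
    also have "\<dots> \<le> real N * (real N - 5)"
      using elim(2,3) unfolding N_def by (intro mult_mono) auto
    also have "\<dots> \<le> 4 * real (total_count n)" unfolding N_def by (rule total_count_lower)
    finally show ?case by simp
  qed
qed

context eds_point begin

section \<open>Summation over the primes and the limit\<close>

lemma bad_subset: "bad q \<subseteq> even_characters q"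
  by (auto simp: bad_def)

text \<open>Outside the exceptional primes \<open>bad_count\<close> gives the fraction
  \<open>1 / T\<close>. At the exceptional ones all characters are counted, and their number times
  \<open>T\<close> is eventually at most \<open>total_count n\<close> again; hence the factor
  \<open>2\<close>.\<close>

lemma bad_sum:
  assumes T: "T \<ge> 1"
  shows "eventually (\<lambda>n. T * (\<Sum>q\<in>primes_upto n. card (bad q)) \<le> 2 * total_count n) sequentially"
proof -
  obtain C where C: "\<And>A T. finite (exceptional A T)" "\<And>A T. card (exceptional A T) \<le> C * (1 + T ^ 2 * A ^ 4)"
    using card_exceptional by blast
  \<comment> \<open>Large enough for the contribution \<open>C * (1 + T ^ 2 * A ^ 4) * T * n\<close>
    of the exceptional primes; \<open>C + 1\<close> keeps it positive even if
    \<open>C = 0\<close>.\<close>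
  define c where "c = real (T * (C + 1) * T ^ 2)"
  have "T * (C + 1) * T ^ 2 > 0" using T by simp
  hence c: "c > 0" unfolding c_def by (simp only: of_nat_0_less_iff)
  show ?thesis
    using eventually_card_small eventually_card_large eventually_total_count[OF c] eventually_ge_at_top[of 1]
  proof eventually_elim
    case (elim n)
    define A where "A = small n * large n"
    define E where "E = exceptional A T"
    have good: "T * card (bad q) \<le> card (even_characters q)" if q: "q \<in> primes_upto n" "q \<notin> E" for q
    proof -
      define L where "L = eds_period W x y q"
      have pq: "prime q" "q \<le> n" using q by (auto simp: primes_upto_def)
      have "\<not> int q dvd h 2" using q pq by (auto simp: E_def exceptional_def)
      hence L: "1 \<le> L" "L \<le> q ^ 6" using eds_period_bounds[OF pq(1)] by (auto simp: L_def)
      let ?w = "card {p. prime p \<and> p dvd L}"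
      have "2 ^ ?w \<le> L" using L by (intro power2_card_prime_divisors_le) simp
      also have "\<dots> \<le> n ^ 6" by (rule order_trans[OF L(2)]) (simp add: power_mono pq(2))
      finally have "real (2 ^ ?w) \<le> real (n ^ 6)" by (simp only: of_nat_le_iff)
      hence "ln (2 ^ ?w) \<le> ln (real n ^ 6)" using elim by (subst ln_le_cancel_iff) auto
      hence "real ?w * ln 2 \<le> 6 * ln (real n)" using elim by (simp add: ln_realpow)
      hence w: "real ?w \<le> 6 * (ln (real n) / ln 2)" by (simp add: field_simps)
      have "\<exists>a\<in>{1..small n * large n}. coprime a L \<and> h (int a) ^ 2 \<noteq> 1"
      proof (rule good_index_exists)
        show "?w < card (primes_upto (small n))" using w elim(1) by simp
        have "real (?w + small n ^ 2) < real (card (primes_upto (large n)))" using w elim(2) by simp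
        thus "?w + small n ^ 2 < card (primes_upto (large n))" by (simp only: of_nat_less_iff)
      qed (use L in simp)
      then obtain a where "a \<in> {1..A}" "coprime a L" "h (int a) ^ 2 \<noteq> 1" unfolding A_def by blast
      thus ?thesis using bad_count[OF pq(1) q(2)[unfolded E_def] _ _ _ T] by (simp add: L_def)
    qed
    have le: "T * card (bad q) \<le> card (even_characters q) + (if q \<in> E then T * n else 0)"
      if q: "q \<in> primes_upto n" for q
    proof (cases "q \<in> E")
      case True
      have pq: "prime q" "q \<le> n" using q by (auto simp: primes_upto_def)
      have "card (bad q) \<le> card (even_characters q)"
        using bad_subset even_characters_bounds(1)[OF pq(1)] by (intro card_mono)
      also have "\<dots> \<le> n" using even_characters_bounds(2)[OF pq(1)] pq(2) by simp
      finally show ?thesis using True by (simp add: trans_le_add2)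
    qed (use good q in simp)
    have "T * (\<Sum>q\<in>primes_upto n. card (bad q)) = (\<Sum>q\<in>primes_upto n. T * card (bad q))"
      by (rule sum_distrib_left)
    also have "\<dots> \<le> (\<Sum>q\<in>primes_upto n. card (even_characters q) + (if q \<in> E then T * n else 0))"
      using le by (rule sum_mono)
    also have "\<dots> = total_count n + (\<Sum>q\<in>primes_upto n \<inter> E. T * n)"
      unfolding sum.distrib total_count_def sum.inter_restrict[OF finite_primes_upto] ..
    also have "(\<Sum>q\<in>primes_upto n \<inter> E. T * n) \<le> card E * (T * n)"
      using C(1) by (simp add: E_def card_mono)
    also have "card E * (T * n) \<le> (C * (1 + T ^ 2 * A ^ 4)) * (T * n)"
      unfolding E_def by (intro mult_right_mono C(2)) simp
    also have "(C * (1 + T ^ 2 * A ^ 4)) * (T * n) \<le> T * (C + 1) * T ^ 2 * (1 + A ^ 4) * n"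
    proof -
      have "1 + T ^ 2 * A ^ 4 \<le> T ^ 2 * (1 + A ^ 4)" using T by (simp add: algebra_simps)
      hence "C * (1 + T ^ 2 * A ^ 4) \<le> (C + 1) * (T ^ 2 * (1 + A ^ 4))" by (intro mult_le_mono) auto
      hence "(C * (1 + T ^ 2 * A ^ 4)) * (T * n) \<le> ((C + 1) * (T ^ 2 * (1 + A ^ 4))) * (T * n)"
        by (rule mult_right_mono) simp
      thus ?thesis by (simp only: mult_ac)
    qed
    also have "T * (C + 1) * T ^ 2 * (1 + A ^ 4) * n \<le> total_count n"
    proof -
      have "real (T * (C + 1) * T ^ 2 * (1 + A ^ 4) * n) = c * (1 + real (A ^ 4)) * real n"
        unfolding c_def by (simp only: of_nat_mult of_nat_add of_nat_1)
      hence "real (T * (C + 1) * T ^ 2 * (1 + A ^ 4) * n) \<le> real (total_count n)"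
        using elim(3) unfolding A_def by linarith
      thus ?thesis by (simp only: of_nat_le_iff)
    qed
    finally show "T * (\<Sum>q\<in>primes_upto n. card (bad q)) \<le> 2 * total_count n" by simp
  qed
qed

lemma total_count_pos: "eventually (\<lambda>n. total_count n > 0) sequentially"
  using eventually_total_count[of 1, simplified] eventually_ge_at_top[of 1]
proof eventually_elim
  case (elim n)
  have "(1 + real ((small n * large n) ^ 4)) * real n > 0"
    using elim(2) by (intro mult_pos_pos add_pos_nonneg) auto
  thus ?case using elim(1) by simp
qed

lemma card_even_prime_characters: "card (even_prime_characters D) = total_count (nat \<lfloor>D\<rfloor>)"
  unfolding even_prime_characters_eq total_count_def
  by (rule card_SigmaI) (auto simp: primes_upto_def even_characters_bounds(1))

lemma card_good:
  "real (card {\<chi> \<in> even_prime_characters D. char_condition W x y \<chi>})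
    = real (total_count (nat \<lfloor>D\<rfloor>)) - real (\<Sum>q\<in>primes_upto (nat \<lfloor>D\<rfloor>). card (bad q))"
proof -
  let ?S = "even_prime_characters D" and ?B = "SIGMA q:primes_upto (nat \<lfloor>D\<rfloor>). bad q"
  have fin: "finite ?S"
    unfolding even_prime_characters_eq by (auto simp: primes_upto_def[of "nat \<lfloor>D\<rfloor>"] even_characters_bounds(1)
      intro!: finite_SigmaI finite_primes_upto[unfolded primes_upto_def])
  have sub: "?B \<subseteq> ?S" unfolding even_prime_characters_eq using bad_subset by auto
  have "{\<chi> \<in> ?S. char_condition W x y \<chi>} = ?S - ?B"
    unfolding even_prime_characters_eq by (auto simp: bad_def)
  hence "card {\<chi> \<in> ?S. char_condition W x y \<chi>} = card ?S - card ?B"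
    using card_Diff_subset[OF finite_subset[OF sub fin] sub] by simp
  moreover have "card ?B = (\<Sum>q\<in>primes_upto (nat \<lfloor>D\<rfloor>). card (bad q))"
    by (rule card_SigmaI) (auto simp: primes_upto_def intro: finite_subset[OF bad_subset even_characters_bounds(1)])
  moreover have "card ?B \<le> card ?S" by (rule card_mono[OF fin sub])
  ultimately show ?thesis by (simp add: card_even_prime_characters of_nat_diff)
qed

text \<open>The counts depend on \<open>D\<close> only through its floor, so the limit is taken
  along the natural numbers. There \<open>bad_sum\<close> bounds the proportion of violating
  characters by \<open>2 / T\<close>, eventually for each fixed \<open>T\<close>.\<close>

theorem density_one:
  "((\<lambda>D::real. real (card {\<chi> \<in> even_prime_characters D. char_condition W x y \<chi>})
    / real (card (even_prime_characters D))) \<longlongrightarrow> 1) at_top"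
proof -
  define r where "r n = (real (total_count n) - real (\<Sum>q\<in>primes_upto n. card (bad q))) / real (total_count n)" for n
  have "r \<longlonglongrightarrow> 1"
  proof (rule tendstoI)
    fix e :: real assume e: "e > 0"
    obtain T where T: "2 / e < real T" using reals_Archimedean2 by blast
    have "0 < 2 / e" using e by simp
    hence T0: "real T > 0" using T by linarith
    hence T1: "T \<ge> 1" by simp
    show "eventually (\<lambda>n. dist (r n) 1 < e) sequentially"
      using bad_sum[OF T1] total_count_pos
    proof eventually_elim
      case (elim n)
      define B F where "B = real (\<Sum>q\<in>primes_upto n. card (bad q))" and "F = real (total_count n)"
      have F: "F > 0" using elim by (simp add: F_def)
      have "real (T * (\<Sum>q\<in>primes_upto n. card (bad q))) \<le> real (2 * total_count n)"
        using elim(1) by (simp only: of_nat_le_iff)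
      hence BF: "real T * B \<le> 2 * F" by (simp add: B_def F_def)
      have "r n - 1 = - (B / F)" using F by (simp add: r_def B_def F_def diff_divide_distrib)
      moreover have "0 \<le> B / F" using F by (simp add: B_def sum_nonneg)
      ultimately have "dist (r n) 1 = B / F" unfolding dist_real_def by linarith
      also have "B / F \<le> 2 / real T" using BF F T0 by (simp add: field_simps)
      also have "\<dots> < e" using T e T0 by (simp add: field_simps)
      finally show ?case .
    qed
  qed
  moreover have "filterlim (\<lambda>D::real. nat \<lfloor>D\<rfloor>) sequentially at_top"
    unfolding filterlim_at_top
  proof
    fix Z :: nat
    show "eventually (\<lambda>D::real. Z \<le> nat \<lfloor>D\<rfloor>) at_top"
      using eventually_ge_at_top[of "real Z"] by eventually_elim (rule le_nat_floor)
  qed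
  ultimately have "((\<lambda>D::real. r (nat \<lfloor>D\<rfloor>)) \<longlongrightarrow> 1) at_top"
    by (rule filterlim_compose)
  thus ?thesis unfolding card_good card_even_prime_characters r_def .
qed

end

theorem theorem6p1:
  fixes W :: "int weierstrass" and x y :: int
  assumes "discriminant W \<noteq> 0"
    and "\<not> has_CM (map_weierstrass of_int W)"
    and "on_curve W x y"
    and "infinite_order (rat_curve W) (rat_point x y)"
    and "everywhere_good_reduction W x y"
  shows "((\<lambda>D::real.
            real (card {\<chi> \<in> even_prime_characters D. char_condition W x y \<chi>})
            / real (card (even_prime_characters D))) \<longlongrightarrow> 1) at_top"
proof -
  interpret eds_point W x y using assms(3-5) by unfold_locales
  show ?thesis by (rule density_one)
qed

end
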